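(* Let $r>0$, $a\le0$, $\tau>0$ and let $g$ be a probability density on $[0,\pi)$. Then there exists a stationary segment process in $\mathbb{R}^2$ (with segments of fixed length $r$) with conditional intensity $$\lambda^*(\mathbf{x},u)=\tau\,g(\varphi)\exp\big(aN_{\mathbf{x}}(u)\big),\qquad u=(y,\varphi)\in\mathbb{R}^2\times[0,\pi),$$ where $N_{\mathbf{x}}(u)$ is the number of segments of $\mathbf{x}\setminus\{u\}$ hit by the segment $u$.
   Context: A segment of fixed length $r$ in $\mathbb{R}^2$ is parametrized by $u=(y,\varphi)$ with centre $y\in\mathbb{R}^2$ and axial direction $\varphi\in[0,\pi)$. Segment $u$ hits segment $v$ (written $u\uparrow v$) if, as closed subsets of $\mathbb{R}^2$, they have nonempty intersection. A segment process in $\mathbb{R}^2$ is a simple point process $X$ on $\mathbb{R}^2\times[0,\pi)$ such that almost surely only finitely many segments have centre in any given bounded set. It is stationary if its distribution is invariant under the shifts $(y,\varphi)\mapsto(y+t,\varphi)$, $t\in\mathbb{R}^2$. The process $X$ has conditional intensity $\lambda^*$ (with respect to the reference measure $\lambda(\mathrm{d}u)=\mathrm{d}y\,\frac1\pi\mathrm{d}\varphi$) if the Georgii-Nguyen-Zessin formula $$\mathbb{E}\Big[\sum_{u\in X}q(u,X\setminus\{u\})\Big]=\int_{\mathbb{R}^2\times[0,\pi)}\mathbb{E}\big[\lambda^*(X,u)\,q(u,X)\big]\,\lambda(\mathrm{d}u)$$ holds for every nonnegative measurable function $q$ of a segment $u$ and a locally finite configuration of segments. *)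

theory Defs
  imports "HOL-Probability.Probability"
begin

(* (y, phi): centre and axial direction; phi is meant to range over {0..<pi}, see seg_space. *)
type_synonym seg = "(real ^ 2) \<times> real"

definition seg_set :: "real \<Rightarrow> seg \<Rightarrow> (real ^ 2) set" where
  "seg_set r u = (let e = vector [cos (snd u), sin (snd u)] :: real ^ 2
     in closed_segment (fst u - (r / 2) *\<^sub>R e) (fst u + (r / 2) *\<^sub>R e))"

definition hits :: "real \<Rightarrow> seg \<Rightarrow> seg \<Rightarrow> bool" where
  "hits r u v \<longleftrightarrow> seg_set r u \<inter> seg_set r v \<noteq> {}"

definition seg_space :: "seg measure" where
  "seg_space = borel \<Otimes>\<^sub>M restrict_space borel {0..<pi}"

definition ref_measure :: "seg measure" where
  "ref_measure =
     lborel \<Otimes>\<^sub>M density (restrict_space lborel {0..<pi}) (\<lambda>_. ennreal (1 / pi))"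

definition locally_finite :: "seg set \<Rightarrow> bool" where
  "locally_finite x \<longleftrightarrow> (\<forall>B. bounded B \<longrightarrow> finite {u \<in> x. fst u \<in> B})"

(* Simple configurations are sets of segments. The sigma-algebra is the one generated by the
   counting maps with values in {0, 1, ..., infinity}; as card is 0 on infinite sets, finiteness
   is part of the event "exactly n points in B". *)
definition config_space :: "seg set measure" where
  "config_space = sigma (Pow (space seg_space))
     {{x \<in> Pow (space seg_space). finite (x \<inter> B) \<and> card (x \<inter> B) = n} | B n. B \<in> sets seg_space}"

definition lf_config_space :: "seg set measure" where
  "lf_config_space = restrict_space config_space {x. locally_finite x}"

definition segment_process :: "'w measure \<Rightarrow> ('w \<Rightarrow> seg set) \<Rightarrow> bool" where
  "segment_process M X \<longleftrightarrow>
     prob_space M \<and> X \<in> M \<rightarrow>\<^sub>M config_space \<and> (AE \<omega> in M. locally_finite (X \<omega>))"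

definition shift :: "real ^ 2 \<Rightarrow> seg set \<Rightarrow> seg set" where
  "shift t x = (\<lambda>(y, \<phi>). (y + t, \<phi>)) ` x"

definition stationary :: "'w measure \<Rightarrow> ('w \<Rightarrow> seg set) \<Rightarrow> bool" where
  "stationary M X \<longleftrightarrow>
     (\<forall>t. distr M config_space (\<lambda>\<omega>. shift t (X \<omega>)) = distr M config_space X)"

(* The Georgii-Nguyen-Zessin formula. The sum over the (in general infinite) configuration is
   the integral with respect to counting measure on it. *)
definition has_conditional_intensity ::
  "'w measure \<Rightarrow> ('w \<Rightarrow> seg set) \<Rightarrow> (seg set \<Rightarrow> seg \<Rightarrow> ennreal) \<Rightarrow> bool" where
  "has_conditional_intensity M X lam \<longleftrightarrow>
     (\<lambda>(u, x). lam x u) \<in> borel_measurable (seg_space \<Otimes>\<^sub>M lf_config_space) \<and>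
     (\<forall>q :: seg \<times> seg set \<Rightarrow> ennreal. q \<in> borel_measurable (seg_space \<Otimes>\<^sub>M lf_config_space) \<longrightarrow>
       (\<integral>\<^sup>+\<omega>. (\<integral>\<^sup>+u. q (u, X \<omega> - {u}) \<partial>count_space (X \<omega>)) \<partial>M) =
       (\<integral>\<^sup>+u. (\<integral>\<^sup>+\<omega>. lam (X \<omega>) u * q (u, X \<omega>) \<partial>M) \<partial>ref_measure))"

(* Only meaningful for locally finite x, where the counted set is finite: segments of
   length r that meet have centres at distance at most r. *)
definition num_hits :: "real \<Rightarrow> seg set \<Rightarrow> seg \<Rightarrow> nat" where
  "num_hits r x u = card {v \<in> x - {u}. hits r u v}"

end

theory Submission
  imports Defs
begin

text \<open>In a bounded window a process with this conditional intensity is given by a density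
with respect to a Poisson process, proportional to \<open>exp (a * H)\<close> with
\<open>H\<close> the number of hitting pairs. There the Georgii-Nguyen-Zessin (GNZ) formula
follows from Mecke's formula for the Poisson process, because inserting a segment multiplies the
density by the exponential of \<open>a\<close> times its number of hits
(\<open>GNZ_gibbs\<close>). A process in the plane is obtained as a limit of these. Nothing forces
a unique limit, so it is taken by compactness.

As \<open>a \<le> 0\<close>, the conditional intensity never exceeds that of the Poisson process,
whatever the configuration. Applying this bound once for every point in a window \<open>W\<close>
shows that the configuration in \<open>W\<close>, jointly with the configuration outside, is
dominated by an (unnormalized) Poisson measure that depends on \<open>W\<close> only
(\<open>dominated_by_poisson\<close>). Thanks to this estimate the limit can be taken without a
topology on the space of configurations.

Stationarity is arranged by averaging the process in a ball over random shifts. The GNZ formula is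
shift covariant and remains exact for segments in a ball of half the radius
(\<open>GNZ_avg\<close>), and a further shift changes the averaged law only by a boundary term
(\<open>avg_shift_le\<close>).

By Tychonoff's theorem the probabilities of all events converge along some filter finer than the
usual one on the indices. The limit is only finitely additive, but by domination it is countably
additive on the events of each window (\<open>emeasure_local_law\<close>), and the law in a window
and the next annulus is absolutely continuous with respect to the product of the law in the window
and a Poisson measure. The Radon-Nikodym density yields a kernel that extends a configuration to
the next window (\<open>extension_kernel\<close>), and the Ionescu-Tulcea theorem joins the
kernels to a process in the plane (\<open>limit_measure_exists\<close>).

The interaction has finite range. Hence, for test functions that live in a window and vanish on
configurations with too many points there, both sides of the GNZ formula are integrals of bounded
functions of the configuration in a larger window, and the formula passes to the limit
(\<open>GNZ_limit_law_local\<close>). Such test functions determine both sides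
(\<open>GNZ_limit_law\<close>).\<close>

section \<open>Locally finite configurations and sums over them\<close>

lemma space_seg_space: "space seg_space = UNIV \<times> {0..<pi}"
  by (auto simp: seg_space_def space_pair_measure space_restrict_space)

lemma fst_seg_measurable [measurable]: "fst \<in> seg_space \<rightarrow>\<^sub>M borel"
  unfolding seg_space_def by measurable

lemma snd_seg_measurable [measurable]: "snd \<in> seg_space \<rightarrow>\<^sub>M restrict_space borel {0..<pi}"
  unfolding seg_space_def by measurable

lemma id_seg_borel: "(\<lambda>u. u) \<in> seg_space \<rightarrow>\<^sub>M borel"
proof -
  have "snd \<in> seg_space \<rightarrow>\<^sub>M borel"
    using measurable_restrict_space2_iff[of snd seg_space borel] snd_seg_measurable by blast
  then have "(\<lambda>u. (fst u, snd u)) \<in> seg_space \<rightarrow>\<^sub>M (borel \<Otimes>\<^sub>M borel)"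
    by (intro measurable_Pair) auto
  then show ?thesis by (simp add: borel_prod)
qed

text \<open>The bounded windows on which configurations are inspected. They exhaust the segment
space, and the smallest one is empty.\<close>
definition win :: "nat \<Rightarrow> seg set" where
  "win k = {u \<in> space seg_space. norm (fst u) < real k}"

lemma win_sets [measurable]: "win k \<in> sets seg_space"
  unfolding win_def by measurable

lemma win_mono: "j \<le> k \<Longrightarrow> win j \<subseteq> win k"
  by (auto simp: win_def)

lemma mem_some_win: "u \<in> space seg_space \<Longrightarrow> \<exists>k. u \<in> win k"
  using reals_Archimedean2[of "norm (fst u)"] by (auto simp: win_def)

lemma space_config_space: "space config_space = Pow (space seg_space)"
  unfolding config_space_def by (intro space_measure_of) auto

lemma mem_space_lf_config:
  "x \<in> space lf_config_space \<longleftrightarrow> x \<subseteq> space seg_space \<and> (\<forall>k. finite (x \<inter> win k))"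
proof -
  have "locally_finite x \<longleftrightarrow> (\<forall>k. finite (x \<inter> win k))" if x: "x \<subseteq> space seg_space"
  proof
    assume lf: "locally_finite x"
    show "\<forall>k. finite (x \<inter> win k)"
    proof
      fix k
      have "finite {u \<in> x. fst u \<in> ball 0 (real k)}"
        using lf unfolding locally_finite_def by blast
      then show "finite (x \<inter> win k)"
        by (rule rev_finite_subset) (auto simp: win_def)
    qed
  next
    assume fin: "\<forall>k. finite (x \<inter> win k)"
    show "locally_finite x" unfolding locally_finite_def
    proof (intro allI impI)
      fix B :: "(real^2) set" assume "bounded B"
      then obtain b where b: "\<And>y. y \<in> B \<Longrightarrow> norm y \<le> b" by (auto simp: bounded_iff)
      obtain k where "b < real k" using reals_Archimedean2 by blast
      with b x have "{u \<in> x. fst u \<in> B} \<subseteq> x \<inter> win k" by (force simp: win_def)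
      with fin show "finite {u \<in> x. fst u \<in> B}" by (meson finite_subset)
    qed
  qed
  then show ?thesis
    by (auto simp: lf_config_space_def space_restrict_space space_config_space)
qed

lemma lf_config_finite: "x \<in> space lf_config_space \<Longrightarrow> B \<subseteq> win k \<Longrightarrow> finite (x \<inter> B)"
  unfolding mem_space_lf_config by (meson finite_subset inf_mono order_refl)

lemma lf_config_subset: "x \<in> space lf_config_space \<Longrightarrow> y \<subseteq> x \<Longrightarrow> y \<in> space lf_config_space"
  unfolding mem_space_lf_config by (meson finite_subset inf_mono order_refl order_trans)

lemma finite_in_lf_config: "finite x \<Longrightarrow> x \<subseteq> space seg_space \<Longrightarrow> x \<in> space lf_config_space"
  unfolding mem_space_lf_config by auto

lemma lf_config_union:
  "x \<in> space lf_config_space \<Longrightarrow> y \<in> space lf_config_space \<Longrightarrow> x \<union> y \<in> space lf_config_space"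
  unfolding mem_space_lf_config by (auto simp: Int_Un_distrib2)

lemma lf_config_insert:
  "u \<in> space seg_space \<Longrightarrow> x \<in> space lf_config_space \<Longrightarrow> insert u x \<in> space lf_config_space"
  unfolding mem_space_lf_config by (auto simp: Int_insert_left)

lemma lf_config_countable: assumes "x \<in> space lf_config_space" shows "countable x"
proof -
  have "x = (\<Union>k. x \<inter> win k)"
    using assms mem_some_win unfolding mem_space_lf_config by blast
  moreover have "countable (\<Union>k. x \<inter> win k)"
    using assms by (intro countable_UN) (auto simp: mem_space_lf_config countable_finite)
  ultimately show ?thesis by simp
qed

abbreviation window_event :: "nat \<Rightarrow> seg set set \<Rightarrow> seg set set" where
  "window_event k A \<equiv> {x \<in> space lf_config_space. x \<inter> win k \<in> A}"

lemma sum_count_eq: 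
  "(\<integral>\<^sup>+u. f u \<partial>count_space x) = (\<integral>\<^sup>+u. f u * indicator x u \<partial>count_space UNIV)"
  for f :: "'a \<Rightarrow> ennreal"
  by (rule nn_integral_count_space_indicator) auto

lemma sum_indicator_eq:
  "(\<integral>\<^sup>+u. indicator B u \<partial>count_space x) = (if finite (x \<inter> B) then of_nat (card (x \<inter> B)) else \<top>)"
proof -
  have "(\<integral>\<^sup>+u. indicator B u \<partial>count_space x) = (\<integral>\<^sup>+u. indicator (x \<inter> B) u \<partial>count_space x)"
    by (intro nn_integral_cong) (auto split: split_indicator)
  also have "\<dots> = emeasure (count_space x) (x \<inter> B)" by (subst nn_integral_indicator) auto
  also have "\<dots> = (if finite (x \<inter> B) then of_nat (card (x \<inter> B)) else \<top>)"
    by (simp add: emeasure_count_space)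
  finally show ?thesis .
qed

lemma config_generator_measurable:
  assumes "B \<in> sets seg_space"
  shows "{x \<in> space lf_config_space. finite (x \<inter> B) \<and> card (x \<inter> B) = n} \<in> sets lf_config_space"
proof -
  have "{x \<in> Pow (space seg_space). finite (x \<inter> B) \<and> card (x \<inter> B) = n} \<in> sets config_space"
    using assms unfolding config_space_def by (intro in_measure_of) auto
  then have "{x. locally_finite x} \<inter> {x \<in> Pow (space seg_space). finite (x \<inter> B) \<and> card (x \<inter> B) = n}
     \<in> sets lf_config_space"
    unfolding lf_config_space_def sets_restrict_space by blast
  also have "{x. locally_finite x} \<inter> {x \<in> Pow (space seg_space). finite (x \<inter> B) \<and> card (x \<inter> B) = n}
     = {x \<in> space lf_config_space. finite (x \<inter> B) \<and> card (x \<inter> B) = n}"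
    by (auto simp: lf_config_space_def space_restrict_space space_config_space)
  finally show ?thesis .
qed

lemma card_measurable:
  assumes B: "B \<in> sets seg_space" "B \<subseteq> win k"
  shows "(\<lambda>x. card (x \<inter> B)) \<in> lf_config_space \<rightarrow>\<^sub>M count_space UNIV"
proof (subst measurable_count_space_eq2_countable, safe)
  fix n
  have "(\<lambda>x. card (x \<inter> B)) -` {n} \<inter> space lf_config_space
    = {x \<in> space lf_config_space. finite (x \<inter> B) \<and> card (x \<inter> B) = n}"
    using lf_config_finite[OF _ B(2)] by auto
  then show "(\<lambda>x. card (x \<inter> B)) -` {n} \<inter> space lf_config_space \<in> sets lf_config_space"
    using config_generator_measurable[OF B(1)] by simp
qed auto

lemma sum_indicator_measurable:
  assumes B: "B \<in> sets seg_space" "B \<subseteq> win k"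
  shows "(\<lambda>x. \<integral>\<^sup>+u. indicator B u \<partial>count_space x) \<in> borel_measurable lf_config_space"
proof -
  have "(\<lambda>x. of_nat (card (x \<inter> B)) :: ennreal) \<in> borel_measurable lf_config_space"
    by (rule measurable_compose[OF card_measurable[OF B]]) simp
  then show ?thesis
    by (rule measurable_cong[THEN iffD1, rotated]) (simp add: sum_indicator_eq lf_config_finite[OF _ B(2)])
qed

lemma sum_over_windows:
  assumes x: "x \<in> space lf_config_space" 
  shows "(\<integral>\<^sup>+u. f u \<partial>count_space x) = (SUP k. \<integral>\<^sup>+u. f u * indicator (win k) u \<partial>count_space x)"
proof -
  have "(\<integral>\<^sup>+u. f u \<partial>count_space x) = (\<integral>\<^sup>+u. (SUP k. f u * indicator (win k) u) \<partial>count_space x)"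
  proof (intro nn_integral_cong)
    fix u assume "u \<in> space (count_space x)"
    then have "u \<in> space seg_space" using x by (auto simp: mem_space_lf_config)
    then obtain k where "u \<in> win k" using mem_some_win by blast
    then have "f u \<le> (SUP k. f u * indicator (win k) u)" by (intro SUP_upper2[of k]) auto
    moreover have "(SUP k. f u * indicator (win k) u) \<le> f u"
      by (intro SUP_least) (auto split: split_indicator)
    ultimately show "f u = (SUP k. f u * indicator (win k) u)" by (rule antisym)
  qed
  also have "\<dots> = (SUP k. \<integral>\<^sup>+u. f u * indicator (win k) u \<partial>count_space x)"
    using win_mono by (intro nn_integral_monotone_convergence_SUP)
      (auto simp: incseq_def le_fun_def split: split_indicator)
  finally show ?thesis .
qed

text \<open>The \<sigma>-algebra is given by counts in arbitrary sets, but for locally finite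
configurations a count is the supremum of the counts in its intersections with windows, so finite
counts suffice.\<close>
lemma measurable_lf_configI:
  assumes sp: "\<And>\<omega>. \<omega> \<in> space M \<Longrightarrow> X \<omega> \<in> space lf_config_space"
    and cnt: "\<And>B k. B \<in> sets seg_space \<Longrightarrow> B \<subseteq> win k \<Longrightarrow>
       (\<lambda>\<omega>. \<integral>\<^sup>+u. indicator B u \<partial>count_space (X \<omega>)) \<in> borel_measurable M"
  shows "X \<in> M \<rightarrow>\<^sub>M lf_config_space"
  unfolding lf_config_space_def
proof (rule measurable_restrict_space2)
  show "X \<in> space M \<rightarrow> {x. locally_finite x}"
    using sp by (auto simp: lf_config_space_def space_restrict_space)
  show "X \<in> M \<rightarrow>\<^sub>M config_space" unfolding config_space_def
  proof (rule measurable_measure_of)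
    show "X \<in> space M \<rightarrow> Pow (space seg_space)" using sp by (auto simp: mem_space_lf_config)
    fix A assume "A \<in> {{x \<in> Pow (space seg_space). finite (x \<inter> B) \<and> card (x \<inter> B) = n} |B n. B \<in> sets seg_space}"
    then obtain B n where B: "B \<in> sets seg_space"
      and A: "A = {x \<in> Pow (space seg_space). finite (x \<inter> B) \<and> card (x \<inter> B) = n}" by blast
    let ?c = "\<lambda>\<omega>. SUP k. \<integral>\<^sup>+u. indicator (B \<inter> win k) u \<partial>count_space (X \<omega>)"
    have [measurable]: "?c \<in> borel_measurable M"
      using B by (intro borel_measurable_SUP) (auto intro!: cnt)
    have "?c \<omega> = (if finite (X \<omega> \<inter> B) then of_nat (card (X \<omega> \<inter> B)) else \<top>)" if "\<omega> \<in> space M" for \<omega>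
      using sum_over_windows[OF sp[OF that], of "indicator B"]
      by (simp add: indicator_inter_arith[symmetric] sum_indicator_eq)
    then have "X -` A \<inter> space M = {\<omega> \<in> space M. ?c \<omega> = of_nat n}"
      using sp by (auto simp: A mem_space_lf_config split: if_splits)
    also have "\<dots> \<in> sets M" by measurable
    finally show "X -` A \<inter> space M \<in> sets M" .
  qed auto
qed

text \<open>A locally finite configuration is, as a counting measure, a kernel that is finite on
every window: for product sets the integral is a count, complements are handled by subtraction
inside a window (where everything is finite), and the windows are exhausted afterwards. Every
operation on configurations below is measurable because its counts are such sums.\<close>
lemma sum_over_config_measurable:
  assumes X[measurable]: "X \<in> M \<rightarrow>\<^sub>M lf_config_space"
    and f[measurable]: "f \<in> borel_measurable (M \<Otimes>\<^sub>M seg_space)"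
  shows "(\<lambda>\<omega>. \<integral>\<^sup>+u. f (\<omega>, u) \<partial>count_space (X \<omega>)) \<in> borel_measurable M"
proof -
  have Xsp: "X \<omega> \<in> space lf_config_space" if "\<omega> \<in> space M" for \<omega>
    using measurable_space[OF X that] .
  have ind: "(\<lambda>\<omega>. \<integral>\<^sup>+u. indicator E (\<omega>, u) * indicator (win k) u \<partial>count_space (X \<omega>)) \<in> borel_measurable M"
    if E: "E \<in> sets (M \<Otimes>\<^sub>M seg_space)" for E k
  proof -
    let ?G = "{a \<times> b | a b. a \<in> sets M \<and> b \<in> sets seg_space}"
    let ?N = "\<lambda>E \<omega>. \<integral>\<^sup>+u. indicator E (\<omega>, u) * indicator (win k) u \<partial>count_space (X \<omega>) :: ennreal"
    let ?T = "space M \<times> space seg_space"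
    have tot: "?N ?T \<omega> = (\<integral>\<^sup>+u. indicator (win k) u \<partial>count_space (X \<omega>))" if "\<omega> \<in> space M" for \<omega>
      using Xsp[OF that] that by (intro nn_integral_cong) (auto simp: mem_space_lf_config split: split_indicator)
    have tot_fin: "?N ?T \<omega> < \<top>" if "\<omega> \<in> space M" for \<omega>
      using lf_config_finite[OF Xsp[OF that], of "win k" k] that
      by (simp add: tot sum_indicator_eq of_nat_less_top)
    have tot_meas[measurable]: "(\<lambda>\<omega>. ?N ?T \<omega>) \<in> borel_measurable M"
      by (rule measurable_cong[THEN iffD2, OF tot])
        (auto intro!: measurable_compose[OF X sum_indicator_measurable])
    have G1: "Int_stable ?G" by (rule Int_stable_pair_measure_generator)
    have G2: "?G \<subseteq> Pow ?T" by (auto dest: sets.sets_into_space)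
    from E have "E \<in> sigma_sets ?T ?G" by (simp add: sets_pair_measure)
    with G1 G2 show ?thesis
    proof (induction rule: sigma_sets_induct_disjoint)
      case (basic A)
      then obtain a b where [measurable]: "a \<in> sets M" "b \<in> sets seg_space" and A: "A = a \<times> b" by blast
      have "?N A \<omega> = indicator a \<omega> * (\<integral>\<^sup>+u. indicator (b \<inter> win k) u \<partial>count_space (X \<omega>))" for \<omega>
        by (subst nn_integral_cmult[symmetric]) (auto intro!: nn_integral_cong simp: A split: split_indicator)
      moreover have "(\<lambda>\<omega>. \<integral>\<^sup>+u. indicator (b \<inter> win k) u \<partial>count_space (X \<omega>)) \<in> borel_measurable M"
        by (rule measurable_compose[OF X sum_indicator_measurable]) auto
      ultimately show "?N A \<in> borel_measurable M" by simp
    next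
      case empty
      show "?N {} \<in> borel_measurable M" by simp
    next
      case (compl A)
      then have A: "A \<in> sigma_sets ?T ?G" and [measurable]: "?N A \<in> borel_measurable M" by auto
      have AT: "A \<subseteq> ?T" using sigma_sets_into_sp[OF _ A] by (auto dest: sets.sets_into_space)
      have sum: "?N A \<omega> + ?N (?T - A) \<omega> = ?N ?T \<omega>" for \<omega>
        using AT by (subst nn_integral_add[symmetric]) (auto intro!: nn_integral_cong split: split_indicator)
      have "?N (?T - A) \<omega> = ?N ?T \<omega> - ?N A \<omega>" if "\<omega> \<in> space M" for \<omega>
      proof -
        have "?N A \<omega> \<le> ?N ?T \<omega>" by (subst sum[symmetric]) simp
        then have "?N A \<omega> \<noteq> \<top>" using tot_fin[OF that] by auto
        then show ?thesis by (simp add: sum[symmetric] ennreal_add_diff_cancel_left)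
      qed
      then show "?N (?T - A) \<in> borel_measurable M"
        by (subst measurable_cong) (assumption, measurable)
    next
      case (union A)
      then have dis: "disjoint_family A" and meas: "\<And>i. ?N (A i) \<in> borel_measurable M" by auto
      have "?N (\<Union>i. A i) \<omega> = (\<Sum>i. ?N (A i) \<omega>)" for \<omega>
        by (subst nn_integral_suminf[symmetric])
           (auto intro!: nn_integral_cong simp: suminf_indicator[OF dis] ennreal_suminf_multc)
      then show "?N (\<Union>i. A i) \<in> borel_measurable M" using meas by simp
    qed
  qed
  have "(\<lambda>\<omega>. \<integral>\<^sup>+u. f (\<omega>, u) * indicator (win k) u \<partial>count_space (X \<omega>)) \<in> borel_measurable M" for k
    using f
  proof (induction rule: borel_measurable_induct)
    case (cong f g)
    then show ?case
      using Xsp by (subst measurable_cong[where g="\<lambda>\<omega>. \<integral>\<^sup>+u. g (\<omega>, u) * indicator (win k) u \<partial>count_space (X \<omega>)"])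
       (auto intro!: nn_integral_cong simp: space_pair_measure mem_space_lf_config subset_eq)
  next
    case (set A) then show ?case by (rule ind)
  next
    case (mult f c) then show ?case by (simp add: mult.assoc nn_integral_cmult)
  next
    case (add f g) then show ?case by (simp add: distrib_right nn_integral_add)
  next
    case (seq F)
    have "(\<integral>\<^sup>+u. (SUP i. F i) (\<omega>, u) * indicator (win k) u \<partial>count_space (X \<omega>))
      = (SUP i. \<integral>\<^sup>+u. F i (\<omega>, u) * indicator (win k) u \<partial>count_space (X \<omega>))" for \<omega>
      using \<open>incseq F\<close>
      by (subst nn_integral_monotone_convergence_SUP[symmetric])
         (auto simp: incseq_def le_fun_def SUP_mult_right_ennreal image_comp intro!: nn_integral_cong mult_right_mono)
    then show ?case using seq by simp
  qed
  then have "(\<lambda>\<omega>. SUP k. \<integral>\<^sup>+u. f (\<omega>, u) * indicator (win k) u \<partial>count_space (X \<omega>)) \<in> borel_measurable M"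
    by measurable
  then show ?thesis
    by (subst measurable_cong[OF sum_over_windows[OF Xsp]])
qed

section \<open>Measurable operations on configurations\<close>

text \<open>The diagonal of the segment space is measurable because it is the trace of the closed
diagonal of the ambient Euclidean space.\<close>
lemma eq_seg_measurable:
  assumes U: "U \<in> M \<rightarrow>\<^sub>M seg_space" and V: "V \<in> M \<rightarrow>\<^sub>M seg_space"
  shows "Measurable.pred M (\<lambda>\<omega>. U \<omega> = V \<omega>)"
proof -
  have [measurable]: "U \<in> M \<rightarrow>\<^sub>M borel" "V \<in> M \<rightarrow>\<^sub>M borel"
    using measurable_compose[OF U id_seg_borel] measurable_compose[OF V id_seg_borel] by auto
  show ?thesis by measurable
qed

lemma sum_filter_eq:
  "(\<integral>\<^sup>+u. f u \<partial>count_space {u \<in> x. P u}) = (\<integral>\<^sup>+u. f u * indicator {u. P u} u \<partial>count_space x)"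
  for f :: "'a \<Rightarrow> ennreal"
  by (subst (1 2) sum_count_eq) (auto intro!: nn_integral_cong split: split_indicator)

lemma filter_config_measurable:
  assumes X[measurable]: "X \<in> M \<rightarrow>\<^sub>M lf_config_space"
    and P[measurable]: "Measurable.pred (M \<Otimes>\<^sub>M seg_space) (\<lambda>p. P (fst p) (snd p))"
  shows "(\<lambda>\<omega>. {u \<in> X \<omega>. P \<omega> u}) \<in> M \<rightarrow>\<^sub>M lf_config_space"
proof (rule measurable_lf_configI)
  show "{u \<in> X \<omega>. P \<omega> u} \<in> space lf_config_space" if "\<omega> \<in> space M" for \<omega>
    by (rule lf_config_subset[OF measurable_space[OF X that]]) auto
  fix B k assume [measurable]: "B \<in> sets seg_space"
  have "(\<lambda>\<omega>. \<integral>\<^sup>+u. (\<lambda>p. indicator B (snd p) * indicator {p. P (fst p) (snd p)} p) (\<omega>, u) \<partial>count_space (X \<omega>))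
    \<in> borel_measurable M"
    by (rule sum_over_config_measurable) measurable
  then show "(\<lambda>\<omega>. \<integral>\<^sup>+u. indicator B u \<partial>count_space {u \<in> X \<omega>. P \<omega> u}) \<in> borel_measurable M"
    by (simp add: sum_filter_eq indicator_def)
qed

lemma member_config_measurable:
  assumes X[measurable]: "X \<in> M \<rightarrow>\<^sub>M lf_config_space" and U[measurable]: "U \<in> M \<rightarrow>\<^sub>M seg_space"
  shows "Measurable.pred M (\<lambda>\<omega>. U \<omega> \<in> X \<omega>)"
proof -
  have [measurable]: "Measurable.pred (M \<Otimes>\<^sub>M seg_space) (\<lambda>p. snd p = U (fst p))"
    by (rule eq_seg_measurable) measurable
  have *: "(\<lambda>\<omega>. \<integral>\<^sup>+u. (\<lambda>p. indicator {p. snd p = U (fst p)} p) (\<omega>, u) \<partial>count_space (X \<omega>)) \<in> borel_measurable M"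
    by (rule sum_over_config_measurable) measurable
  have "(\<integral>\<^sup>+u. indicator {p. snd p = U (fst p)} (\<omega>, u) \<partial>count_space (X \<omega>)) = indicator (X \<omega>) (U \<omega>)" for \<omega>
  proof -
    have "(\<integral>\<^sup>+u. indicator {p. snd p = U (fst p)} (\<omega>, u) \<partial>count_space (X \<omega>)) =
      (\<integral>\<^sup>+u. indicator {U \<omega>} u \<partial>count_space (X \<omega>))" 
      by (intro nn_integral_cong) (auto split: split_indicator)
    also have "\<dots> = indicator (X \<omega>) (U \<omega>)"
      by (auto simp: sum_indicator_eq split: split_indicator)
    finally show ?thesis .
  qed
  with * have "(\<lambda>\<omega>. indicator (X \<omega>) (U \<omega>) :: ennreal) \<in> borel_measurable M" by simp
  then have "Measurable.pred M (\<lambda>\<omega>. indicator (X \<omega>) (U \<omega>) = (1::ennreal))" by measurable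
  then show ?thesis by (simp add: indicator_def)
qed

lemma remove_config_measurable [measurable]:
  assumes X[measurable]: "X \<in> M \<rightarrow>\<^sub>M lf_config_space" and U[measurable]: "U \<in> M \<rightarrow>\<^sub>M seg_space"
  shows "(\<lambda>\<omega>. X \<omega> - {U \<omega>}) \<in> M \<rightarrow>\<^sub>M lf_config_space"
proof -
  have [measurable]: "Measurable.pred (M \<Otimes>\<^sub>M seg_space) (\<lambda>p. snd p = U (fst p))"
    by (rule eq_seg_measurable) measurable
  have "(\<lambda>\<omega>. {u \<in> X \<omega>. u \<noteq> U \<omega>}) \<in> M \<rightarrow>\<^sub>M lf_config_space"
    by (rule filter_config_measurable) measurable
  then show ?thesis by (simp add: set_diff_eq)
qed

lemma inter_config_measurable [measurable]:
  assumes X[measurable]: "X \<in> M \<rightarrow>\<^sub>M lf_config_space" and W[measurable]: "W \<in> sets seg_space"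
  shows "(\<lambda>\<omega>. X \<omega> \<inter> W) \<in> M \<rightarrow>\<^sub>M lf_config_space"
proof -
  have "(\<lambda>\<omega>. {u \<in> X \<omega>. u \<in> W}) \<in> M \<rightarrow>\<^sub>M lf_config_space"
    by (rule filter_config_measurable) measurable
  then show ?thesis by (simp add: Int_def)
qed

lemma diff_config_measurable [measurable]:
  assumes X[measurable]: "X \<in> M \<rightarrow>\<^sub>M lf_config_space" and W[measurable]: "W \<in> sets seg_space"
  shows "(\<lambda>\<omega>. X \<omega> - W) \<in> M \<rightarrow>\<^sub>M lf_config_space"
proof -
  have "(\<lambda>\<omega>. {u \<in> X \<omega>. u \<notin> W}) \<in> M \<rightarrow>\<^sub>M lf_config_space"
    by (rule filter_config_measurable) measurable
  then show ?thesis by (simp add: set_diff_eq)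
qed

lemma sum_union_eq:
  "(\<integral>\<^sup>+u. f u \<partial>count_space (x \<union> y)) =
    (\<integral>\<^sup>+u. f u \<partial>count_space x) + (\<integral>\<^sup>+u. f u * indicator (- x) u \<partial>count_space y)"
  for f :: "'a \<Rightarrow> ennreal"
  by (subst (1 2 3) sum_count_eq, subst nn_integral_add[symmetric])
     (auto intro!: nn_integral_cong split: split_indicator)

lemma union_config_measurable [measurable]:
  assumes X[measurable]: "X \<in> M \<rightarrow>\<^sub>M lf_config_space" and Y[measurable]: "Y \<in> M \<rightarrow>\<^sub>M lf_config_space"
  shows "(\<lambda>\<omega>. X \<omega> \<union> Y \<omega>) \<in> M \<rightarrow>\<^sub>M lf_config_space"
proof (rule measurable_lf_configI)
  show "X \<omega> \<union> Y \<omega> \<in> space lf_config_space" if "\<omega> \<in> space M" for \<omega>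
    by (intro lf_config_union measurable_space[OF X that] measurable_space[OF Y that])
  fix B k assume [measurable]: "B \<in> sets seg_space"
  have [measurable]: "Measurable.pred (M \<Otimes>\<^sub>M seg_space) (\<lambda>p. snd p \<in> X (fst p))"
    by (rule member_config_measurable) measurable
  have "(\<lambda>\<omega>. (\<integral>\<^sup>+u. (\<lambda>p. indicator B (snd p)) (\<omega>, u) \<partial>count_space (X \<omega>))
    + (\<integral>\<^sup>+u. (\<lambda>p. indicator B (snd p) * indicator {p. snd p \<notin> X (fst p)} p) (\<omega>, u) \<partial>count_space (Y \<omega>)))
    \<in> borel_measurable M"
    by (intro borel_measurable_add sum_over_config_measurable) measurable
  then show "(\<lambda>\<omega>. \<integral>\<^sup>+u. indicator B u \<partial>count_space (X \<omega> \<union> Y \<omega>)) \<in> borel_measurable M"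
    by (simp add: sum_union_eq indicator_def)
qed

lemma insert_config_measurable [measurable]:
  assumes X[measurable]: "X \<in> M \<rightarrow>\<^sub>M lf_config_space" and U[measurable]: "U \<in> M \<rightarrow>\<^sub>M seg_space"
  shows "(\<lambda>\<omega>. insert (U \<omega>) (X \<omega>)) \<in> M \<rightarrow>\<^sub>M lf_config_space"
proof -
  have "(\<lambda>\<omega>. {U \<omega>}) \<in> M \<rightarrow>\<^sub>M lf_config_space"
  proof (rule measurable_lf_configI)
    show "{U \<omega>} \<in> space lf_config_space" if "\<omega> \<in> space M" for \<omega>
      using measurable_space[OF U that] by (intro finite_in_lf_config) auto
    fix B k assume [measurable]: "B \<in> sets seg_space"
    have "(\<integral>\<^sup>+u. indicator B u \<partial>count_space {U \<omega>}) = (indicator B (U \<omega>) :: ennreal)" for \<omega>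
      by (subst nn_integral_count_space_finite) auto
    then show "(\<lambda>\<omega>. \<integral>\<^sup>+u. indicator B u \<partial>count_space {U \<omega>}) \<in> borel_measurable M" by simp
  qed
  from union_config_measurable[OF this X] show ?thesis by simp
qed

lemma sum_insert_eq:
  "u \<notin> x \<Longrightarrow> (\<integral>\<^sup>+v. f v \<partial>count_space (insert u x)) = f u + (\<integral>\<^sup>+v. f v \<partial>count_space x)"
  for f :: "'a \<Rightarrow> ennreal"
proof -
  assume u: "u \<notin> x"
  have "(\<integral>\<^sup>+v. f v \<partial>count_space (insert u x)) =
    (\<integral>\<^sup>+v. f v \<partial>count_space {u}) + (\<integral>\<^sup>+v. f v * indicator (- {u}) v \<partial>count_space x)"
    using sum_union_eq[of "{u}" x f] by simp
  also have "(\<integral>\<^sup>+v. f v * indicator (- {u}) v \<partial>count_space x) = (\<integral>\<^sup>+v. f v \<partial>count_space x)"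
    using u by (intro nn_integral_cong) (auto split: split_indicator)
  finally show ?thesis by (simp add: nn_integral_count_space_finite)
qed

text \<open>The shift of configurations is the image under this map of single segments.\<close>
definition sh :: "real ^ 2 \<Rightarrow> seg \<Rightarrow> seg" where "sh t u = (fst u + t, snd u)"

lemma shift_eq: "shift t x = sh t ` x"
  by (simp add: shift_def sh_def[abs_def] case_prod_unfold)

lemma sh_sh [simp]: "sh s (sh t u) = sh (s + t) u" and sh_0 [simp]: "sh 0 u = u"
  by (auto simp: sh_def algebra_simps)

lemma fst_sh [simp]: "fst (sh t u) = fst u + t" and snd_sh [simp]: "snd (sh t u) = snd u"
  by (auto simp: sh_def)

lemma sh_inject [simp]: "sh t u = sh t v \<longleftrightarrow> u = v"
  by (auto simp: sh_def prod_eq_iff)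

lemma sh_space [simp]: "sh t u \<in> space seg_space \<longleftrightarrow> u \<in> space seg_space"
  by (auto simp: sh_def space_seg_space mem_Times_iff)

lemma sh_measurable [measurable]:
  assumes "T \<in> borel_measurable M" and "U \<in> M \<rightarrow>\<^sub>M seg_space"
  shows "(\<lambda>\<omega>. sh (T \<omega>) (U \<omega>)) \<in> M \<rightarrow>\<^sub>M seg_space"
proof -
  have [measurable]: "(\<lambda>\<omega>. fst (U \<omega>)) \<in> M \<rightarrow>\<^sub>M borel" "(\<lambda>\<omega>. snd (U \<omega>)) \<in> M \<rightarrow>\<^sub>M restrict_space borel {0..<pi}"
    by (rule measurable_compose[OF assms(2)], measurable)+
  note assms(1)[measurable]
  have "(\<lambda>\<omega>. (fst (U \<omega>) + T \<omega>, snd (U \<omega>))) \<in> M \<rightarrow>\<^sub>M (borel \<Otimes>\<^sub>M restrict_space borel {0..<pi})"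
    by measurable
  then show ?thesis by (simp add: sh_def seg_space_def)
qed

lemma sum_shift_eq: "(\<integral>\<^sup>+v. f v \<partial>count_space (shift t x)) = (\<integral>\<^sup>+u. f (sh t u) \<partial>count_space x)"
  unfolding shift_eq
  by (rule nn_integral_bij_count_space[symmetric]) (auto simp: bij_betw_def inj_on_def)

lemma win_sh: "norm t \<le> real j \<Longrightarrow> sh t u \<in> win k \<Longrightarrow> u \<in> win (k + j)"
  using norm_triangle_ineq4[of "fst u + t" t] by (auto simp: win_def)

lemma shift_lf_config: assumes x: "x \<in> space lf_config_space" shows "shift t x \<in> space lf_config_space"
  unfolding mem_space_lf_config
proof (intro conjI allI)
  show "shift t x \<subseteq> space seg_space" using x by (auto simp: shift_eq mem_space_lf_config)
  fix k
  obtain j where "norm t \<le> real j" using real_arch_simple by blast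
  then have "shift t x \<inter> win k \<subseteq> sh t ` (x \<inter> win (k + j))"
    using win_sh[of t j] by (auto simp: shift_eq)
  then show "finite (shift t x \<inter> win k)"
    using x by (auto simp: mem_space_lf_config intro: finite_subset)
qed

lemma shift_config_measurable [measurable]:
  assumes X[measurable]: "X \<in> M \<rightarrow>\<^sub>M lf_config_space" and T[measurable]: "T \<in> borel_measurable M"
  shows "(\<lambda>\<omega>. shift (T \<omega>) (X \<omega>)) \<in> M \<rightarrow>\<^sub>M lf_config_space"
proof (rule measurable_lf_configI)
  show "shift (T \<omega>) (X \<omega>) \<in> space lf_config_space" if "\<omega> \<in> space M" for \<omega>
    by (intro shift_lf_config measurable_space[OF X that])
  fix B k assume [measurable]: "B \<in> sets seg_space"
  have "(\<lambda>\<omega>. \<integral>\<^sup>+u. (\<lambda>p. indicator B (sh (T (fst p)) (snd p))) (\<omega>, u) \<partial>count_space (X \<omega>)) \<in> borel_measurable M"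
    by (intro sum_over_config_measurable) measurable
  then show "(\<lambda>\<omega>. \<integral>\<^sup>+u. indicator B u \<partial>count_space (shift (T \<omega>) (X \<omega>))) \<in> borel_measurable M"
    by (simp add: sum_shift_eq)
qed

lemma shift_remove: "shift t (x - {u}) = shift t x - {sh t u}"
  by (auto simp: shift_eq)

section \<open>The hitting relation\<close>

abbreviation dirv :: "seg \<Rightarrow> real ^ 2" where "dirv u \<equiv> vector [cos (snd u), sin (snd u)]"

lemma centred_segment_point:
  fixes y e :: "real ^ 'n"
  shows "(1 - c) *\<^sub>R (y - (r / 2) *\<^sub>R e) + c *\<^sub>R (y + (r / 2) *\<^sub>R e) = y + ((c - 1 / 2) * r) *\<^sub>R e"
  by (simp add: vec_eq_iff field_simps)

lemma mem_seg_set: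
  "z \<in> seg_set r u \<longleftrightarrow> (\<exists>s\<in>{-1/2..1/2}. z = fst u + (s * r) *\<^sub>R dirv u)"
proof
  assume "z \<in> seg_set r u"
  then obtain c where c: "0 \<le> c" "c \<le> 1"
    and z: "z = (1 - c) *\<^sub>R (fst u - (r/2) *\<^sub>R dirv u) + c *\<^sub>R (fst u + (r/2) *\<^sub>R dirv u)"
    by (auto simp: seg_set_def Let_def in_segment)
  have "z = fst u + ((c - 1/2) * r) *\<^sub>R dirv u"
    by (simp only: z centred_segment_point)
  with c show "\<exists>s\<in>{-1/2..1/2}. z = fst u + (s * r) *\<^sub>R dirv u"
    by (intro bexI[of _ "c - 1/2"]) auto
next
  assume "\<exists>s\<in>{-1/2..1/2}. z = fst u + (s * r) *\<^sub>R dirv u"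
  then obtain s where s: "s \<in> {-1/2..1/2}" and z: "z = fst u + (s * r) *\<^sub>R dirv u" by blast
  have "z = (1 - (s + 1/2)) *\<^sub>R (fst u - (r/2) *\<^sub>R dirv u) + (s + 1/2) *\<^sub>R (fst u + (r/2) *\<^sub>R dirv u)"
    by (simp only: z centred_segment_point) simp
  with s show "z \<in> seg_set r u"
    by (auto simp: seg_set_def Let_def in_segment intro!: exI[of _ "s + 1/2"])
qed

lemma norm_dirv [simp]: "norm (dirv u) = 1"
  by (simp add: norm_vec_def L2_set_def sum_2)

lemma seg_set_dist: "r > 0 \<Longrightarrow> z \<in> seg_set r u \<Longrightarrow> dist z (fst u) \<le> r / 2"
  by (auto simp: mem_seg_set dist_norm abs_mult)

lemma hits_dist: "r > 0 \<Longrightarrow> hits r u v \<Longrightarrow> dist (fst u) (fst v) \<le> r"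
proof -
  assume r: "r > 0" and "hits r u v"
  then obtain z where "z \<in> seg_set r u" "z \<in> seg_set r v" by (auto simp: hits_def)
  then have "dist z (fst u) \<le> r / 2" "dist z (fst v) \<le> r / 2" using seg_set_dist[OF r] by auto
  then show ?thesis using dist_triangle3[of "fst u" "fst v" z] by simp
qed

lemma hits_commute: "hits r u v \<longleftrightarrow> hits r v u"
  by (auto simp: hits_def)

lemma seg_set_sh: "seg_set r (sh t u) = (\<lambda>z. z + t) ` seg_set r u"
proof -
  have "z \<in> seg_set r (sh t u) \<longleftrightarrow> z - t \<in> seg_set r u" for z
    unfolding mem_seg_set by (simp add: sh_def algebra_simps)
  moreover have "z \<in> (\<lambda>z. z + t) ` A \<longleftrightarrow> z - t \<in> A" for z and A :: "(real^2) set"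
    by (auto simp: image_iff intro: bexI[of _ "z - t"])
  ultimately show ?thesis by blast
qed

lemma hits_sh [simp]: "hits r (sh t u) (sh t v) \<longleftrightarrow> hits r u v"
  unfolding hits_def seg_set_sh by auto

lemma continuous_dirv:
  fixes f :: "'a :: t2_space \<Rightarrow> real"
  assumes that: "continuous_on A f"
  shows "continuous_on A (\<lambda>p. vector [cos (f p), sin (f p)] :: real ^ 2)"
proof -
  have "continuous_on A (\<lambda>p. \<chi> i. if i = (1::2) then cos (f p) else sin (f p))"
  proof (rule continuous_on_vec_lambda)
    fix i :: 2
    show "continuous_on A (\<lambda>p. if i = 1 then cos (f p) else sin (f p))"
      using that by (cases "i = 1") (auto intro: continuous_on_cos continuous_on_sin)
  qed
  moreover have "(\<chi> i. if i = (1::2) then c else s) = (vector [c, s] :: real ^ 2)" for c s :: real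
    by (simp add: vec_eq_iff forall_2)
  ultimately show ?thesis by simp
qed

text \<open>Hitting means that two points, each given by a parameter in a compact interval,
coincide; so the hitting relation is the projection of a closed set along a compact
factor.\<close>
lemma closed_hits: "closed {p. hits r (fst p) (snd p)}"
proof -
  let ?I = "{-1/2..1/2::real} \<times> {-1/2..1/2::real}"
  let ?E = "{q :: (real \<times> real) \<times> (seg \<times> seg).
    fst (fst (snd q)) + (fst (fst q) * r) *\<^sub>R dirv (fst (snd q)) = fst (snd (snd q)) + (snd (fst q) * r) *\<^sub>R dirv (snd (snd q))}"
  have "closed ?E"
    by (intro closed_Collect_eq continuous_intros continuous_dirv)
  then have "closed {y. \<exists>x. x \<in> ?I \<and> (x, y) \<in> ?E}"
    by (intro closed_compact_projection compact_Times) auto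
  also have "{y. \<exists>x. x \<in> ?I \<and> (x, y) \<in> ?E} = {p. hits r (fst p) (snd p)}"
  proof (intro Collect_cong iffI)
    fix p :: "seg \<times> seg"
    assume "\<exists>x. x \<in> ?I \<and> (x, p) \<in> ?E"
    then obtain x where "x \<in> ?I" "(x, p) \<in> ?E" by blast
    then have x: "fst x \<in> {-1/2..1/2}" "snd x \<in> {-1/2..1/2}" and
      eq: "fst (fst p) + (fst x * r) *\<^sub>R dirv (fst p) = fst (snd p) + (snd x * r) *\<^sub>R dirv (snd p)"
      by (auto simp: mem_Times_iff)
    have "fst (fst p) + (fst x * r) *\<^sub>R dirv (fst p) \<in> seg_set r (fst p)"
      unfolding mem_seg_set using x(1) by blast
    moreover have "fst (fst p) + (fst x * r) *\<^sub>R dirv (fst p) \<in> seg_set r (snd p)"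
      unfolding mem_seg_set eq using x(2) by blast
    ultimately show "hits r (fst p) (snd p)" unfolding hits_def by blast
  next
    fix p :: "seg \<times> seg"
    assume "hits r (fst p) (snd p)"
    then obtain z where "z \<in> seg_set r (fst p)" "z \<in> seg_set r (snd p)" unfolding hits_def by blast
    then obtain s t where "s \<in> {-1/2..1/2}" "t \<in> {-1/2..1/2}"
      "z = fst (fst p) + (s * r) *\<^sub>R dirv (fst p)" "z = fst (snd p) + (t * r) *\<^sub>R dirv (snd p)"
      unfolding mem_seg_set by blast
    then show "\<exists>x. x \<in> ?I \<and> (x, p) \<in> ?E"
      by (intro exI[of _ "(s, t)"]) auto
  qed
  finally show ?thesis .
qed

lemma hits_measurable [measurable]:
  assumes U: "U \<in> M \<rightarrow>\<^sub>M seg_space" and V: "V \<in> M \<rightarrow>\<^sub>M seg_space"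
  shows "Measurable.pred M (\<lambda>\<omega>. hits r (U \<omega>) (V \<omega>))"
proof -
  have [measurable]: "U \<in> M \<rightarrow>\<^sub>M borel" "V \<in> M \<rightarrow>\<^sub>M borel"
    using measurable_compose[OF U id_seg_borel] measurable_compose[OF V id_seg_borel] by auto
  have "(\<lambda>\<omega>. (U \<omega>, V \<omega>)) \<in> M \<rightarrow>\<^sub>M borel"
    by (subst borel_prod[symmetric]) measurable
  moreover have "{p. hits r (fst p) (snd p)} \<in> sets borel"
    using closed_hits by (rule borel_closed)
  ultimately have "(\<lambda>\<omega>. (U \<omega>, V \<omega>)) -` {p. hits r (fst p) (snd p)} \<inter> space M \<in> sets M"
    by (rule measurable_sets)
  also have "(\<lambda>\<omega>. (U \<omega>, V \<omega>)) -` {p. hits r (fst p) (snd p)} \<inter> space M = {\<omega> \<in> space M. hits r (U \<omega>) (V \<omega>)}"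
    by auto
  finally show ?thesis by (simp add: pred_def)
qed

lemma finite_hits:
  assumes r: "r > 0" and x: "x \<in> space lf_config_space" shows "finite {v \<in> x. hits r u v}"
proof -
  obtain k where k: "norm (fst u) + r < real k" using reals_Archimedean2 by blast
  have "{v \<in> x. hits r u v} \<subseteq> x \<inter> win k"
  proof safe
    fix v assume v: "v \<in> x" "hits r u v"
    have "norm (fst v) \<le> norm (fst u) + dist (fst u) (fst v)"
      using norm_triangle_ineq[of "fst u" "fst v - fst u"] by (simp add: dist_norm norm_minus_commute)
    with hits_dist[OF r v(2)] k v(1) x show "v \<in> win k" by (auto simp: win_def mem_space_lf_config)
  qed
  with x show ?thesis unfolding mem_space_lf_config by (meson finite_subset)
qed

text \<open>Counting the hits amounts to integrating an indicator over the configuration, which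
turns the measurability of the number of hits into an instance of the general result on
sums.\<close>
lemma num_hits_eq_sum:
  assumes r: "r > 0" and x: "x \<in> space lf_config_space"
  shows "of_nat (num_hits r x u) = (\<integral>\<^sup>+v. indicator {v. v \<noteq> u \<and> hits r u v} v \<partial>count_space x)"
proof -
  have "x \<inter> {v. v \<noteq> u \<and> hits r u v} = {v \<in> x - {u}. hits r u v}" by auto
  moreover have "finite {v \<in> x - {u}. hits r u v}"
    by (rule finite_subset[OF _ finite_hits[OF r x]]) auto
  ultimately show ?thesis by (simp add: sum_indicator_eq num_hits_def)
qed

lemma num_hits_ennreal_measurable:
  assumes r: "r > 0" and X[measurable]: "X \<in> M \<rightarrow>\<^sub>M lf_config_space" and U[measurable]: "U \<in> M \<rightarrow>\<^sub>M seg_space"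
  shows "(\<lambda>\<omega>. of_nat (num_hits r (X \<omega>) (U \<omega>)) :: ennreal) \<in> borel_measurable M"
proof -
  have [measurable]: "Measurable.pred (M \<Otimes>\<^sub>M seg_space) (\<lambda>p. snd p = U (fst p))"
    by (rule eq_seg_measurable) measurable
  have "(\<lambda>\<omega>. \<integral>\<^sup>+v. (\<lambda>p. indicator {p. snd p \<noteq> U (fst p) \<and> hits r (U (fst p)) (snd p)} p) (\<omega>, v) \<partial>count_space (X \<omega>))
    \<in> borel_measurable M"
    by (intro sum_over_config_measurable) measurable
  then show ?thesis
    by (rule measurable_cong[THEN iffD1, rotated])
       (auto simp: num_hits_eq_sum[OF r measurable_space[OF X]] indicator_def)
qed

lemma num_hits_measurable [measurable]:
  assumes r: "r > 0" and X[measurable]: "X \<in> M \<rightarrow>\<^sub>M lf_config_space" and U[measurable]: "U \<in> M \<rightarrow>\<^sub>M seg_space"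
  shows "(\<lambda>\<omega>. real (num_hits r (X \<omega>) (U \<omega>))) \<in> borel_measurable M"
proof -
  note num_hits_ennreal_measurable[OF r X U, measurable]
  have "(\<lambda>\<omega>. enn2real (of_nat (num_hits r (X \<omega>) (U \<omega>)))) \<in> borel_measurable M" by measurable
  then show ?thesis by simp
qed

lemma num_hits_shift [simp]: "num_hits r (shift t x) (sh t u) = num_hits r x u"
proof -
  have "{v \<in> shift t x - {sh t u}. hits r (sh t u) v} = sh t ` {v \<in> x - {u}. hits r u v}"
    by (auto simp: shift_eq)
  moreover have "inj_on (sh t) A" for A by (auto simp: inj_on_def)
  ultimately show ?thesis unfolding num_hits_def by (simp add: card_image)
qed

section \<open>Measures given by functionals\<close>

text \<open>Several measures are known through their integrals, as sums or iterated integrals of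
other measures. Additivity, homogeneity and monotone continuity of the functional are what makes
it an integral.\<close>
lemma functional_as_measure:
  fixes \<Phi> :: "('a \<Rightarrow> ennreal) \<Rightarrow> ennreal"
  assumes cong: "\<And>f g. (\<And>x. x \<in> space N \<Longrightarrow> f x = g x) \<Longrightarrow> \<Phi> f = \<Phi> g"
    and add: "\<And>f g. f \<in> borel_measurable N \<Longrightarrow> g \<in> borel_measurable N \<Longrightarrow> \<Phi> (\<lambda>x. f x + g x) = \<Phi> f + \<Phi> g"
    and mult: "\<And>f c. f \<in> borel_measurable N \<Longrightarrow> \<Phi> (\<lambda>x. c * f x) = c * \<Phi> f"
    and sup: "\<And>F. (\<And>i. F i \<in> borel_measurable N) \<Longrightarrow> incseq F \<Longrightarrow> \<Phi> (\<lambda>x. SUP i. F i x) = (SUP i. \<Phi> (F i))"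
  shows "\<exists>K. sets K = sets N \<and> (\<forall>f\<in>borel_measurable N. (\<integral>\<^sup>+x. f x \<partial>K) = \<Phi> f)"
proof -
  define K where "K = measure_of (space N) (sets N) (\<lambda>A. \<Phi> (indicator A))"
  have sets_K[measurable_cong]: "sets K = sets N" by (simp add: K_def)
  then have space_K: "space K = space N" by (rule sets_eq_imp_space_eq)
  have zero: "\<Phi> (\<lambda>x. 0) = 0" using mult[of "\<lambda>x. 0" 0] by simp
  have fin: "\<Phi> (\<lambda>x. \<Sum>i<n. f i x) = (\<Sum>i<n. \<Phi> (f i))" if "\<And>i. f i \<in> borel_measurable N" for n :: nat and f
    using that by (induction n) (simp_all add: zero add)
  have ctbl: "\<Phi> (\<lambda>x. \<Sum>i. f i x) = (\<Sum>i. \<Phi> (f i))" if f: "\<And>i::nat. f i \<in> borel_measurable N" for f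
  proof -
    have "\<Phi> (\<lambda>x. \<Sum>i. f i x) = \<Phi> (\<lambda>x. SUP n. \<Sum>i<n. f i x)" by (simp add: suminf_eq_SUP)
    also have "\<dots> = (SUP n. \<Phi> (\<lambda>x. \<Sum>i<n. f i x))"
      using f by (intro sup) (auto simp: incseq_def le_fun_def intro!: sum_mono2)
    finally show ?thesis using f by (simp add: fin suminf_eq_SUP)
  qed
  have em: "emeasure K A = \<Phi> (indicator A)" if A: "A \<in> sets N" for A
  proof (rule emeasure_measure_of[OF K_def])
    show "sets N \<subseteq> Pow (space N)" by (rule sets.space_closed)
    show "positive (sets K) (\<lambda>A. \<Phi> (indicator A))"
      using zero by (simp add: positive_def indicator_def[abs_def])
    show "countably_additive (sets K) (\<lambda>A. \<Phi> (indicator A))"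
    proof (rule countably_additiveI)
      fix A :: "nat \<Rightarrow> _" assume "range A \<subseteq> sets K" "disjoint_family A"
      then show "(\<Sum>i. \<Phi> (indicator (A i))) = \<Phi> (indicator (\<Union>i. A i))"
        by (subst ctbl[symmetric]) (auto simp: sets_K suminf_indicator range_subsetD)
    qed
    show "A \<in> sets K" using A by (simp add: sets_K)
  qed
  have "(\<integral>\<^sup>+x. f x \<partial>K) = \<Phi> f" if "f \<in> borel_measurable N" for f
    using that
  proof (induction rule: borel_measurable_induct)
    case (cong f g)
    have "(\<integral>\<^sup>+x. f x \<partial>K) = (\<integral>\<^sup>+x. g x \<partial>K)"
      using cong(3) by (intro nn_integral_cong) (simp add: space_K)
    moreover have "\<Phi> f = \<Phi> g" using assms(1) cong(3) by blast
    ultimately show ?case using cong(4) by simp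
  next
    case (set A) then show ?case using em by (simp add: sets_K)
  next
    case (mult u c)
    have "u \<in> borel_measurable K" using mult by simp
    then show ?case using mult assms(3)[of u c] by (simp add: nn_integral_cmult)
  next
    case (add u v) 
    have "u \<in> borel_measurable K" "v \<in> borel_measurable K" using add by simp_all
    then show ?case using add assms(2)[of v u] by (simp add: nn_integral_add)
  next
    case (seq F)
    have "\<And>i. F i \<in> borel_measurable K" using seq by simp
    moreover have "(SUP i. F i) = (\<lambda>x. SUP i. F i x)" by (auto simp: fun_eq_iff image_comp)
    ultimately show ?case
      using seq assms(4)[of F] by (simp add: nn_integral_monotone_convergence_SUP)
  qed
  with sets_K show ?thesis by blast
qed

lemma pred_subset_config [measurable]:
  assumes [measurable]: "W \<in> sets seg_space" shows "Measurable.pred lf_config_space (\<lambda>x. x \<subseteq> W)"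
proof -
  have "(\<lambda>x. \<integral>\<^sup>+u. (\<lambda>p. indicator (space seg_space - W) (snd p)) (x, u) \<partial>count_space x) \<in> borel_measurable lf_config_space"
    by (rule sum_over_config_measurable) measurable
  then have m[measurable]: "(\<lambda>x. \<integral>\<^sup>+u. indicator (space seg_space - W) u \<partial>count_space x :: ennreal) \<in> borel_measurable lf_config_space"
    by simp
  have *: "Measurable.pred lf_config_space (\<lambda>x. (\<integral>\<^sup>+u. indicator (space seg_space - W) u \<partial>count_space x) = (0::ennreal))"
    using borel_measurable_eq[OF m measurable_const[of 0]] by (simp add: pred_def)
  have eq: "x \<subseteq> W \<longleftrightarrow> (\<integral>\<^sup>+u. indicator (space seg_space - W) u \<partial>count_space x) = (0::ennreal)" if "x \<in> space lf_config_space" for x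
  proof -
    have "x \<subseteq> W \<longleftrightarrow> x \<inter> (space seg_space - W) = {}" using that by (auto simp: mem_space_lf_config)
    also have "\<dots> \<longleftrightarrow> (\<integral>\<^sup>+u. indicator (space seg_space - W) u \<partial>count_space x) = (0::ennreal)"
    proof (cases "finite (x \<inter> (space seg_space - W))")
      case True then show ?thesis unfolding sum_indicator_eq by simp
    next
      case False
      then have "x \<inter> (space seg_space - W) \<noteq> {}" by fastforce
      with False show ?thesis unfolding sum_indicator_eq by simp
    qed
    finally show ?thesis .
  qed
  show ?thesis by (rule measurable_cong[OF eq, THEN iffD2, OF _ *])
qed

lemma empty_in_lf_config [simp]: "{} \<in> space lf_config_space"
  by (rule finite_in_lf_config) auto

lemma sum_removed_measurable [measurable]:
  assumes [measurable]: "q \<in> borel_measurable (seg_space \<Otimes>\<^sub>M lf_config_space)"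
  shows "(\<lambda>x. \<integral>\<^sup>+u. q (u, x - {u}) \<partial>count_space x) \<in> borel_measurable lf_config_space"
proof -
  have "(\<lambda>x. \<integral>\<^sup>+u. (\<lambda>p. q (snd p, fst p - {snd p})) (x, u) \<partial>count_space x) \<in> borel_measurable lf_config_space"
    by (rule sum_over_config_measurable) measurable
  then show ?thesis by simp
qed

text \<open>This splits the sum in the induction step of Mecke's formula: the new point
contributes one term, and for the old points it belongs to the configuration left after
removal.\<close>
lemma sum_removed_insert:
  fixes q :: "_ \<Rightarrow> ennreal"
  assumes "v \<notin> x"
  shows "(\<integral>\<^sup>+u. q (u, insert v x - {u}) \<partial>count_space (insert v x)) =
    q (v, x) + (\<integral>\<^sup>+u. q (u, insert v (x - {u})) \<partial>count_space x)"
proof -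
  have "(\<integral>\<^sup>+u. q (u, insert v x - {u}) \<partial>count_space x) = (\<integral>\<^sup>+u. q (u, insert v (x - {u})) \<partial>count_space x)"
    using assms by (intro nn_integral_cong arg_cong[where f="q"]) auto
  with assms show ?thesis by (simp add: sum_insert_eq)
qed

section \<open>The Poisson process in a window and its domination property\<close>

locale diffuse_intensity =
  fixes \<rho> :: "seg measure"
  assumes sets_\<rho> [measurable_cong]: "sets \<rho> = sets seg_space"
    and finite_win: "emeasure \<rho> (win k) < \<infinity>"
    and diffuse: "emeasure \<rho> {u} = 0"
begin

lemma space_\<rho>: "space \<rho> = space seg_space" using sets_\<rho> by (rule sets_eq_imp_space_eq)

sublocale sigma_finite_measure \<rho>
proof
  have "(\<Union>k. win k) = space \<rho>" using mem_some_win by (auto simp: space_\<rho> win_def)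
  then show "\<exists>A. countable A \<and> A \<subseteq> sets \<rho> \<and> \<Union> A = space \<rho> \<and> (\<forall>a\<in>A. emeasure \<rho> a \<noteq> \<infinity>)"
    using finite_win by (intro exI[of _ "range win"]) (auto simp: sets_\<rho> less_top)
qed

definition restr :: "seg set \<Rightarrow> seg measure" where "restr W = density \<rho> (indicator W)"

lemma sets_restr [measurable_cong, simp]: "sets (restr W) = sets seg_space"
  by (simp add: restr_def sets_\<rho>)

lemma space_restr [simp]: "space (restr W) = space seg_space"
  by (simp add: restr_def space_\<rho>)

lemma nn_integral_restr: 
  assumes [measurable]: "W \<in> sets seg_space" "f \<in> borel_measurable seg_space"
  shows "(\<integral>\<^sup>+u. f u \<partial>restr W) = (\<integral>\<^sup>+u. f u * indicator W u \<partial>\<rho>)"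
  unfolding restr_def by (subst nn_integral_density) (auto simp: mult.commute)

lemma finite_restr: assumes "W \<in> sets seg_space" "W \<subseteq> win k" shows "finite_measure (restr W)"
proof
  have "emeasure (restr W) (space (restr W)) = emeasure \<rho> W"
    using assms(1) sets.sets_into_space[OF assms(1)] unfolding restr_def
    by (subst emeasure_density) (auto simp: space_\<rho> sets_\<rho> Int_absorb2 nn_integral_indicator 
      intro!: arg_cong[where f="emeasure \<rho>"] simp flip: indicator_inter_arith)
  also have "\<dots> \<le> emeasure \<rho> (win k)" using assms by (intro emeasure_mono) (auto simp: sets_\<rho>)
  finally show "emeasure (restr W) (space (restr W)) \<noteq> \<infinity>" using finite_win[of k] by (auto simp: top_unique)
qed

lemma AE_restr_not_in: assumes "x \<in> space lf_config_space" "W \<in> sets seg_space" shows "AE v in restr W. v \<notin> x"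
proof -
  have "AE v in \<rho>. \<forall>u\<in>x. v \<noteq> u"
  proof (subst AE_ball_countable[OF lf_config_countable[OF assms(1)]], intro ballI)
    fix u assume "u \<in> x"
    then have u: "u \<in> space seg_space" using assms(1) by (auto simp: mem_space_lf_config)
    have "{v \<in> space seg_space. v = u} \<in> sets seg_space"
      using eq_seg_measurable[of "\<lambda>v. v" seg_space "\<lambda>v. u"] u by (simp add: pred_def)
    also have "{v \<in> space seg_space. v = u} = {u}" using u by auto
    finally show "AE v in \<rho>. v \<noteq> u"
      using diffuse[of u] by (intro AE_I[where N="{u}"]) (auto simp: sets_\<rho>)
  qed
  then have "AE v in \<rho>. v \<notin> x" by (rule AE_mp) auto
  then show ?thesis unfolding restr_def
    using assms(2) by (subst AE_density) (auto simp: sets_\<rho> cong: measurable_cong_sets)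
qed

text \<open>The law (up to the factor given by the total mass) of the set formed by independent
points in the window. Adding one point at a time replaces symmetrization over orderings by
Fubini's theorem.\<close>
primrec tuple_law :: "seg set \<Rightarrow> nat \<Rightarrow> seg set measure" where
  "tuple_law W 0 = return lf_config_space {}"
| "tuple_law W (Suc n) = distr (restr W \<Otimes>\<^sub>M tuple_law W n) lf_config_space (\<lambda>p. insert (fst p) (snd p))"

lemma sets_tuple_law [measurable_cong, simp]: "sets (tuple_law W n) = sets lf_config_space"
  by (cases n) auto

lemma space_tuple_law [simp]: "space (tuple_law W n) = space lf_config_space"
  by (rule sets_eq_imp_space_eq) simp

context
  fixes W k assumes W [measurable]: "W \<in> sets seg_space" and W_win: "W \<subseteq> win k"
begin

interpretation restr: finite_measure "restr W" using finite_restr[OF W W_win] .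

lemma finite_tuple_law: "finite_measure (tuple_law W n)"
proof (induction n)
  case 0 show ?case by (simp add: prob_space.finite_measure prob_space_return)
next
  case (Suc n)
  interpret n: finite_measure "tuple_law W n" by (rule Suc)
  interpret p: pair_sigma_finite "restr W" "tuple_law W n" ..
  have "emeasure (restr W \<Otimes>\<^sub>M tuple_law W n) (space (restr W \<Otimes>\<^sub>M tuple_law W n))
    = emeasure (restr W) (space (restr W)) * emeasure (tuple_law W n) (space (tuple_law W n))"
    unfolding space_pair_measure by (rule n.emeasure_pair_measure_Times[OF sets.top sets.top])
  then interpret f: finite_measure "restr W \<Otimes>\<^sub>M tuple_law W n"
    by (intro finite_measureI) (simp add: ennreal_mult_eq_top_iff)
  show ?case by (simp add: f.finite_measure_distr)
qed

lemma mass_tuple_law: "emeasure (tuple_law W n) (space lf_config_space) = emeasure \<rho> W ^ n"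
proof (induction n)
  case 0 show ?case by simp
next
  case (Suc n)
  interpret n: finite_measure "tuple_law W n" by (rule finite_tuple_law)
  have "emeasure (tuple_law W (Suc n)) (space lf_config_space) = emeasure (restr W \<Otimes>\<^sub>M tuple_law W n) (space (restr W \<Otimes>\<^sub>M tuple_law W n))"
    by (subst tuple_law.simps, subst emeasure_distr)
       (measurable, auto intro!: arg_cong[where f="emeasure _"] simp: space_pair_measure lf_config_insert)
  also have "\<dots> = emeasure (restr W) (space (restr W)) * emeasure (tuple_law W n) (space (tuple_law W n))"
    unfolding space_pair_measure by (rule n.emeasure_pair_measure_Times[OF sets.top sets.top])
  also have "emeasure (restr W) (space (restr W)) = emeasure \<rho> W"
    using nn_integral_restr[OF W, of "\<lambda>_. 1"] by (simp add: nn_integral_indicator sets_\<rho>)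
  finally show ?case using Suc by simp
qed

lemma nn_integral_tuple_law_Suc:
  assumes [measurable]: "f \<in> borel_measurable lf_config_space"
  shows "(\<integral>\<^sup>+x. f x \<partial>tuple_law W (Suc n)) = (\<integral>\<^sup>+u. \<integral>\<^sup>+x. f (insert u x) \<partial>tuple_law W n \<partial>restr W)"
proof -
  interpret n: finite_measure "tuple_law W n" by (rule finite_tuple_law)
  have "(\<integral>\<^sup>+x. f x \<partial>tuple_law W (Suc n)) = (\<integral>\<^sup>+p. f (insert (fst p) (snd p)) \<partial>(restr W \<Otimes>\<^sub>M tuple_law W n))"
    unfolding tuple_law.simps by (subst nn_integral_distr) auto
  also have "\<dots> = (\<integral>\<^sup>+u. \<integral>\<^sup>+x. f (insert u x) \<partial>tuple_law W n \<partial>restr W)"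
    by (subst n.nn_integral_fst[symmetric]) auto
  finally show ?thesis .
qed

lemma swap_restr:
  assumes "sigma_finite_measure N" and [measurable]: "(\<lambda>p. f (fst p) (snd p)) \<in> borel_measurable (restr W \<Otimes>\<^sub>M N)"
  shows "(\<integral>\<^sup>+u. \<integral>\<^sup>+x. f u x \<partial>N \<partial>restr W) = (\<integral>\<^sup>+x. \<integral>\<^sup>+u. f u x \<partial>restr W \<partial>N)"
proof -
  interpret N: sigma_finite_measure N by fact
  interpret p: pair_sigma_finite "restr W" N ..
  show ?thesis using p.Fubini[of "\<lambda>p. f (fst p) (snd p)"] by simp
qed

text \<open>The reference measure is diffuse and a configuration is countable, so a random
location almost never falls into a given configuration.\<close>
lemma swap_restr_not_in:
  assumes N: "sigma_finite_measure N" "sets N = sets lf_config_space"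
    and f[measurable]: "(\<lambda>p. f (fst p) (snd p)) \<in> borel_measurable (seg_space \<Otimes>\<^sub>M lf_config_space)"
    and g[measurable]: "(\<lambda>p. g (fst p) (snd p)) \<in> borel_measurable (seg_space \<Otimes>\<^sub>M lf_config_space)"
    and eq: "\<And>u x. u \<in> space seg_space \<Longrightarrow> x \<in> space lf_config_space \<Longrightarrow> u \<notin> x \<Longrightarrow> f u x = g u x"
  shows "(\<integral>\<^sup>+u. \<integral>\<^sup>+x. f u x \<partial>N \<partial>restr W) = (\<integral>\<^sup>+u. \<integral>\<^sup>+x. g u x \<partial>N \<partial>restr W)"
proof -
  note N(2)[measurable_cong]
  have "(\<integral>\<^sup>+u. \<integral>\<^sup>+x. f u x \<partial>N \<partial>restr W) = (\<integral>\<^sup>+x. \<integral>\<^sup>+u. f u x \<partial>restr W \<partial>N)"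
    by (rule swap_restr[OF N(1)]) measurable
  also have "\<dots> = (\<integral>\<^sup>+x. \<integral>\<^sup>+u. g u x \<partial>restr W \<partial>N)"
  proof (rule nn_integral_cong)
    fix x assume "x \<in> space N"
    then have x: "x \<in> space lf_config_space" using sets_eq_imp_space_eq[OF N(2)] by simp
    show "(\<integral>\<^sup>+u. f u x \<partial>restr W) = (\<integral>\<^sup>+u. g u x \<partial>restr W)"
      using AE_restr_not_in[OF x W] eq[OF _ x] by (intro nn_integral_cong_AE) (auto elim!: AE_mp)
  qed
  also have "\<dots> = (\<integral>\<^sup>+u. \<integral>\<^sup>+x. g u x \<partial>N \<partial>restr W)"
    by (rule swap_restr[OF N(1), symmetric]) measurable
  finally show ?thesis .
qed

text \<open>In the induction step the outermost point is either the one removed, which yields the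
right-hand side directly, or it stays; then the induction hypothesis applies to the remaining
points, and Fubini's theorem exchanges the outermost point with the removed one.\<close>
lemma Mecke_tuple_law:
  assumes [measurable]: "q \<in> borel_measurable (seg_space \<Otimes>\<^sub>M lf_config_space)"
  shows "(\<integral>\<^sup>+x. \<integral>\<^sup>+u. q (u, x - {u}) \<partial>count_space x \<partial>tuple_law W (Suc n)) =
    of_nat (Suc n) * (\<integral>\<^sup>+u. \<integral>\<^sup>+x. q (u, x) \<partial>tuple_law W n \<partial>restr W)"
  using assms
proof (induction n arbitrary: q)
  case (0 q)
  note [measurable] = "0.prems"
  have 1: "(\<integral>\<^sup>+x. (\<integral>\<^sup>+v. q (v, insert u x - {v}) \<partial>count_space (insert u x)) \<partial>tuple_law W 0) = q (u, {})"
    if [measurable]: "u \<in> space seg_space" for u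
  proof -
    have "(\<lambda>x. \<integral>\<^sup>+v. q (v, insert u x - {v}) \<partial>count_space (insert u x)) \<in> borel_measurable lf_config_space"
      by (rule measurable_compose[OF _ sum_removed_measurable[OF "0.prems"]]) measurable
    then show ?thesis
      by (simp add: nn_integral_return nn_integral_count_space_finite)
  qed
  have 2: "(\<integral>\<^sup>+x. q (u, x) \<partial>tuple_law W 0) = q (u, {})" if [measurable]: "u \<in> space seg_space" for u
    by (simp add: nn_integral_return)
  show ?case
    by (subst nn_integral_tuple_law_Suc, measurable)
       (simp del: tuple_law.simps, rule nn_integral_cong, simp add: 1 2 del: tuple_law.simps)
next
  case (Suc n q)
  note [measurable] = Suc.prems
  interpret n: finite_measure "tuple_law W n" by (rule finite_tuple_law)
  interpret Sn: finite_measure "tuple_law W (Suc n)" by (rule finite_tuple_law)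
  \<comment> \<open>the sum over the old points, with the new point present but not removed\<close>
  let ?s = "\<lambda>v x. \<integral>\<^sup>+u. q (u, insert v (x - {u})) \<partial>count_space x"
  have qv[measurable]: "(\<lambda>p. q (fst p, insert v (snd p))) \<in> borel_measurable (seg_space \<Otimes>\<^sub>M lf_config_space)"
    if "v \<in> space seg_space" for v using that by measurable
  have "(\<lambda>w. \<integral>\<^sup>+u. (\<lambda>p. q (snd p, insert (fst (fst p)) (snd (fst p) - {snd p}))) (w, u) \<partial>count_space (snd w)) 
    \<in> borel_measurable (seg_space \<Otimes>\<^sub>M lf_config_space)"
    by (rule sum_over_config_measurable) measurable
  then have s_meas[measurable]: "(\<lambda>p. ?s (fst p) (snd p)) \<in> borel_measurable (seg_space \<Otimes>\<^sub>M lf_config_space)"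
    by simp
  have "(\<lambda>w. \<integral>\<^sup>+u. (\<lambda>p. q (snd p, insert (fst (fst p)) (snd (fst p)) - {snd p})) (w, u) \<partial>count_space (insert (fst w) (snd w))) 
    \<in> borel_measurable (seg_space \<Otimes>\<^sub>M lf_config_space)"
    by (rule sum_over_config_measurable) measurable
  then have t_meas[measurable]: "(\<lambda>p. \<integral>\<^sup>+u. q (u, insert (fst p) (snd p) - {u}) \<partial>count_space (insert (fst p) (snd p)))
     \<in> borel_measurable (seg_space \<Otimes>\<^sub>M lf_config_space)"
    by simp
  have "(\<integral>\<^sup>+x. \<integral>\<^sup>+u. q (u, x - {u}) \<partial>count_space x \<partial>tuple_law W (Suc (Suc n))) =
    (\<integral>\<^sup>+v. \<integral>\<^sup>+x. (\<integral>\<^sup>+u. q (u, insert v x - {u}) \<partial>count_space (insert v x)) \<partial>tuple_law W (Suc n) \<partial>restr W)"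
    by (rule nn_integral_tuple_law_Suc) measurable
  also have "\<dots> = (\<integral>\<^sup>+v. \<integral>\<^sup>+x. (q (v, x) + ?s v x) \<partial>tuple_law W (Suc n) \<partial>restr W)"
    by (rule swap_restr_not_in) (simp_all add: sum_removed_insert Sn.sigma_finite_measure_axioms del: tuple_law.simps, measurable)
  also have "\<dots> = (\<integral>\<^sup>+v. (\<integral>\<^sup>+x. q (v, x) \<partial>tuple_law W (Suc n)) + (\<integral>\<^sup>+x. ?s v x \<partial>tuple_law W (Suc n)) \<partial>restr W)"
  proof (intro nn_integral_cong nn_integral_add)
    fix v assume "v \<in> space (restr W)"
    then have v[measurable]: "v \<in> space seg_space" by simp
    show "(\<lambda>x. q (v, x)) \<in> borel_measurable (tuple_law W (Suc n))" by measurable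
    show "(\<lambda>x. ?s v x) \<in> borel_measurable (tuple_law W (Suc n))"
      using sum_removed_measurable[OF qv[OF v]] by simp
  qed
  also have "\<dots> = (\<integral>\<^sup>+v. (\<integral>\<^sup>+x. q (v, x) \<partial>tuple_law W (Suc n)) \<partial>restr W) + (\<integral>\<^sup>+v. (\<integral>\<^sup>+x. ?s v x \<partial>tuple_law W (Suc n)) \<partial>restr W)"
    by (rule nn_integral_add) measurable
  also have "(\<integral>\<^sup>+v. (\<integral>\<^sup>+x. ?s v x \<partial>tuple_law W (Suc n)) \<partial>restr W) =
     (\<integral>\<^sup>+v. of_nat (Suc n) * (\<integral>\<^sup>+u. \<integral>\<^sup>+x. q (u, insert v x) \<partial>tuple_law W n \<partial>restr W) \<partial>restr W)"
    using Suc.IH[OF qv] by (intro nn_integral_cong) simp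
  also have "\<dots> = of_nat (Suc n) * (\<integral>\<^sup>+v. \<integral>\<^sup>+u. \<integral>\<^sup>+x. q (u, insert v x) \<partial>tuple_law W n \<partial>restr W \<partial>restr W)"
    by (rule nn_integral_cmult) measurable
  also have "(\<integral>\<^sup>+v. \<integral>\<^sup>+u. \<integral>\<^sup>+x. q (u, insert v x) \<partial>tuple_law W n \<partial>restr W \<partial>restr W) =
     (\<integral>\<^sup>+u. \<integral>\<^sup>+v. \<integral>\<^sup>+x. q (u, insert v x) \<partial>tuple_law W n \<partial>restr W \<partial>restr W)"
    by (rule swap_restr[OF restr.sigma_finite_measure_axioms]) measurable
  also have "\<dots> = (\<integral>\<^sup>+u. \<integral>\<^sup>+x. q (u, x) \<partial>tuple_law W (Suc n) \<partial>restr W)"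
    by (intro nn_integral_cong nn_integral_tuple_law_Suc[symmetric]) simp
  finally show ?case
    by (simp add: distrib_right del: tuple_law.simps)
qed

end


text \<open>The Poisson process in the window without its normalizing factor, so that the empty
configuration has mass one. Mecke's formula is not affected by the choice of the factor, and the
domination result holds with constant one.\<close>
definition poisson :: "seg set \<Rightarrow> seg set measure" where
  "poisson W = (SOME K. sets K = sets lf_config_space \<and>
     (\<forall>f\<in>borel_measurable lf_config_space.
        (\<integral>\<^sup>+x. f x \<partial>K) = (\<integral>\<^sup>+n. inverse (fact n) * (\<integral>\<^sup>+x. f x \<partial>tuple_law W n) \<partial>count_space UNIV)))"

lemma poisson_exists:
  "\<exists>K. sets K = sets lf_config_space \<and>
     (\<forall>f\<in>borel_measurable lf_config_space.
        (\<integral>\<^sup>+x. f x \<partial>K) = (\<integral>\<^sup>+n. inverse (fact n) * (\<integral>\<^sup>+x. f x \<partial>tuple_law W n) \<partial>count_space UNIV))"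
  (is "\<exists>K. _ \<and> (\<forall>f\<in>_. _ = ?\<Phi> f)")
proof (rule functional_as_measure)
    fix f g :: "seg set \<Rightarrow> ennreal" assume "\<And>x. x \<in> space lf_config_space \<Longrightarrow> f x = g x"
    then have "(\<integral>\<^sup>+x. f x \<partial>tuple_law W n) = (\<integral>\<^sup>+x. g x \<partial>tuple_law W n)" for n by (intro nn_integral_cong) simp
    then show "?\<Phi> f = ?\<Phi> g" by simp
  next
    fix f g :: "seg set \<Rightarrow> ennreal"
    assume "f \<in> borel_measurable lf_config_space" "g \<in> borel_measurable lf_config_space"
    then show "?\<Phi> (\<lambda>x. f x + g x) = ?\<Phi> f + ?\<Phi> g"
      by (subst nn_integral_add[symmetric]) (auto simp: nn_integral_add distrib_left)
  next
    fix f :: "seg set \<Rightarrow> ennreal" and c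
    assume "f \<in> borel_measurable lf_config_space"
    then show "?\<Phi> (\<lambda>x. c * f x) = c * ?\<Phi> f"
      by (subst nn_integral_cmult[symmetric]) (auto simp: nn_integral_cmult mult.left_commute)
  next
    fix F :: "nat \<Rightarrow> seg set \<Rightarrow> ennreal"
    assume F: "\<And>i. F i \<in> borel_measurable lf_config_space" "incseq F"
    have "(\<integral>\<^sup>+x. (SUP i. F i x) \<partial>tuple_law W n) = (SUP i. \<integral>\<^sup>+x. F i x \<partial>tuple_law W n)" for n
      using F by (intro nn_integral_monotone_convergence_SUP) auto
    moreover have "incseq (\<lambda>i n. inverse (fact n) * (\<integral>\<^sup>+x. F i x \<partial>tuple_law W n))"
      using F(2) by (auto simp: incseq_def le_fun_def intro!: mult_left_mono nn_integral_mono)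
    ultimately show "?\<Phi> (\<lambda>x. SUP i. F i x) = (SUP i. ?\<Phi> (F i))"
      by (simp add: SUP_mult_left_ennreal[symmetric] nn_integral_monotone_convergence_SUP[symmetric])
qed

lemma sets_poisson [measurable_cong, simp]: "sets (poisson W) = sets lf_config_space"
  using someI_ex[OF poisson_exists[of W]] unfolding poisson_def[symmetric] by blast

lemma space_poisson [simp]: "space (poisson W) = space lf_config_space"
  by (rule sets_eq_imp_space_eq) simp

lemma nn_integral_poisson:
  "f \<in> borel_measurable lf_config_space \<Longrightarrow>
    (\<integral>\<^sup>+x. f x \<partial>poisson W) = (\<Sum>n. inverse (fact n) * (\<integral>\<^sup>+x. f x \<partial>tuple_law W n))"
  using someI_ex[OF poisson_exists[of W]] unfolding poisson_def[symmetric]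
  by (simp add: nn_integral_count_space_nat)

lemma card_pred_measurable:
  assumes "W \<in> sets seg_space" "W \<subseteq> win k" and X: "X \<in> M \<rightarrow>\<^sub>M lf_config_space"
  shows "Measurable.pred M (\<lambda>\<omega>. card (X \<omega> \<inter> W) = n)"
proof -
  have "(\<lambda>\<omega>. card (X \<omega> \<inter> W)) \<in> M \<rightarrow>\<^sub>M count_space UNIV"
    by (rule measurable_compose[OF X card_measurable[OF assms(1,2)]])
  then show ?thesis by measurable
qed

lemma inverse_fact_ennreal: "inverse (fact n :: ennreal) = ennreal (inverse (fact n))"
  by (simp add: inverse_ennreal flip: ennreal_fact)

lemma inverse_fact_Suc: "inverse (fact (Suc n)) * of_nat (Suc n) = (inverse (fact n) :: ennreal)"
proof -
  have "inverse (fact (Suc n)) * real (Suc n) = inverse (fact n)"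
    by (simp only: fact_Suc) (simp add: field_simps del: of_nat_Suc)
  then have "ennreal (inverse (fact (Suc n))) * ennreal (real (Suc n)) = ennreal (inverse (fact n))"
    by (subst ennreal_mult[symmetric]) (simp_all del: fact_Suc of_nat_Suc)
  then show ?thesis by (simp only: inverse_fact_ennreal ennreal_of_nat_eq_real_of_nat)
qed

lemma inverse_fact_mult: "inverse (fact n) * (fact n :: ennreal) = 1"
proof -
  have "ennreal (inverse (fact n)) * ennreal (fact n) = 1"
    by (subst ennreal_mult[symmetric]) simp_all
  then show ?thesis by (simp only: inverse_fact_ennreal ennreal_fact)
qed

context
  fixes W k assumes W [measurable]: "W \<in> sets seg_space" and W_win: "W \<subseteq> win k"
begin

text \<open>The total mass is the exponential series in the mass of the window.\<close>
lemma finite_poisson: "finite_measure (poisson W)"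
proof
  define c where "c = enn2real (emeasure \<rho> W)"
  have "emeasure \<rho> W \<le> emeasure \<rho> (win k)" using W_win by (intro emeasure_mono) (auto simp: sets_\<rho>)
  then have c: "emeasure \<rho> W = ennreal c"
    using finite_win[of k] by (auto simp: c_def less_top top_unique)
  have c0: "c \<ge> 0" by (simp add: c_def)
  have "emeasure (poisson W) (space (poisson W)) = (\<integral>\<^sup>+x. 1 \<partial>poisson W)" by simp
  also have "\<dots> = (\<Sum>n. inverse (fact n) * emeasure \<rho> W ^ n)"
    using mass_tuple_law[OF W W_win] by (subst nn_integral_poisson) auto
  also have "\<dots> = (\<Sum>n. ennreal (c ^ n /\<^sub>R fact n))"
    using c0 by (intro suminf_cong) (simp add: c ennreal_power ennreal_mult mult.commute inverse_ennreal
      flip: ennreal_fact)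
  also have "\<dots> < \<infinity>"
    using summable_exp_generic[of c] c0 by (subst suminf_ennreal2) (auto)
  finally show "emeasure (poisson W) (space (poisson W)) \<noteq> \<infinity>" by simp
qed

text \<open>The empty configuration is an atom of mass one. This gives a lower bound for the
partition function of the Gibbs process.\<close>
lemma poisson_ge_empty:
  assumes "f \<in> borel_measurable lf_config_space"
  shows "f {} \<le> (\<integral>\<^sup>+x. f x \<partial>poisson W)"
proof -
  have "f {} = (\<Sum>n<Suc 0. inverse (fact n) * (\<integral>\<^sup>+x. f x \<partial>tuple_law W n))"
    using assms by (simp add: nn_integral_return)
  also have "\<dots> \<le> (\<integral>\<^sup>+x. f x \<partial>poisson W)"
    unfolding nn_integral_poisson[OF assms] by (intro sum_le_suminf) auto
  finally show ?thesis .
qed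

lemma AE_poisson_subset: "AE x in poisson W. x \<subseteq> W"
proof -
  have *: "(\<integral>\<^sup>+x. indicator {x. \<not> x \<subseteq> W} x \<partial>tuple_law W n) = 0" for n
  proof (induction n)
    case 0 show ?case by (simp add: nn_integral_return)
  next
    case (Suc n)
    have "(\<integral>\<^sup>+x. indicator {x. \<not> x \<subseteq> W} x \<partial>tuple_law W (Suc n)) =
      (\<integral>\<^sup>+u. \<integral>\<^sup>+x. indicator {x. \<not> x \<subseteq> W} (insert u x) \<partial>tuple_law W n \<partial>restr W)"
      by (rule nn_integral_tuple_law_Suc[OF W W_win]) measurable
    also have "\<dots> = (\<integral>\<^sup>+u. (\<integral>\<^sup>+x. indicator {x. \<not> x \<subseteq> W} (insert u x) \<partial>tuple_law W n) * indicator W u \<partial>\<rho>)"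
    proof (rule nn_integral_restr[OF W])
      interpret n: finite_measure "tuple_law W n" by (rule finite_tuple_law[OF W W_win])
      show "(\<lambda>u. \<integral>\<^sup>+x. indicator {x. \<not> x \<subseteq> W} (insert u x) \<partial>tuple_law W n) \<in> borel_measurable seg_space"
        by measurable
    qed
    also have "\<dots> = (\<integral>\<^sup>+u. 0 \<partial>\<rho>)"
    proof (rule nn_integral_cong)
      fix u assume "u \<in> space \<rho>"
      have "(\<integral>\<^sup>+x. indicator {x. \<not> x \<subseteq> W} (insert u x) \<partial>tuple_law W n) = (\<integral>\<^sup>+x. indicator {x. \<not> x \<subseteq> W} x \<partial>tuple_law W n)"
        if "u \<in> W" using that by (intro nn_integral_cong) (auto split: split_indicator)
      then show "(\<integral>\<^sup>+x. indicator {x. \<not> x \<subseteq> W} (insert u x) \<partial>tuple_law W n) * indicator W u = 0"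
        using Suc by (auto split: split_indicator)
    qed
    finally show ?case by simp
  qed
  have "(\<integral>\<^sup>+x. indicator {x. \<not> x \<subseteq> W} x \<partial>poisson W) = 0"
    by (subst nn_integral_poisson) (auto simp: * simp del: tuple_law.simps)
  then have "AE x in poisson W. indicator {x. \<not> x \<subseteq> W} x = (0::ennreal)"
    by (subst (asm) nn_integral_0_iff_AE) auto
  then show ?thesis by (rule eventually_mono) (auto split: split_indicator_asm)
qed

text \<open>The weight of configurations with one more point is smaller by a factor that cancels
the number of points from which the removed one is chosen.\<close>
theorem Mecke:
  assumes q[measurable]: "q \<in> borel_measurable (seg_space \<Otimes>\<^sub>M lf_config_space)"
  shows "(\<integral>\<^sup>+x. \<integral>\<^sup>+u. q (u, x - {u}) \<partial>count_space x \<partial>poisson W) =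
    (\<integral>\<^sup>+u. \<integral>\<^sup>+x. q (u, x) \<partial>poisson W \<partial>restr W)"
proof -
  let ?F = "\<lambda>x. \<integral>\<^sup>+u. q (u, x - {u}) \<partial>count_space x"
  let ?I = "\<lambda>n. inverse (fact n) * (\<integral>\<^sup>+x. ?F x \<partial>tuple_law W n)"
  have J0: "(\<integral>\<^sup>+x. ?F x \<partial>tuple_law W 0) = 0"
    by (simp add: nn_integral_return nn_integral_count_space_finite)
  have "(\<integral>\<^sup>+x. ?F x \<partial>poisson W) = (\<Sum>n. ?I n)" by (rule nn_integral_poisson) measurable
  also have "\<dots> = (\<Sum>n. ?I (Suc n))"
  proof -
    have "(\<Sum>n. ?I n) = (\<Sum>n. ?I (n + 1)) + (\<Sum>n<1. ?I n)"
      by (rule suminf_offset) simp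
    also have "(\<Sum>n<1. ?I n) = 0" using J0 by (simp del: tuple_law.simps)
    finally show ?thesis by (simp del: tuple_law.simps)
  qed
  also have "\<dots> = (\<Sum>n. inverse (fact n) * (\<integral>\<^sup>+u. \<integral>\<^sup>+x. q (u, x) \<partial>tuple_law W n \<partial>restr W))"
    unfolding Mecke_tuple_law[OF W W_win q] mult.assoc[symmetric] inverse_fact_Suc ..
  also have "\<dots> = (\<Sum>n. \<integral>\<^sup>+u. inverse (fact n) * (\<integral>\<^sup>+x. q (u, x) \<partial>tuple_law W n) \<partial>restr W)"
  proof (intro suminf_cong nn_integral_cmult[symmetric])
    fix n interpret n: finite_measure "tuple_law W n" by (rule finite_tuple_law[OF W W_win])
    show "(\<lambda>u. \<integral>\<^sup>+x. q (u, x) \<partial>tuple_law W n) \<in> borel_measurable (restr W)" by measurable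
  qed
  also have "\<dots> = (\<integral>\<^sup>+u. (\<Sum>n. inverse (fact n) * (\<integral>\<^sup>+x. q (u, x) \<partial>tuple_law W n)) \<partial>restr W)"
  proof (rule nn_integral_suminf[symmetric])
    fix n interpret n: finite_measure "tuple_law W n" by (rule finite_tuple_law[OF W W_win])
    show "(\<lambda>u. inverse (fact n) * (\<integral>\<^sup>+x. q (u, x) \<partial>tuple_law W n)) \<in> borel_measurable (restr W)" by measurable
  qed
  also have "\<dots> = (\<integral>\<^sup>+u. \<integral>\<^sup>+x. q (u, x) \<partial>poisson W \<partial>restr W)"
  proof (rule nn_integral_cong)
    fix u assume "u \<in> space (restr W)"
    then have [measurable]: "u \<in> space seg_space" by simp
    show "(\<Sum>n. inverse (fact n) * (\<integral>\<^sup>+x. q (u, x) \<partial>tuple_law W n)) = (\<integral>\<^sup>+x. q (u, x) \<partial>poisson W)"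
      by (rule nn_integral_poisson[symmetric]) measurable
  qed
  finally show ?thesis .
qed

context
  fixes Q :: "seg set measure"
  assumes sets_Q [measurable_cong]: "sets Q = sets lf_config_space"
    and finite_Q: "finite_measure Q"
    and sub: "\<And>q. q \<in> borel_measurable (seg_space \<Otimes>\<^sub>M lf_config_space) \<Longrightarrow>
      (\<integral>\<^sup>+x. \<integral>\<^sup>+u. q (u, x - {u}) * indicator W u \<partial>count_space x \<partial>Q) \<le>
      (\<integral>\<^sup>+u. \<integral>\<^sup>+x. q (u, x) \<partial>Q \<partial>restr W)"
begin

interpretation Q: finite_measure Q by (rule finite_Q)

lemma space_Q: "space Q = space lf_config_space"
  using sets_Q by (rule sets_eq_imp_space_eq)

text \<open>Removing the points of the window one by one, each removal costs at most an
integration over the reference measure, whatever the rest of the configuration looks like; a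
configuration with a given number of points is reached in as many ways as there are orderings,
which gives the factorial.\<close>
lemma dominated_by_tuple_law:
  assumes "F \<in> borel_measurable (lf_config_space \<Otimes>\<^sub>M lf_config_space)"
  shows "fact n * (\<integral>\<^sup>+x. F (x - W, x \<inter> W) * indicator {x. card (x \<inter> W) = n} x \<partial>Q) \<le>
    (\<integral>\<^sup>+x. \<integral>\<^sup>+y. F (x - W, y) \<partial>tuple_law W n \<partial>Q)"
  using assms
proof (induction n arbitrary: F)
  case (0 F)
  note [measurable] = "0.prems"
  have fin: "finite (x \<inter> W)" if "x \<in> space Q" for x
    using lf_config_finite[OF _ W_win] that by (simp add: space_Q)
  have "(\<integral>\<^sup>+y. F (x - W, y) \<partial>tuple_law W 0) = F (x - W, {})" if "x \<in> space Q" for x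
    using that measurable_space[OF diff_config_measurable[OF measurable_ident W]] 
    by (simp add: nn_integral_return space_Q)
  then have "(\<integral>\<^sup>+x. \<integral>\<^sup>+y. F (x - W, y) \<partial>tuple_law W 0 \<partial>Q) = (\<integral>\<^sup>+x. F (x - W, {}) \<partial>Q)"
    by (intro nn_integral_cong)
  moreover have "(\<integral>\<^sup>+x. F (x - W, x \<inter> W) * indicator {x. card (x \<inter> W) = 0} x \<partial>Q) \<le> (\<integral>\<^sup>+x. F (x - W, {}) \<partial>Q)"
    using fin by (intro nn_integral_mono) (auto split: split_indicator)
  ultimately show ?case by simp
next
  case (Suc n F)
  note [measurable] = Suc.prems
  note [measurable] = card_pred_measurable[OF W W_win]
  interpret n: finite_measure "tuple_law W n" by (rule finite_tuple_law[OF W W_win])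
  define q where "q p = F (snd p - W, insert (fst p) (snd p \<inter> W)) * indicator {p. card (snd p \<inter> W) = n} p" for p
  have q[measurable]: "q \<in> borel_measurable (seg_space \<Otimes>\<^sub>M lf_config_space)" unfolding q_def by measurable
  have *: "of_nat (Suc n) * (F (x - W, x \<inter> W) * indicator {x. card (x \<inter> W) = Suc n} x) \<le>
    (\<integral>\<^sup>+u. q (u, x - {u}) * indicator W u \<partial>count_space x)" if x: "x \<in> space Q" for x
  proof (cases "card (x \<inter> W) = Suc n")
    case True
    then have fin: "finite (x \<inter> W)" by (intro card_ge_0_finite) simp
    have "of_nat (Suc n) * (F (x - W, x \<inter> W) * indicator {x. card (x \<inter> W) = Suc n} x) =
      F (x - W, x \<inter> W) * (\<integral>\<^sup>+u. indicator W u \<partial>count_space x)"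
      using True fin by (simp add: sum_indicator_eq mult.commute)
    also have "\<dots> = (\<integral>\<^sup>+u. F (x - W, x \<inter> W) * indicator W u \<partial>count_space x)"
      by (simp add: nn_integral_cmult)
    also have "\<dots> = (\<integral>\<^sup>+u. q (u, x - {u}) * indicator W u \<partial>count_space x)"
    proof (rule nn_integral_cong)
      fix u assume u: "u \<in> space (count_space x)"
      show "F (x - W, x \<inter> W) * indicator W u = q (u, x - {u}) * indicator W u"
      proof (cases "u \<in> W")
        case uW: True
        have "x - {u} - W = x - W" "insert u ((x - {u}) \<inter> W) = x \<inter> W" using u uW by auto
        moreover have "(x - {u}) \<inter> W = (x \<inter> W) - {u}" by auto
        then have "card ((x - {u}) \<inter> W) = n" using u uW True fin by simp
        ultimately show ?thesis by (simp add: q_def)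
      qed simp
    qed
    finally show ?thesis by simp
  qed simp
  have "fact (Suc n) * (\<integral>\<^sup>+x. F (x - W, x \<inter> W) * indicator {x. card (x \<inter> W) = Suc n} x \<partial>Q) =
    fact n * (\<integral>\<^sup>+x. of_nat (Suc n) * (F (x - W, x \<inter> W) * indicator {x. card (x \<inter> W) = Suc n} x) \<partial>Q)"
    by (subst nn_integral_cmult) (measurable, simp add: mult_ac)
  also have "\<dots> \<le> fact n * (\<integral>\<^sup>+x. \<integral>\<^sup>+u. q (u, x - {u}) * indicator W u \<partial>count_space x \<partial>Q)"
    by (intro mult_left_mono nn_integral_mono *) auto
  also have "\<dots> \<le> fact n * (\<integral>\<^sup>+u. \<integral>\<^sup>+x. q (u, x) \<partial>Q \<partial>restr W)"
    by (intro mult_left_mono sub) auto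
  also have "\<dots> = (\<integral>\<^sup>+u. fact n * (\<integral>\<^sup>+x. q (u, x) \<partial>Q) \<partial>restr W)"
    by (rule nn_integral_cmult[symmetric]) measurable
  also have "\<dots> \<le> (\<integral>\<^sup>+u. \<integral>\<^sup>+x. \<integral>\<^sup>+y. F (x - W, insert u y) \<partial>tuple_law W n \<partial>Q \<partial>restr W)"
  proof (rule nn_integral_mono)
    fix u assume "u \<in> space (restr W)"
    then have [measurable]: "u \<in> space seg_space" by simp
    have "(\<lambda>p. F (fst p, insert u (snd p))) \<in> borel_measurable (lf_config_space \<Otimes>\<^sub>M lf_config_space)"
      by measurable
    from Suc.IH[OF this] show "fact n * (\<integral>\<^sup>+x. q (u, x) \<partial>Q) \<le>
       (\<integral>\<^sup>+x. \<integral>\<^sup>+y. F (x - W, insert u y) \<partial>tuple_law W n \<partial>Q)"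
      by (simp add: q_def indicator_def)
  qed
  also have "\<dots> = (\<integral>\<^sup>+x. \<integral>\<^sup>+u. \<integral>\<^sup>+y. F (x - W, insert u y) \<partial>tuple_law W n \<partial>restr W \<partial>Q)"
    by (rule swap_restr[OF W W_win Q.sigma_finite_measure_axioms]) measurable
  also have "\<dots> = (\<integral>\<^sup>+x. \<integral>\<^sup>+y. F (x - W, y) \<partial>tuple_law W (Suc n) \<partial>Q)"
  proof (rule nn_integral_cong)
    fix x assume "x \<in> space Q"
    then have [measurable]: "x - W \<in> space lf_config_space"
      using lf_config_subset by (auto simp: space_Q)
    show "(\<integral>\<^sup>+u. \<integral>\<^sup>+y. F (x - W, insert u y) \<partial>tuple_law W n \<partial>restr W) = (\<integral>\<^sup>+y. F (x - W, y) \<partial>tuple_law W (Suc n))"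
      by (rule nn_integral_tuple_law_Suc[OF W W_win, symmetric]) measurable
  qed
  finally show ?case .
qed

text \<open>The central estimate. A process whose conditional intensity is at most that of the
reference measure has, given its restriction to the complement of the window, a density of at most
one with respect to the Poisson measure in the window. The bound depends on the window only. It
makes limits of such processes countably additive and shows that their laws on larger windows
extend those on smaller ones through kernels.\<close>
lemma dominated_by_poisson:
  assumes F[measurable]: "F \<in> borel_measurable (lf_config_space \<Otimes>\<^sub>M lf_config_space)"
  shows "(\<integral>\<^sup>+x. F (x - W, x \<inter> W) \<partial>Q) \<le> (\<integral>\<^sup>+x. \<integral>\<^sup>+y. F (x - W, y) \<partial>poisson W \<partial>Q)"
proof -
  note [measurable] = card_pred_measurable[OF W W_win]
  have 1: "(\<Sum>n. indicator {x. card (x \<inter> W) = n} x) = (1::ennreal)" for x :: "seg set"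
    by (subst suminf_finite[of "{card (x \<inter> W)}"]) auto
  have "(\<integral>\<^sup>+x. F (x - W, x \<inter> W) \<partial>Q) = (\<integral>\<^sup>+x. (\<Sum>n. F (x - W, x \<inter> W) * indicator {x. card (x \<inter> W) = n} x) \<partial>Q)"
    by (simp add: 1)
  also have "\<dots> = (\<Sum>n. \<integral>\<^sup>+x. F (x - W, x \<inter> W) * indicator {x. card (x \<inter> W) = n} x \<partial>Q)"
    by (rule nn_integral_suminf) measurable
  also have "\<dots> \<le> (\<Sum>n. inverse (fact n) * (\<integral>\<^sup>+x. \<integral>\<^sup>+y. F (x - W, y) \<partial>tuple_law W n \<partial>Q))"
  proof (intro suminf_le)
    fix n
    let ?A = "\<integral>\<^sup>+x. F (x - W, x \<inter> W) * indicator {x. card (x \<inter> W) = n} x \<partial>Q"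
    have "?A = inverse (fact n) * (fact n * ?A)"
      by (simp only: mult.assoc[symmetric] inverse_fact_mult mult_1)
    also have "\<dots> \<le> inverse (fact n) * (\<integral>\<^sup>+x. \<integral>\<^sup>+y. F (x - W, y) \<partial>tuple_law W n \<partial>Q)"
      by (intro mult_left_mono dominated_by_tuple_law F) auto
    finally show "?A \<le> inverse (fact n) * (\<integral>\<^sup>+x. \<integral>\<^sup>+y. F (x - W, y) \<partial>tuple_law W n \<partial>Q)" .
  qed auto
  also have "\<dots> = (\<Sum>n. \<integral>\<^sup>+x. inverse (fact n) * (\<integral>\<^sup>+y. F (x - W, y) \<partial>tuple_law W n) \<partial>Q)"
  proof (intro suminf_cong nn_integral_cmult[symmetric])
    fix n interpret n: finite_measure "tuple_law W n" by (rule finite_tuple_law[OF W W_win])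
    show "(\<lambda>x. \<integral>\<^sup>+y. F (x - W, y) \<partial>tuple_law W n) \<in> borel_measurable Q" by measurable
  qed
  also have "\<dots> = (\<integral>\<^sup>+x. (\<Sum>n. inverse (fact n) * (\<integral>\<^sup>+y. F (x - W, y) \<partial>tuple_law W n)) \<partial>Q)"
  proof (rule nn_integral_suminf[symmetric])
    fix n interpret n: finite_measure "tuple_law W n" by (rule finite_tuple_law[OF W W_win])
    show "(\<lambda>x. inverse (fact n) * (\<integral>\<^sup>+y. F (x - W, y) \<partial>tuple_law W n)) \<in> borel_measurable Q" by measurable
  qed
  also have "\<dots> = (\<integral>\<^sup>+x. \<integral>\<^sup>+y. F (x - W, y) \<partial>poisson W \<partial>Q)"
  proof (rule nn_integral_cong)
    fix x assume "x \<in> space Q"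
    then have [measurable]: "x - W \<in> space lf_config_space"
      using lf_config_subset by (auto simp: space_Q)
    show "(\<Sum>n. inverse (fact n) * (\<integral>\<^sup>+y. F (x - W, y) \<partial>tuple_law W n)) = (\<integral>\<^sup>+y. F (x - W, y) \<partial>poisson W)"
      by (rule nn_integral_poisson[symmetric]) measurable
  qed
  finally show ?thesis .
qed

end

end

end

section \<open>The Gibbs process in a window\<close>

lemma sets_ref_measure [measurable_cong, simp]: "sets ref_measure = sets seg_space"
  unfolding ref_measure_def seg_space_def by (intro sets_pair_measure_cong) (auto simp: sets_restrict_space)

lemma space_ref_measure [simp]: "space ref_measure = space seg_space"
  by (rule sets_eq_imp_space_eq) simp

definition dir_measure :: "real measure" where
  "dir_measure = density (restrict_space lborel {0..<pi}) (\<lambda>_. ennreal (1 / pi))"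

lemma sets_dir_measure [measurable_cong, simp]: "sets dir_measure = sets (restrict_space borel {0..<pi})"
  by (simp add: dir_measure_def sets_restrict_space)

lemma finite_dir_measure: "finite_measure dir_measure"
proof
  have "emeasure dir_measure (space dir_measure) = (\<integral>\<^sup>+x. 1 \<partial>dir_measure)" by simp
  also have "\<dots> = (\<integral>\<^sup>+x. ennreal (1 / pi) \<partial>restrict_space lborel {0..<pi})"
    unfolding dir_measure_def by (subst nn_integral_density) auto
  also have "\<dots> < \<infinity>"
    by (simp add: emeasure_restrict_space space_restrict_space ennreal_mult_less_top)
  finally show "emeasure dir_measure (space dir_measure) \<noteq> \<infinity>" by simp
qed

interpretation dir: finite_measure dir_measure by (rule finite_dir_measure)

lemma nn_integral_ref:
  assumes "f \<in> borel_measurable seg_space"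
  shows "(\<integral>\<^sup>+u. f u \<partial>ref_measure) = (\<integral>\<^sup>+y. \<integral>\<^sup>+\<phi>. f (y, \<phi>) \<partial>dir_measure \<partial>lborel)"
proof -
  have "sets (lborel \<Otimes>\<^sub>M dir_measure) = sets seg_space"
    using sets_ref_measure unfolding ref_measure_def dir_measure_def[symmetric] .
  then have "f \<in> borel_measurable (lborel \<Otimes>\<^sub>M dir_measure)"
    using assms measurable_cong_sets[OF _ refl] by blast
  then show ?thesis
    using dir.nn_integral_fst unfolding ref_measure_def dir_measure_def[symmetric] by metis
qed

text \<open>The reference measure inherits the translation invariance of Lebesgue measure.\<close>
lemma nn_integral_ref_sh:
  assumes f[measurable]: "f \<in> borel_measurable seg_space"
  shows "(\<integral>\<^sup>+u. f (sh t u) \<partial>ref_measure) = (\<integral>\<^sup>+u. f u \<partial>ref_measure)"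
proof -
  have f'[measurable]: "f \<in> borel_measurable (borel \<Otimes>\<^sub>M restrict_space borel {0..<pi})"
    using f by (simp add: seg_space_def)
  have "(\<lambda>u. f (sh t u)) \<in> borel_measurable seg_space" by measurable
  then have "(\<integral>\<^sup>+u. f (sh t u) \<partial>ref_measure) = (\<integral>\<^sup>+y. \<integral>\<^sup>+\<phi>. f (sh t (y, \<phi>)) \<partial>dir_measure \<partial>lborel)"
    by (rule nn_integral_ref)
  also have "\<dots> = (\<integral>\<^sup>+y. (\<lambda>y. \<integral>\<^sup>+\<phi>. f (y, \<phi>) \<partial>dir_measure) (t + y) \<partial>lborel)"
    by (simp add: sh_def add.commute)
  also have "\<dots> = (\<integral>\<^sup>+y. \<integral>\<^sup>+\<phi>. f (y, \<phi>) \<partial>dir_measure \<partial>distr lborel borel ((+) t))"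
    by (subst nn_integral_distr) auto
  also have "\<dots> = (\<integral>\<^sup>+u. f u \<partial>ref_measure)"
    by (simp add: lborel_distr_plus nn_integral_ref)
  finally show ?thesis .
qed

locale segment_gibbs =
  fixes r a \<tau> :: real and g :: "real \<Rightarrow> real"
  assumes r: "r > 0" and a: "a \<le> 0" and \<tau>: "\<tau> > 0"
    and g_measurable [measurable]: "g \<in> borel_measurable (restrict_space borel {0..<pi})"
    and g_nonneg: "\<And>\<phi>. \<phi> \<in> {0..<pi} \<Longrightarrow> g \<phi> \<ge> 0"
    and g_mass: "(\<integral>\<^sup>+\<phi>. ennreal (g \<phi>) \<partial>restrict_space lborel {0..<pi}) = 1"
begin

definition dens :: "seg \<Rightarrow> ennreal" where "dens u = ennreal (\<tau> * g (snd u))"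

lemma dens_measurable [measurable]: "dens \<in> borel_measurable seg_space"
  unfolding dens_def by measurable

definition \<rho> :: "seg measure" where "\<rho> = density ref_measure dens"

lemma sets_\<rho> [measurable_cong, simp]: "sets \<rho> = sets seg_space"
  by (simp add: \<rho>_def)

lemma nn_integral_\<rho>: "f \<in> borel_measurable seg_space \<Longrightarrow> (\<integral>\<^sup>+u. f u \<partial>\<rho>) = (\<integral>\<^sup>+u. dens u * f u \<partial>ref_measure)"
  unfolding \<rho>_def by (rule nn_integral_density) auto

lemma nn_integral_\<rho>_sh:
  assumes f[measurable]: "f \<in> borel_measurable seg_space"
  shows "(\<integral>\<^sup>+u. f (sh t u) \<partial>\<rho>) = (\<integral>\<^sup>+u. f u \<partial>\<rho>)"
proof -
  have "(\<integral>\<^sup>+u. f (sh t u) \<partial>\<rho>) = (\<integral>\<^sup>+u. (\<lambda>u. dens u * f u) (sh t u) \<partial>ref_measure)"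
    by (subst nn_integral_\<rho>) (measurable, simp add: dens_def)
  also have "\<dots> = (\<integral>\<^sup>+u. dens u * f u \<partial>ref_measure)"
    by (rule nn_integral_ref_sh) measurable
  finally show ?thesis by (simp add: nn_integral_\<rho>)
qed

sublocale diffuse_intensity \<rho>
proof
  show "sets \<rho> = sets seg_space" by simp
  show "emeasure \<rho> (win k) < \<infinity>" for k
  proof -
    let ?b = "ball 0 (real k) :: (real^2) set"
    have dens': "(\<integral>\<^sup>+\<phi>. ennreal (\<tau> * g \<phi>) \<partial>dir_measure) = ennreal (\<tau> / pi)"
    proof -
      have "(\<integral>\<^sup>+\<phi>. ennreal (\<tau> * g \<phi>) \<partial>dir_measure) =
        (\<integral>\<^sup>+\<phi>. ennreal (\<tau> / pi) * ennreal (g \<phi>) \<partial>restrict_space lborel {0..<pi})"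
        unfolding dir_measure_def using \<tau> g_nonneg
        by (subst nn_integral_density)
          (auto simp: space_restrict_space ennreal_mult[symmetric] cong: measurable_cong_sets 
             intro!: nn_integral_cong measurable_compose[OF _ measurable_ennreal] arg_cong[where f=ennreal])
      also have "\<dots> = ennreal (\<tau> / pi) * 1"
        unfolding g_mass[symmetric] by (rule nn_integral_cmult) (auto cong: measurable_cong_sets)
      finally show ?thesis by simp
    qed
    have [measurable]: "(\<lambda>u. indicator ?b (fst u) :: ennreal) \<in> borel_measurable seg_space"
      by (rule measurable_compose[OF fst_seg_measurable borel_measurable_indicator]) simp
    have "emeasure \<rho> (win k) = (\<integral>\<^sup>+u. indicator (win k) u \<partial>\<rho>)" by simp
    also have "\<dots> = (\<integral>\<^sup>+u. dens u * indicator (win k) u \<partial>ref_measure)" by (rule nn_integral_\<rho>) simp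
    also have "\<dots> = (\<integral>\<^sup>+u. dens u * indicator ?b (fst u) \<partial>ref_measure)"
      by (intro nn_integral_cong) (auto simp: win_def split: split_indicator)
    also have "\<dots> = (\<integral>\<^sup>+y. \<integral>\<^sup>+\<phi>. ennreal (\<tau> * g \<phi>) * indicator ?b y \<partial>dir_measure \<partial>lborel)"
      by (subst nn_integral_ref) (simp_all add: dens_def)
    also have "\<dots> = (\<integral>\<^sup>+y. ennreal (\<tau> / pi) * indicator ?b y \<partial>lborel)"
      by (subst nn_integral_multc) (auto simp: dens' cong: measurable_cong_sets)
    also have "\<dots> = ennreal (\<tau> / pi) * emeasure lborel ?b"
      by (subst nn_integral_cmult) (auto intro!: borel_measurable_indicator)
    also have "\<dots> < \<infinity>"
      using emeasure_bounded_finite[of ?b] by (simp add: ennreal_mult_less_top)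
    finally show ?thesis .
  qed
  show "emeasure \<rho> {u} = 0" for u
  proof (cases "{u} \<in> sets seg_space")
    case True
    then have u: "u \<in> space seg_space" using sets.sets_into_space by blast
    have "emeasure \<rho> {u} = (\<integral>\<^sup>+v. dens v * indicator {u} v \<partial>ref_measure)"
      using True by (simp add: \<rho>_def emeasure_density)
    also have "\<dots> = (\<integral>\<^sup>+y. \<integral>\<^sup>+\<phi>. dens (y, \<phi>) * indicator {u} (y, \<phi>) \<partial>dir_measure \<partial>lborel)"
      using True by (intro nn_integral_ref) auto
    also have "\<dots> = 0"
    proof (rule nn_integral_zero')
      have "AE y in lborel. y \<noteq> fst u" using AE_lborel_singleton by auto
      then show "AE y in lborel. (\<integral>\<^sup>+\<phi>. dens (y, \<phi>) * indicator {u} (y, \<phi>) \<partial>dir_measure) = 0"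
      proof (rule eventually_mono)
        fix y assume "y \<noteq> fst u"
        then have "indicator {u} (y, \<phi>) = (0 :: ennreal)" for \<phi> by (auto split: split_indicator)
        then show "(\<integral>\<^sup>+\<phi>. dens (y, \<phi>) * indicator {u} (y, \<phi>) \<partial>dir_measure) = 0" by simp
      qed
    qed
    finally show ?thesis .
  qed (simp add: emeasure_notin_sets)
qed

text \<open>The interaction part of the conditional intensity; the remaining factor is absorbed
into the reference measure.\<close>
definition hit_weight :: "seg set \<Rightarrow> seg \<Rightarrow> ennreal" where
  "hit_weight x u = ennreal (exp (a * real (num_hits r x u)))"

lemma hit_weight_measurable [measurable]:
  assumes [measurable]: "X \<in> M \<rightarrow>\<^sub>M lf_config_space" "U \<in> M \<rightarrow>\<^sub>M seg_space"
  shows "(\<lambda>\<omega>. hit_weight (X \<omega>) (U \<omega>)) \<in> borel_measurable M"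
  unfolding hit_weight_def using num_hits_measurable[OF r assms] by measurable

lemma hit_weight_le_1: "hit_weight x u \<le> 1"
  using a by (auto simp: hit_weight_def mult_nonpos_nonneg)

lemma hit_weight_shift [simp]: "hit_weight (shift t x) (sh t u) = hit_weight x u"
  by (simp add: hit_weight_def)

text \<open>Every hitting pair is counted from both of its segments, hence the factor one half. A
configuration with infinitely many hitting pairs gets the default weight one; the Poisson measure
of a bounded window does not charge these.\<close>
definition boltzmann :: "seg set \<Rightarrow> ennreal" where
  "boltzmann x = ennreal (exp (a / 2 * enn2real (\<integral>\<^sup>+u. of_nat (num_hits r x u) \<partial>count_space x)))"

lemma boltzmann_measurable [measurable]: "boltzmann \<in> borel_measurable lf_config_space"
proof -
  have "(\<lambda>x. \<integral>\<^sup>+u. (\<lambda>p. of_nat (num_hits r (fst p) (snd p))) (x, u) \<partial>count_space x :: ennreal) \<in> borel_measurable lf_config_space"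
    by (intro sum_over_config_measurable num_hits_ennreal_measurable[OF r]) measurable
  then show ?thesis unfolding boltzmann_def by simp
qed

lemma boltzmann_le_1: "boltzmann x \<le> 1"
  using a by (auto simp: boltzmann_def mult_nonpos_nonneg)

lemma boltzmann_finite: "finite x \<Longrightarrow> boltzmann x = ennreal (exp (a / 2 * real (\<Sum>u\<in>x. num_hits r x u)))"
  by (simp add: boltzmann_def nn_integral_count_space_finite of_nat_sum[symmetric] del: of_nat_sum)

text \<open>A new segment adds one hitting pair for each segment that it hits, and both ends of
each such pair see one more hit.\<close>
lemma boltzmann_insert:
  assumes x: "finite x" and u: "u \<notin> x"
  shows "boltzmann (insert u x) = hit_weight x u * boltzmann x"
proof -
  have 1: "num_hits r (insert u x) u = num_hits r x u"
    unfolding num_hits_def using u by (intro arg_cong[where f=card]) auto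
  have 2: "num_hits r (insert u x) v = num_hits r x v + (if hits r v u then 1 else 0)" if v: "v \<in> x" for v
  proof -
    have "{y \<in> insert u x - {v}. hits r v y} = {y \<in> x - {v}. hits r v y} \<union> (if hits r v u then {u} else {})"
      using v u by auto
    moreover have "finite {y \<in> x - {v}. hits r v y}" using x by auto
    ultimately show ?thesis using u unfolding num_hits_def by auto
  qed
  have 3: "(\<Sum>v\<in>x. if hits r v u then 1 else 0) = num_hits r x u"
  proof -
    have "{v \<in> x - {u}. hits r u v} = {v \<in> x. hits r v u}" using u by (auto simp: hits_commute)
    then show ?thesis using x by (simp add: num_hits_def sum.If_cases Int_def)
  qed
  have "(\<Sum>v\<in>insert u x. num_hits r (insert u x) v) = num_hits r x u + (\<Sum>v\<in>x. num_hits r (insert u x) v)"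
    using x u by (simp add: 1)
  also have "(\<Sum>v\<in>x. num_hits r (insert u x) v) = (\<Sum>v\<in>x. num_hits r x v) + num_hits r x u"
    using 2 by (simp add: sum.distrib 3)
  finally have "a / 2 * real (\<Sum>v\<in>insert u x. num_hits r (insert u x) v) =
    a * real (num_hits r x u) + a / 2 * real (\<Sum>v\<in>x. num_hits r x v)"
    by (simp add: field_simps)
  then show ?thesis
    using x by (simp only: boltzmann_finite finite_insert hit_weight_def ennreal_mult[symmetric] exp_ge_zero exp_add)
qed

definition Z :: "seg set \<Rightarrow> ennreal" where "Z W = (\<integral>\<^sup>+x. boltzmann x \<partial>poisson W)"

definition gibbs :: "seg set \<Rightarrow> seg set measure" where
  "gibbs W = density (poisson W) (\<lambda>x. boltzmann x / Z W)"

lemma sets_gibbs [measurable_cong, simp]: "sets (gibbs W) = sets lf_config_space"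
  by (simp add: gibbs_def)

lemma space_gibbs [simp]: "space (gibbs W) = space lf_config_space"
  by (rule sets_eq_imp_space_eq) simp

lemma nn_integral_gibbs:
  "f \<in> borel_measurable lf_config_space \<Longrightarrow> (\<integral>\<^sup>+x. f x \<partial>gibbs W) = (\<integral>\<^sup>+x. boltzmann x / Z W * f x \<partial>poisson W)"
  unfolding gibbs_def by (rule nn_integral_density) auto

context
  fixes W k assumes W [measurable]: "W \<in> sets seg_space" and W_win: "W \<subseteq> win k"
begin

interpretation P: finite_measure "poisson W" by (rule finite_poisson[OF W W_win])

lemma Z_bounds: "0 < Z W" "Z W < \<top>"
proof -
  have "(1::ennreal) = boltzmann {}" by (simp add: boltzmann_finite)
  also have "\<dots> \<le> Z W" unfolding Z_def by (rule poisson_ge_empty[OF W W_win]) simp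
  finally show "0 < Z W" by (rule less_le_trans[rotated]) simp
  have "Z W \<le> (\<integral>\<^sup>+x. 1 \<partial>poisson W)" unfolding Z_def by (intro nn_integral_mono boltzmann_le_1)
  also have "\<dots> < \<top>" by (simp add: P.emeasure_finite less_top[symmetric] del: space_poisson)
  finally show "Z W < \<top>" .
qed

lemma prob_gibbs: "prob_space (gibbs W)"
proof
  have "emeasure (gibbs W) (space (gibbs W)) = (\<integral>\<^sup>+x. 1 \<partial>gibbs W)" by simp
  also have "\<dots> = (\<integral>\<^sup>+x. boltzmann x / Z W * 1 \<partial>poisson W)" by (rule nn_integral_gibbs) simp
  also have "\<dots> = Z W / Z W" unfolding Z_def by (simp add: nn_integral_divide)
  also have "\<dots> = 1" using Z_bounds by (intro ennreal_divide_self) auto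
  finally show "emeasure (gibbs W) (space (gibbs W)) = 1" .
qed

text \<open>Mecke's formula moves the density from the full configuration to the configuration
with the removed point put back, and there the Boltzmann weight splits off the interaction of that
point.\<close>
theorem GNZ_gibbs:
  assumes q[measurable]: "q \<in> borel_measurable (seg_space \<Otimes>\<^sub>M lf_config_space)"
  shows "(\<integral>\<^sup>+x. \<integral>\<^sup>+u. q (u, x - {u}) \<partial>count_space x \<partial>gibbs W) =
    (\<integral>\<^sup>+u. \<integral>\<^sup>+x. hit_weight x u * q (u, x) \<partial>gibbs W \<partial>restr W)"
proof -
  let ?d = "\<lambda>x. boltzmann x / Z W"
  define q' where "q' p = ?d (insert (fst p) (snd p)) * q p" for p
  have q'[measurable]: "q' \<in> borel_measurable (seg_space \<Otimes>\<^sub>M lf_config_space)"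
    unfolding q'_def by measurable
  have "(\<integral>\<^sup>+x. \<integral>\<^sup>+u. q (u, x - {u}) \<partial>count_space x \<partial>gibbs W)
    = (\<integral>\<^sup>+x. ?d x * (\<integral>\<^sup>+u. q (u, x - {u}) \<partial>count_space x) \<partial>poisson W)"
    by (rule nn_integral_gibbs) measurable
  also have "\<dots> = (\<integral>\<^sup>+x. \<integral>\<^sup>+u. q' (u, x - {u}) \<partial>count_space x \<partial>poisson W)"
    by (subst nn_integral_cmult[symmetric])
       (auto intro!: nn_integral_cong simp: q'_def insert_absorb)
  also have "\<dots> = (\<integral>\<^sup>+u. \<integral>\<^sup>+x. q' (u, x) \<partial>poisson W \<partial>restr W)"
    by (rule Mecke[OF W W_win q'])
  also have "\<dots> = (\<integral>\<^sup>+u. \<integral>\<^sup>+x. q' (u, x) * indicator {x. x \<subseteq> W} x \<partial>poisson W \<partial>restr W)"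
    using AE_poisson_subset[OF W W_win] 
    by (intro nn_integral_cong nn_integral_cong_AE) (auto elim!: eventually_mono)
  also have "\<dots> = (\<integral>\<^sup>+u. \<integral>\<^sup>+x. ?d x * (hit_weight x u * q (u, x)) * indicator {x. x \<subseteq> W} x \<partial>poisson W \<partial>restr W)"
  proof (rule swap_restr_not_in[OF W W_win P.sigma_finite_measure_axioms])
    fix u x assume "x \<in> space lf_config_space" "u \<notin> x"
    then have "boltzmann (insert u x) = hit_weight x u * boltzmann x" if "x \<subseteq> W"
      using that lf_config_finite[of x x k] W_win by (intro boltzmann_insert) auto
    then show "q' (u, x) * indicator {x. x \<subseteq> W} x = ?d x * (hit_weight x u * q (u, x)) * indicator {x. x \<subseteq> W} x"
      by (auto simp: q'_def divide_ennreal_def mult_ac split: split_indicator)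
  qed (simp, measurable)
  also have "\<dots> = (\<integral>\<^sup>+u. \<integral>\<^sup>+x. ?d x * (hit_weight x u * q (u, x)) \<partial>poisson W \<partial>restr W)"
    using AE_poisson_subset[OF W W_win] 
    by (intro nn_integral_cong nn_integral_cong_AE) (auto elim!: eventually_mono)
  also have "\<dots> = (\<integral>\<^sup>+u. \<integral>\<^sup>+x. hit_weight x u * q (u, x) \<partial>gibbs W \<partial>restr W)"
  proof (rule nn_integral_cong)
    fix u assume "u \<in> space (restr W)"
    then have [measurable]: "u \<in> space seg_space" by simp
    show "(\<integral>\<^sup>+x. ?d x * (hit_weight x u * q (u, x)) \<partial>poisson W) = (\<integral>\<^sup>+x. hit_weight x u * q (u, x) \<partial>gibbs W)"
      by (rule nn_integral_gibbs[symmetric]) measurable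
  qed
  finally show ?thesis .
qed

end

end

section \<open>Averages over shifts\<close>

lemma shift_shift: "shift s (shift t x) = shift (s + t) x"
  by (simp add: shift_eq image_image)

lemma shift_0 [simp]: "shift 0 x = x"
  by (simp add: shift_eq)

context segment_gibbs begin

definition unif :: "nat \<Rightarrow> (real ^ 2) measure" where
  "unif n = uniform_measure lborel (ball 0 (real (Suc n)))"

lemma sets_unif [measurable_cong, simp]: "sets (unif n) = sets borel"
  by (simp add: unif_def)

lemma ball_vol: 
  assumes "R \<ge> 0" shows "emeasure lborel (ball 0 R :: (real^2) set) = ennreal (unit_ball_vol 2 * R ^ 2)"
  using emeasure_ball[of R "0 :: real^2"] assms by simp

lemma prob_unif: "prob_space (unif n)"
  unfolding unif_def using unit_ball_vol_pos[of 2]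
  by (intro prob_space_uniform_measure) (simp_all add: ball_vol ennreal_eq_0_iff not_le mult_pos_pos)

text \<open>The window is twice as large as the ball from which the shift is drawn. A shifted copy
then still covers a ball of the smaller radius, on which the conditional intensity is therefore
exact.\<close>
definition big :: "nat \<Rightarrow> seg set" where "big n = win (2 * Suc n)"

lemma big: "big n \<in> sets seg_space" "big n \<subseteq> win (2 * Suc n)"
  by (auto simp: big_def)

definition avg :: "nat \<Rightarrow> seg set measure" where
  "avg n = distr (unif n \<Otimes>\<^sub>M gibbs (big n)) lf_config_space (\<lambda>p. shift (fst p) (snd p))"

lemma sets_avg [measurable_cong, simp]: "sets (avg n) = sets lf_config_space"
  by (simp add: avg_def)

lemma space_avg [simp]: "space (avg n) = space lf_config_space"
  by (rule sets_eq_imp_space_eq) simp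

lemma prob_avg: "prob_space (avg n)"
proof -
  interpret U: prob_space "unif n" by (rule prob_unif)
  interpret G: prob_space "gibbs (big n)" by (rule prob_gibbs[OF big])
  interpret P: pair_prob_space "unif n" "gibbs (big n)" ..
  show ?thesis unfolding avg_def by (rule P.prob_space_distr) measurable
qed

lemma nn_integral_avg:
  assumes [measurable]: "f \<in> borel_measurable lf_config_space"
  shows "(\<integral>\<^sup>+x. f x \<partial>avg n) = (\<integral>\<^sup>+t. \<integral>\<^sup>+x. f (shift t x) \<partial>gibbs (big n) \<partial>unif n)"
proof -
  interpret G: prob_space "gibbs (big n)" by (rule prob_gibbs[OF big])
  have "(\<integral>\<^sup>+x. f x \<partial>avg n) = (\<integral>\<^sup>+p. f (shift (fst p) (snd p)) \<partial>(unif n \<Otimes>\<^sub>M gibbs (big n)))"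
    unfolding avg_def by (rule nn_integral_distr) measurable
  also have "\<dots> = (\<integral>\<^sup>+t. \<integral>\<^sup>+x. f (shift t x) \<partial>gibbs (big n) \<partial>unif n)"
    by (subst G.nn_integral_fst[symmetric]) auto
  finally show ?thesis .
qed

text \<open>Both the reference measure and the number of hits are invariant under shifts, so the
formula holds for each shifted copy; segments near the origin come from locations inside the large
window, where the Gibbs process satisfies the formula.\<close>
theorem GNZ_avg:
  assumes q[measurable]: "q \<in> borel_measurable (seg_space \<Otimes>\<^sub>M lf_config_space)"
  shows "(\<integral>\<^sup>+x. \<integral>\<^sup>+u. q (u, x - {u}) * indicator (win (Suc n)) u \<partial>count_space x \<partial>avg n) =
    (\<integral>\<^sup>+u. (\<integral>\<^sup>+x. hit_weight x u * q (u, x) \<partial>avg n) * indicator (win (Suc n)) u \<partial>\<rho>)"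
proof -
  interpret U: prob_space "unif n" by (rule prob_unif)
  interpret G: prob_space "gibbs (big n)" by (rule prob_gibbs[OF big])
  interpret P: pair_sigma_finite "unif n" \<rho> ..
  let ?V = "win (Suc n)"
  define p where "p z = q z * indicator ?V (fst z)" for z
  have p[measurable]: "p \<in> borel_measurable (seg_space \<Otimes>\<^sub>M lf_config_space)" unfolding p_def by measurable
  \<comment> \<open>the formula for a single shift; a segment in the small window has its preimage in the large one\<close>
  have one: "(\<integral>\<^sup>+x. (\<integral>\<^sup>+u. p (u, shift t x - {u}) \<partial>count_space (shift t x)) \<partial>gibbs (big n)) =
    (\<integral>\<^sup>+u. \<integral>\<^sup>+x. hit_weight (shift t x) u * p (u, shift t x) \<partial>gibbs (big n) \<partial>\<rho>)" if t: "norm t < real (Suc n)" for t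
  proof -
    define pt where "pt z = p (sh t (fst z), shift t (snd z))" for z
    have pt[measurable]: "pt \<in> borel_measurable (seg_space \<Otimes>\<^sub>M lf_config_space)" unfolding pt_def by measurable
    have "(\<integral>\<^sup>+x. (\<integral>\<^sup>+u. p (u, shift t x - {u}) \<partial>count_space (shift t x)) \<partial>gibbs (big n)) =
      (\<integral>\<^sup>+x. \<integral>\<^sup>+u. pt (u, x - {u}) \<partial>count_space x \<partial>gibbs (big n))"
      by (simp add: sum_shift_eq pt_def shift_remove)
    also have "\<dots> = (\<integral>\<^sup>+u. \<integral>\<^sup>+x. hit_weight x u * pt (u, x) \<partial>gibbs (big n) \<partial>restr (big n))"
      by (rule GNZ_gibbs[OF big pt])
    also have "\<dots> = (\<integral>\<^sup>+u. (\<integral>\<^sup>+x. hit_weight x u * pt (u, x) \<partial>gibbs (big n)) * indicator (big n) u \<partial>\<rho>)"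
      by (rule nn_integral_restr[OF big(1)]) measurable
    also have "\<dots> = (\<integral>\<^sup>+u. \<integral>\<^sup>+x. hit_weight x u * pt (u, x) \<partial>gibbs (big n) \<partial>\<rho>)"
    proof (rule nn_integral_cong)
      fix u assume "u \<in> space \<rho>"
      have "sh t u \<notin> ?V" if "u \<notin> big n"
        using win_sh[of t "Suc n" u "Suc n"] t that by (auto simp: big_def mult_2)
      then have "pt (u, x) = 0" if "u \<notin> big n" for x using that by (simp add: pt_def p_def)
      then show "(\<integral>\<^sup>+x. hit_weight x u * pt (u, x) \<partial>gibbs (big n)) * indicator (big n) u =
         (\<integral>\<^sup>+x. hit_weight x u * pt (u, x) \<partial>gibbs (big n))" by (auto split: split_indicator)
    qed
    also have "\<dots> = (\<integral>\<^sup>+u. (\<lambda>u. \<integral>\<^sup>+x. hit_weight (shift t x) u * p (u, shift t x) \<partial>gibbs (big n)) (sh t u) \<partial>\<rho>)"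
      by (simp add: pt_def)
    also have "\<dots> = (\<integral>\<^sup>+u. \<integral>\<^sup>+x. hit_weight (shift t x) u * p (u, shift t x) \<partial>gibbs (big n) \<partial>\<rho>)"
      by (rule nn_integral_\<rho>_sh) measurable
    finally show ?thesis .
  qed
  have "(\<integral>\<^sup>+x. \<integral>\<^sup>+u. q (u, x - {u}) * indicator ?V u \<partial>count_space x \<partial>avg n)
    = (\<integral>\<^sup>+x. \<integral>\<^sup>+u. p (u, x - {u}) \<partial>count_space x \<partial>avg n)" by (simp add: p_def)
  also have "\<dots> = (\<integral>\<^sup>+t. \<integral>\<^sup>+x. (\<integral>\<^sup>+u. p (u, shift t x - {u}) \<partial>count_space (shift t x)) \<partial>gibbs (big n) \<partial>unif n)"
    by (rule nn_integral_avg) measurable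
  also have "\<dots> = (\<integral>\<^sup>+t. \<integral>\<^sup>+u. \<integral>\<^sup>+x. hit_weight (shift t x) u * p (u, shift t x) \<partial>gibbs (big n) \<partial>\<rho> \<partial>unif n)"
  proof (rule nn_integral_cong_AE)
    have "AE t in unif n. norm t < real (Suc n)"
      unfolding unif_def by (rule AE_uniform_measureI) auto
    then show "AE t in unif n. (\<integral>\<^sup>+x. (\<integral>\<^sup>+u. p (u, shift t x - {u}) \<partial>count_space (shift t x)) \<partial>gibbs (big n)) =
      (\<integral>\<^sup>+u. \<integral>\<^sup>+x. hit_weight (shift t x) u * p (u, shift t x) \<partial>gibbs (big n) \<partial>\<rho>)"
      by (rule eventually_mono) (rule one)
  qed
  also have "\<dots> = (\<integral>\<^sup>+u. \<integral>\<^sup>+t. \<integral>\<^sup>+x. hit_weight (shift t x) u * p (u, shift t x) \<partial>gibbs (big n) \<partial>unif n \<partial>\<rho>)"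
    by (rule P.Fubini'[symmetric]) measurable
  also have "\<dots> = (\<integral>\<^sup>+u. (\<integral>\<^sup>+x. hit_weight x u * q (u, x) \<partial>avg n) * indicator ?V u \<partial>\<rho>)"
  proof (rule nn_integral_cong)
    fix u assume "u \<in> space \<rho>"
    then have [measurable]: "u \<in> space seg_space" by (simp add: space_\<rho>)
    have "(\<integral>\<^sup>+t. \<integral>\<^sup>+x. hit_weight (shift t x) u * p (u, shift t x) \<partial>gibbs (big n) \<partial>unif n) = (\<integral>\<^sup>+x. hit_weight x u * p (u, x) \<partial>avg n)"
      by (rule nn_integral_avg[symmetric]) measurable
    also have "\<dots> = (\<integral>\<^sup>+x. hit_weight x u * q (u, x) * indicator ?V u \<partial>avg n)"
      by (simp add: p_def mult.assoc)
    also have "\<dots> = (\<integral>\<^sup>+x. hit_weight x u * q (u, x) \<partial>avg n) * indicator ?V u"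
      by (rule nn_integral_multc) measurable
    finally show "(\<integral>\<^sup>+t. \<integral>\<^sup>+x. hit_weight (shift t x) u * p (u, shift t x) \<partial>gibbs (big n) \<partial>unif n) =
      (\<integral>\<^sup>+x. hit_weight x u * q (u, x) \<partial>avg n) * indicator ?V u" .
  qed
  finally show ?thesis .
qed

text \<open>Shifting the averaged process translates the ball from which the shift is drawn, and
the error is at most the relative volume of the part of the translated ball outside the original
one.\<close>
lemma avg_shift_le:
  assumes A[measurable]: "A \<in> sets lf_config_space"
  shows "emeasure (avg n) {x \<in> space lf_config_space. shift s x \<in> A} \<le> 
    emeasure (avg n) A + ennreal (((real (Suc n) + norm s)\<^sup>2 - (real (Suc n))\<^sup>2) / (real (Suc n))\<^sup>2)"
proof -
  interpret G: prob_space "gibbs (big n)" by (rule prob_gibbs[OF big])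
  let ?R = "real (Suc n)" and ?c = "unit_ball_vol 2"
  let ?B = "ball 0 ?R :: (real^2) set" and ?B' = "ball 0 (?R + norm s) :: (real^2) set"
  have c: "?c > 0" by simp
  define \<phi> where "\<phi> t = (\<integral>\<^sup>+x. indicator A (shift t x) \<partial>gibbs (big n))" for t
  have [measurable]: "\<phi> \<in> borel_measurable borel" unfolding \<phi>_def by measurable
  have \<phi>1: "\<phi> t \<le> 1" for t
  proof -
    have "\<phi> t \<le> (\<integral>\<^sup>+x. 1 \<partial>gibbs (big n))" unfolding \<phi>_def by (intro nn_integral_mono) (auto split: split_indicator)
    then show ?thesis by (simp add: G.emeasure_space_1 del: space_gibbs)
  qed
  have [measurable]: "(\<lambda>t. indicator ?B (t - s) :: ennreal) \<in> borel_measurable borel"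
    by (rule measurable_compose[OF _ borel_measurable_indicator, where N=borel]) auto
  have U: "(\<integral>\<^sup>+t. f t \<partial>unif n) = (\<integral>\<^sup>+t. f t * indicator ?B t \<partial>lborel) / emeasure lborel ?B"
    if "f \<in> borel_measurable borel" for f
    unfolding unif_def using that by (subst nn_integral_uniform_measure) auto
  have "emeasure (avg n) {x \<in> space lf_config_space. shift s x \<in> A} =
    (\<integral>\<^sup>+x. indicator {x \<in> space lf_config_space. shift s x \<in> A} x \<partial>avg n)"
    by (rule nn_integral_indicator[symmetric]) measurable
  also have "\<dots> = (\<integral>\<^sup>+x. indicator A (shift s x) \<partial>avg n)"
    by (intro nn_integral_cong) (auto split: split_indicator)
  also have "\<dots> = (\<integral>\<^sup>+t. \<phi> (s + t) \<partial>unif n)"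
    unfolding \<phi>_def by (subst nn_integral_avg) (measurable, simp add: shift_shift)
  also have "\<dots> = (\<integral>\<^sup>+t. \<phi> (s + t) * indicator ?B t \<partial>lborel) / emeasure lborel ?B"
    by (rule U) measurable
  also have "(\<integral>\<^sup>+t. \<phi> (s + t) * indicator ?B t \<partial>lborel) = (\<integral>\<^sup>+t. (\<lambda>t. \<phi> t * indicator ?B (t - s)) (s + t) \<partial>lborel)"
    by simp
  also have "\<dots> = (\<integral>\<^sup>+t. \<phi> t * indicator ?B (t - s) \<partial>distr lborel borel ((+) s))"
    by (rule nn_integral_distr[symmetric]) measurable
  also have "\<dots> = (\<integral>\<^sup>+t. \<phi> t * indicator ?B (t - s) \<partial>lborel)" by (simp add: lborel_distr_plus)
  also have "\<dots> \<le> (\<integral>\<^sup>+t. \<phi> t * indicator ?B t + indicator (?B' - ?B) t \<partial>lborel)"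
  proof (rule nn_integral_mono)
    fix t
    have "norm t \<le> norm (t - s) + norm s" using norm_triangle_ineq[of "t - s" s] by simp
    then show "\<phi> t * indicator ?B (t - s) \<le> \<phi> t * indicator ?B t + indicator (?B' - ?B) t"
      using \<phi>1[of t] by (auto split: split_indicator)
  qed
  also have "\<dots> = (\<integral>\<^sup>+t. \<phi> t * indicator ?B t \<partial>lborel) + (\<integral>\<^sup>+t. indicator (?B' - ?B) t \<partial>lborel)"
  proof (rule nn_integral_add)
    show "(\<lambda>t. \<phi> t * indicator ?B t) \<in> borel_measurable lborel"
      by (intro borel_measurable_times_ennreal borel_measurable_indicator) auto
    show "indicator (?B' - ?B) \<in> borel_measurable lborel"
      by (intro borel_measurable_indicator sets.Diff) auto
  qed
  also have "(\<integral>\<^sup>+t. indicator (?B' - ?B) t \<partial>lborel) = emeasure lborel (?B' - ?B)"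
    by (intro nn_integral_indicator sets.Diff) auto
  finally have "emeasure (avg n) {x \<in> space lf_config_space. shift s x \<in> A} \<le>
    ((\<integral>\<^sup>+t. \<phi> t * indicator ?B t \<partial>lborel) + emeasure lborel (?B' - ?B)) / emeasure lborel ?B"
    by (simp add: divide_right_mono_ennreal)
  also have "\<dots> = (\<integral>\<^sup>+t. \<phi> t * indicator ?B t \<partial>lborel) / emeasure lborel ?B
     + emeasure lborel (?B' - ?B) / emeasure lborel ?B"
    by (rule add_divide_distrib_ennreal)
  also have "(\<integral>\<^sup>+t. \<phi> t * indicator ?B t \<partial>lborel) / emeasure lborel ?B = (\<integral>\<^sup>+t. \<phi> t \<partial>unif n)"
    by (rule U[symmetric]) measurable
  also have "\<dots> = (\<integral>\<^sup>+x. indicator A x \<partial>avg n)"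
    unfolding \<phi>_def by (rule nn_integral_avg[symmetric]) measurable
  also have "\<dots> = emeasure (avg n) A" by simp
  also have "emeasure lborel (?B' - ?B) / emeasure lborel ?B = ennreal (((?R + norm s)\<^sup>2 - ?R\<^sup>2) / ?R\<^sup>2)"
  proof -
    have sq: "?R\<^sup>2 \<le> (?R + norm s)\<^sup>2" by (intro power_mono) auto
    have "emeasure lborel (?B' - ?B) = emeasure lborel ?B' - emeasure lborel ?B"
    proof (rule emeasure_Diff)
      show "?B \<subseteq> ?B'" by (rule subset_ball) simp
    qed (simp_all add: ball_vol)
    also have "\<dots> = ennreal (?c * (?R + norm s)\<^sup>2 - ?c * ?R\<^sup>2)"
      using c by (simp add: ball_vol ennreal_minus)
    also have "\<dots> / emeasure lborel ?B = ennreal ((?c * (?R + norm s)\<^sup>2 - ?c * ?R\<^sup>2) / (?c * ?R\<^sup>2))"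
      using c sq by (subst ball_vol) (auto intro!: divide_ennreal mult_left_mono)
    also have "(?c * (?R + norm s)\<^sup>2 - ?c * ?R\<^sup>2) / (?c * ?R\<^sup>2) = ((?R + norm s)\<^sup>2 - ?R\<^sup>2) / ?R\<^sup>2"
      using less_imp_neq[OF c] unfolding right_diff_distrib[symmetric] by (intro mult_divide_mult_cancel_left) auto
    finally show ?thesis .
  qed
  finally show ?thesis .
qed

text \<open>Since the interaction is repulsive, the conditional intensity is at most that of the
Poisson process, and the central estimate applies to every window that lies in the region of
exactness.\<close>
lemma avg_dominated:
  assumes W[measurable]: "W \<in> sets seg_space" and Wn: "W \<subseteq> win (Suc n)"
    and F[measurable]: "F \<in> borel_measurable (lf_config_space \<Otimes>\<^sub>M lf_config_space)"
  shows "(\<integral>\<^sup>+x. F (x - W, x \<inter> W) \<partial>avg n) \<le> (\<integral>\<^sup>+x. \<integral>\<^sup>+y. F (x - W, y) \<partial>poisson W \<partial>avg n)"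
proof (rule dominated_by_poisson[OF W Wn _ _ _ F])
  interpret A: prob_space "avg n" by (rule prob_avg)
  show "finite_measure (avg n)" by (rule A.finite_measure)
  fix q :: "seg \<times> seg set \<Rightarrow> ennreal"
  assume q[measurable]: "q \<in> borel_measurable (seg_space \<Otimes>\<^sub>M lf_config_space)"
  define p where "p z = q z * indicator W (fst z)" for z
  have p[measurable]: "p \<in> borel_measurable (seg_space \<Otimes>\<^sub>M lf_config_space)" unfolding p_def by measurable
  have "(\<integral>\<^sup>+x. \<integral>\<^sup>+u. q (u, x - {u}) * indicator W u \<partial>count_space x \<partial>avg n) =
    (\<integral>\<^sup>+x. \<integral>\<^sup>+u. p (u, x - {u}) * indicator (win (Suc n)) u \<partial>count_space x \<partial>avg n)"
    using Wn by (intro nn_integral_cong) (auto simp: p_def split: split_indicator)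
  also have "\<dots> = (\<integral>\<^sup>+u. (\<integral>\<^sup>+x. hit_weight x u * p (u, x) \<partial>avg n) * indicator (win (Suc n)) u \<partial>\<rho>)"
    by (rule GNZ_avg[OF p])
  also have "\<dots> \<le> (\<integral>\<^sup>+u. (\<integral>\<^sup>+x. q (u, x) \<partial>avg n) * indicator W u \<partial>\<rho>)"
  proof (rule nn_integral_mono)
    fix u
    have "(\<integral>\<^sup>+x. hit_weight x u * p (u, x) \<partial>avg n) \<le> (\<integral>\<^sup>+x. q (u, x) \<partial>avg n)" if "u \<in> W"
      using mult_right_mono[OF hit_weight_le_1] that by (intro nn_integral_mono) (simp add: p_def)
    moreover have "(\<integral>\<^sup>+x. hit_weight x u * p (u, x) \<partial>avg n) = 0" if "u \<notin> W" using that by (simp add: p_def)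
    ultimately show "(\<integral>\<^sup>+x. hit_weight x u * p (u, x) \<partial>avg n) * indicator (win (Suc n)) u \<le>
       (\<integral>\<^sup>+x. q (u, x) \<partial>avg n) * indicator W u"
      using Wn by (auto split: split_indicator)
  qed
  also have "\<dots> = (\<integral>\<^sup>+u. \<integral>\<^sup>+x. q (u, x) \<partial>avg n \<partial>restr W)"
    by (rule nn_integral_restr[OF W, symmetric]) measurable
  finally show "(\<integral>\<^sup>+x. \<integral>\<^sup>+u. q (u, x - {u}) * indicator W u \<partial>count_space x \<partial>avg n) \<le>
    (\<integral>\<^sup>+u. \<integral>\<^sup>+x. q (u, x) \<partial>avg n \<partial>restr W)" .
qed simp

end

section \<open>Limits along a filter\<close>

text \<open>By Tychonoff's theorem the sequence, a point of a power of the unit interval for each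
index, has a cluster point; the filter consists of the indices at which the sequence is close to
it.\<close>
lemma filter_with_limits:
  fixes s :: "nat \<Rightarrow> 'b \<Rightarrow> real"
  assumes s: "\<And>n b. 0 \<le> s n b" "\<And>n b. s n b \<le> 1"
  shows "\<exists>G. G \<noteq> bot \<and> G \<le> sequentially \<and> (\<forall>b. \<exists>l. ((\<lambda>n. s n b) \<longlongrightarrow> l) G)"
proof -
  let ?C = "Pi\<^sub>E UNIV (\<lambda>_. {0..1}) :: ('b \<Rightarrow> real) set"
  have "compactin (product_topology (\<lambda>_. euclidean) UNIV) ?C"
    by (subst compactin_PiE) auto
  then have "compact ?C" by (simp add: euclidean_product_topology)
  moreover have "filtermap s sequentially \<noteq> bot" by (simp add: filtermap_bot_iff)
  moreover have "eventually (\<lambda>x. x \<in> ?C) (filtermap s sequentially)"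
    using s by (simp add: eventually_filtermap PiE_iff)
  ultimately obtain x where x: "inf (nhds x) (filtermap s sequentially) \<noteq> bot"
    unfolding compact_filter by blast
  define G where "G = inf (filtercomap s (nhds x)) sequentially"
  have "G \<noteq> bot"
  proof
    assume "G = bot"
    then have "eventually (\<lambda>_. False) (inf (filtercomap s (nhds x)) sequentially)" by (simp add: G_def)
    then obtain P Q where P: "eventually P (filtercomap s (nhds x))" and Q: "eventually Q sequentially"
      and PQ: "\<And>n. P n \<Longrightarrow> Q n \<Longrightarrow> False"
      unfolding eventually_inf by blast
    obtain P' where P': "eventually P' (nhds x)" "\<And>n. P' (s n) \<Longrightarrow> P n"
      using P unfolding eventually_filtercomap by blast
    have "eventually (\<lambda>y. \<not> P' y) (filtermap s sequentially)"
      unfolding eventually_filtermap using Q by (rule eventually_mono) (use P'(2) PQ in blast)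
    with P'(1) have "eventually (\<lambda>_. False) (inf (nhds x) (filtermap s sequentially))"
      unfolding eventually_inf by blast
    with x show False by (simp add: trivial_limit_def)
  qed
  moreover have "G \<le> sequentially" by (simp add: G_def)
  moreover have "((\<lambda>n. s n b) \<longlongrightarrow> x b) G" for b
  proof -
    have "filterlim s (nhds x) G"
      unfolding G_def by (rule filterlim_mono[OF filterlim_filtercomap order_refl]) simp
    have cont: "continuous_on UNIV (\<lambda>f :: 'b \<Rightarrow> real. f b)" by simp
    from continuous_on_tendsto_compose[OF cont \<open>filterlim s (nhds x) G\<close>] show ?thesis by simp
  qed
  ultimately show ?thesis by blast
qed

text \<open>A bounded function is a uniform limit of step functions, for which the integral is a
finite combination of probabilities. Uniformity permits the exchange of limits along an arbitrary
filter, where dominated convergence is not at hand.\<close>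
lemma tendsto_nn_integral_bounded:
  fixes N :: "'i \<Rightarrow> 'a measure"
  assumes sets_N: "\<And>n. sets (N n) = sets M" and sets_N': "sets N' = sets M"
    and prob: "\<And>n. prob_space (N n)" and prob': "prob_space N'"
    and lim: "\<And>A. A \<in> sets M \<Longrightarrow> ((\<lambda>n. emeasure (N n) A) \<longlongrightarrow> emeasure N' A) F"
    and f[measurable]: "f \<in> borel_measurable M" and bound: "\<And>x. f x \<le> ennreal K"
  shows "((\<lambda>n. \<integral>\<^sup>+x. f x \<partial>N n) \<longlongrightarrow> (\<integral>\<^sup>+x. f x \<partial>N')) F"
proof -
  define B where "B = max K 1"
  have B: "B > 0" "\<And>x. f x \<le> ennreal B"
  proof -
    show "B > 0" by (simp add: B_def)
    fix x show "f x \<le> ennreal B" using bound[of x] by (rule order_trans) (simp add: B_def ennreal_leI)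
  qed
  \<comment> \<open>the width of the steps\<close>
  define \<delta> where "\<delta> j = B / real (Suc j)" for j
  have \<delta>: "\<delta> j > 0" for j using B(1) by (simp add: \<delta>_def)
  define E where "E j l = {x \<in> space M. ennreal (real l * \<delta> j) \<le> f x}" for j l
  have E[measurable]: "E j l \<in> sets M" for j l unfolding E_def by measurable
  define s where "s j x = (\<Sum>l\<in>{1..Suc j}. ennreal (\<delta> j) * indicator (E j l) x)" for j x
  have s[measurable]: "s j \<in> borel_measurable M" for j unfolding s_def by measurable
  have s_f: "s j x \<le> f x \<and> f x \<le> s j x + ennreal (\<delta> j)" if x: "x \<in> space M" for j x
  proof -
    obtain y where y: "f x = ennreal y" "0 \<le> y" "y \<le> B"
      using B(2)[of x] by (cases "f x") (use B(1) in \<open>auto simp: top_unique\<close>)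
    \<comment> \<open>the number of steps below the value\<close>
    define p where "p = nat \<lfloor>y / \<delta> j\<rfloor>"
    have y\<delta>: "0 \<le> y / \<delta> j" "y / \<delta> j \<le> real (Suc j)"
    proof -
      show "0 \<le> y / \<delta> j" using y \<delta>[of j] by simp
      have "y \<le> real (Suc j) * \<delta> j" using y(3) by (simp add: \<delta>_def)
      then show "y / \<delta> j \<le> real (Suc j)" using \<delta>[of j] by (simp only: pos_divide_le_eq)
    qed
    have p1: "real p \<le> y / \<delta> j" "y / \<delta> j < real p + 1" using y\<delta>(1) unfolding p_def by linarith+
    have pj: "p \<le> Suc j" using p1(1) y\<delta>(2) by linarith
    have eqv: "real l * \<delta> j \<le> y \<longleftrightarrow> l \<le> p" for l
    proof -
      have "real l * \<delta> j \<le> y \<longleftrightarrow> real l \<le> y / \<delta> j" using \<delta>[of j] by (simp add: pos_le_divide_eq)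
      also have "\<dots> \<longleftrightarrow> l \<le> p" using p1 by linarith
      finally show ?thesis .
    qed
    have "s j x = (\<Sum>l\<in>{1..Suc j}. ennreal (\<delta> j) * indicator {..p} l)"
      unfolding s_def using x y eqv
      by (intro sum.cong) (auto simp: E_def indicator_def)
    also have "\<dots> = (\<Sum>l\<in>{1..p}. ennreal (\<delta> j))"
      using pj by (intro sum.mono_neutral_cong_right) (auto split: split_indicator)
    also have "\<dots> = ennreal (real p * \<delta> j)"
      using \<delta>[of j] by (simp add: ennreal_mult ennreal_of_nat_eq_real_of_nat)
    finally have sp: "s j x = ennreal (real p * \<delta> j)" .
    have "real p * \<delta> j \<le> y" using eqv by simp
    moreover have "y \<le> real p * \<delta> j + \<delta> j"
      using p1(2) \<delta>[of j] by (simp add: field_simps)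
    moreover have "ennreal (real p * \<delta> j) + ennreal (\<delta> j) = ennreal (real p * \<delta> j + \<delta> j)"
      using \<delta>[of j] by (intro ennreal_plus[symmetric]) auto
    ultimately show ?thesis
      by (simp only: sp y(1) ennreal_leI simp_thms)
  qed
  let ?a = "\<lambda>j P. enn2real (\<integral>\<^sup>+x. s j x \<partial>P)" and ?h = "\<lambda>P. enn2real (\<integral>\<^sup>+x. f x \<partial>P)"
  have close: "dist (?a j P) (?h P) \<le> \<delta> j" and fin: "(\<integral>\<^sup>+x. f x \<partial>P) < \<top>" and fin_s: "(\<integral>\<^sup>+x. s j x \<partial>P) < \<top>"
    if P: "prob_space P" "sets P = sets M" for P j
  proof -
    interpret P: prob_space P by fact
    note P(2)[measurable_cong]
    have sp: "space P = space M" using P(2) by (rule sets_eq_imp_space_eq)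
    have "(\<integral>\<^sup>+x. f x \<partial>P) \<le> (\<integral>\<^sup>+x. ennreal B \<partial>P)" by (intro nn_integral_mono B(2))
    also have "\<dots> < \<top>" by (simp add: P.emeasure_space_1)
    finally show f_fin: "(\<integral>\<^sup>+x. f x \<partial>P) < \<top>" .
    have 1: "(\<integral>\<^sup>+x. s j x \<partial>P) \<le> (\<integral>\<^sup>+x. f x \<partial>P)" using s_f by (intro nn_integral_mono) (simp add: sp)
    then show s_fin: "(\<integral>\<^sup>+x. s j x \<partial>P) < \<top>" using f_fin by (rule le_less_trans)
    have "(\<integral>\<^sup>+x. f x \<partial>P) \<le> (\<integral>\<^sup>+x. s j x + ennreal (\<delta> j) \<partial>P)" using s_f by (intro nn_integral_mono) (simp add: sp)
    also have "\<dots> = (\<integral>\<^sup>+x. s j x \<partial>P) + ennreal (\<delta> j)"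
      by (subst nn_integral_add) (simp_all add: P.emeasure_space_1)
    finally have 2: "(\<integral>\<^sup>+x. f x \<partial>P) \<le> (\<integral>\<^sup>+x. s j x \<partial>P) + ennreal (\<delta> j)" .
    have "?a j P \<le> ?h P" using 1 f_fin by (intro enn2real_mono) auto
    moreover have "?h P \<le> enn2real ((\<integral>\<^sup>+x. s j x \<partial>P) + ennreal (\<delta> j))"
      using 2 s_fin by (intro enn2real_mono) auto
    then have "?h P \<le> ?a j P + \<delta> j"
      using s_fin \<delta>[of j] by (simp add: enn2real_plus)
    ultimately show "dist (?a j P) (?h P) \<le> \<delta> j" by (simp add: dist_real_def)
  qed
  have \<delta>_lim: "\<delta> \<longlonglongrightarrow> 0"
    unfolding \<delta>_def using LIMSEQ_Suc[OF lim_const_over_n[of B]] by simp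
  have a_lim: "((\<lambda>n. ?a j (N n)) \<longlongrightarrow> ?a j N') F" for j
  proof -
    have eq: "(\<integral>\<^sup>+x. s j x \<partial>P) = (\<Sum>l\<in>{1..Suc j}. ennreal (\<delta> j) * emeasure P (E j l))" if "sets P = sets M" for P
    proof -
      note that[measurable_cong]
      have [measurable]: "E j l \<in> sets P" for l using that by simp
      show ?thesis unfolding s_def
        by (subst nn_integral_sum) (auto simp: nn_integral_cmult_indicator)
    qed
    have "((\<lambda>n. \<integral>\<^sup>+x. s j x \<partial>N n) \<longlongrightarrow> (\<integral>\<^sup>+x. s j x \<partial>N')) F"
      unfolding eq[OF sets_N] eq[OF sets_N']
      by (intro tendsto_sum ennreal_tendsto_cmult lim) auto
    then show ?thesis
      using fin_s[OF prob' sets_N'] by (intro tendsto_enn2real) auto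
  qed
  have "((\<lambda>n. ?h (N n)) \<longlongrightarrow> ?h N') F"
  proof (rule swap_uniform_limit'[where f = "\<lambda>j n. ?a j (N n)" and F = sequentially and S = UNIV])
    show "\<forall>\<^sub>F j in sequentially. ((\<lambda>n. ?a j (N n)) \<longlongrightarrow> ?a j N') F" using a_lim by simp
    show "(\<lambda>j. ?a j N') \<longlonglongrightarrow> ?h N'"
    proof (rule metric_tendsto_imp_tendsto[OF \<delta>_lim])
      show "\<forall>\<^sub>F j in sequentially. dist (?a j N') (?h N') \<le> dist (\<delta> j) 0"
        using close[OF prob' sets_N'] \<delta> by (simp add: less_imp_le)
    qed
    show "uniform_limit UNIV (\<lambda>j n. ?a j (N n)) (\<lambda>n. ?h (N n)) sequentially"
    proof (rule uniform_limitI)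
      fix e :: real assume "e > 0"
      then have "\<forall>\<^sub>F j in sequentially. \<delta> j < e" using \<delta>_lim by (rule order_tendstoD(2)[rotated])
      then show "\<forall>\<^sub>F j in sequentially. \<forall>n\<in>UNIV. dist (?a j (N n)) (?h (N n)) < e"
        by (rule eventually_mono) (use close[OF prob sets_N] le_less_trans in blast)
    qed
  qed auto
  then have "((\<lambda>n. ennreal (?h (N n))) \<longlongrightarrow> ennreal (?h N')) F" by (rule tendsto_ennrealI)
  then show ?thesis using fin[OF prob sets_N] fin[OF prob' sets_N'] by simp
qed

context segment_gibbs begin

definition lim_filter :: "nat filter" where
  "lim_filter = (SOME G. G \<noteq> bot \<and> G \<le> sequentially \<and> (\<forall>A. \<exists>l. ((\<lambda>n. measure (avg n) A) \<longlongrightarrow> l) G))"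

lemma lim_filter: "lim_filter \<noteq> bot" "lim_filter \<le> sequentially" "\<exists>l. ((\<lambda>n. measure (avg n) A) \<longlongrightarrow> l) lim_filter"
proof -
  have "\<exists>G. G \<noteq> bot \<and> G \<le> sequentially \<and> (\<forall>A. \<exists>l. ((\<lambda>n. measure (avg n) A) \<longlongrightarrow> l) G)"
    by (rule filter_with_limits) (auto intro: prob_space.prob_le_1 prob_avg)
  from someI_ex[OF this] show "lim_filter \<noteq> bot" "lim_filter \<le> sequentially" "\<exists>l. ((\<lambda>n. measure (avg n) A) \<longlongrightarrow> l) lim_filter"
    unfolding lim_filter_def[symmetric] by blast+
qed

text \<open>The limit of the probabilities is a finitely additive set function on all events. It
becomes countably additive only when restricted to the events of one window.\<close>
definition lim_val :: "seg set set \<Rightarrow> ennreal" where "lim_val A = Lim lim_filter (\<lambda>n. emeasure (avg n) A)"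

lemma tendsto_lim_val: "((\<lambda>n. emeasure (avg n) A) \<longlongrightarrow> lim_val A) lim_filter"
proof -
  obtain l where "((\<lambda>n. measure (avg n) A) \<longlongrightarrow> l) lim_filter" using lim_filter(3) by blast
  then have "((\<lambda>n. ennreal (measure (avg n) A)) \<longlongrightarrow> ennreal l) lim_filter" by (rule tendsto_ennrealI)
  then have "((\<lambda>n. emeasure (avg n) A) \<longlongrightarrow> ennreal l) lim_filter"
    using prob_avg by (simp add: finite_measure.emeasure_eq_measure prob_space.finite_measure)
  moreover from this have "lim_val A = ennreal l" unfolding lim_val_def using lim_filter(1) by (intro tendsto_Lim) auto
  ultimately show ?thesis by simp
qed

lemma eventually_lim_filter: "eventually P sequentially \<Longrightarrow> eventually P lim_filter"
  using lim_filter(2) unfolding le_filter_def by blast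

text \<open>The candidate for the law of the limit process inside a window.\<close>
definition local_law :: "nat \<Rightarrow> seg set measure" where
  "local_law k = measure_of (space lf_config_space) (sets lf_config_space)
     (\<lambda>A. lim_val (window_event k A))"

lemma sets_local_law [measurable_cong, simp]: "sets (local_law k) = sets lf_config_space"
  by (simp add: local_law_def)

lemma space_local_law [simp]: "space (local_law k) = space lf_config_space"
  by (rule sets_eq_imp_space_eq) simp

lemma local_event [measurable]: 
  "A \<in> sets lf_config_space \<Longrightarrow> (window_event k A) \<in> sets lf_config_space"
proof -
  assume A: "A \<in> sets lf_config_space"
  have "(\<lambda>x. x \<inter> win k) \<in> lf_config_space \<rightarrow>\<^sub>M lf_config_space" by measurable
  from measurable_sets[OF this A] have "(\<lambda>x. x \<inter> win k) -` A \<inter> space lf_config_space \<in> sets lf_config_space" .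
  also have "(\<lambda>x. x \<inter> win k) -` A \<inter> space lf_config_space = window_event k A" by auto
  finally show ?thesis .
qed

text \<open>The bound on the averaged processes does not depend on their index once the window is
in the region of exactness, hence it survives in the limit.\<close>
lemma lim_val_le_poisson:
  assumes A[measurable]: "A \<in> sets lf_config_space"
  shows "lim_val (window_event k A) \<le> emeasure (poisson (win k)) A"
proof (rule tendsto_upperbound[OF tendsto_lim_val _ lim_filter(1)])
  have "emeasure (avg n) (window_event k A) \<le> emeasure (poisson (win k)) A" if "k \<le> n" for n
  proof -
    interpret prob_space "avg n" by (rule prob_avg)
    have "emeasure (avg n) (window_event k A) =
      (\<integral>\<^sup>+x. indicator (window_event k A) x \<partial>avg n)"
      by (rule nn_integral_indicator[symmetric]) measurable
    also have "\<dots> = (\<integral>\<^sup>+x. (\<lambda>p. indicator A (snd p)) (x - win k, x \<inter> win k) \<partial>avg n)"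
      by (intro nn_integral_cong) (auto split: split_indicator)
    also have "\<dots> \<le> (\<integral>\<^sup>+x. \<integral>\<^sup>+y. (\<lambda>p. indicator A (snd p)) (x - win k, y) \<partial>poisson (win k) \<partial>avg n)"
      using that by (intro avg_dominated win_mono) auto
    also have "\<dots> = emeasure (poisson (win k)) A" by (simp add: emeasure_space_1 del: space_avg)
    finally show ?thesis .
  qed
  then show "eventually (\<lambda>n. emeasure (avg n) (window_event k A) \<le>
     emeasure (poisson (win k)) A) lim_filter"
    by (intro eventually_lim_filter eventually_sequentiallyI)
qed

lemma lim_val_space: "lim_val (space lf_config_space) = 1"
proof (rule tendsto_unique[OF lim_filter(1) tendsto_lim_val])
  have "emeasure (avg n) (space lf_config_space) = 1" for n
    using prob_space.emeasure_space_1[OF prob_avg] by simp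
  then show "((\<lambda>n. emeasure (avg n) (space lf_config_space)) \<longlongrightarrow> 1) lim_filter" by simp
qed

lemma lim_val_le_1: "lim_val A \<le> 1"
  using prob_space.measure_le_1[OF prob_avg]
  by (intro tendsto_upperbound[OF tendsto_lim_val _ lim_filter(1)]) simp

text \<open>Along a decreasing sequence of events with empty intersection the dominating Poisson
measure tends to zero, and so does the limit; this continuity at the empty set is countable
additivity.\<close>
lemma emeasure_local_law:
  assumes A: "A \<in> sets lf_config_space"
  shows "emeasure (local_law k) A = lim_val (window_event k A)"
proof (rule emeasure_measure_of[OF local_law_def])
  let ?f = "\<lambda>A. lim_val (window_event k A)"
  interpret P: finite_measure "poisson (win k)" by (rule finite_poisson[OF win_sets order_refl])
  show "sets lf_config_space \<subseteq> Pow (space lf_config_space)" by (rule sets.space_closed)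
  have "lim_val {} = 0" using tendsto_unique[OF lim_filter(1) tendsto_lim_val[of "{}"], of 0] by simp
  then show pos: "positive (sets (local_law k)) ?f" by (simp add: positive_def)
  show "countably_additive (sets (local_law k)) ?f" unfolding sets_local_law
  proof (rule sets.empty_continuous_imp_countably_additive)
    show "positive (sets lf_config_space) ?f" using pos by simp
    show "additive (sets lf_config_space) ?f" unfolding additive_def
    proof (intro ballI impI)
      fix A B assume AB[measurable]: "A \<in> sets lf_config_space" "B \<in> sets lf_config_space" and dis: "A \<inter> B = {}"
      have "emeasure (avg n) {x \<in> space lf_config_space. x \<inter> win k \<in> A \<union> B} =
        emeasure (avg n) (window_event k A) +
        emeasure (avg n) (window_event k B)" for n
      proof (subst plus_emeasure)
        show "window_event k A \<inter> window_event k B = {}"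
          using dis by blast
        have "{x \<in> space lf_config_space. x \<inter> win k \<in> A \<union> B} =
          (window_event k A) \<union> (window_event k B)" by blast
        then show "emeasure (avg n) {x \<in> space lf_config_space. x \<inter> win k \<in> A \<union> B} = emeasure (avg n)
          ((window_event k A) \<union> (window_event k B))" by (rule arg_cong)
      qed (simp_all only: sets_avg local_event AB)
      then have "((\<lambda>n. emeasure (avg n) {x \<in> space lf_config_space. x \<inter> win k \<in> A \<union> B}) \<longlongrightarrow> ?f A + ?f B) lim_filter"
        by (simp only: tendsto_add[OF tendsto_lim_val tendsto_lim_val])
      then show "?f (A \<union> B) = ?f A + ?f B" by (rule tendsto_unique[OF lim_filter(1) tendsto_lim_val])
    qed
    show "\<forall>A\<in>sets lf_config_space. ?f A \<noteq> \<infinity>"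
    proof
      fix A
      have "?f A < \<top>" using lim_val_le_1 by (rule le_less_trans) simp
      then show "?f A \<noteq> \<infinity>" by simp
    qed
    fix A :: "nat \<Rightarrow> seg set set" assume A: "range A \<subseteq> sets lf_config_space" "decseq A" "(\<Inter>i. A i) = {}"
    have "(\<lambda>i. emeasure (poisson (win k)) (A i)) \<longlonglongrightarrow> emeasure (poisson (win k)) (\<Inter>i. A i)"
      using A by (intro Lim_emeasure_decseq) auto
    then have "(\<lambda>i. emeasure (poisson (win k)) (A i)) \<longlonglongrightarrow> 0" using A(3) by simp
    then show "(\<lambda>i. ?f (A i)) \<longlonglongrightarrow> 0"
    proof (rule tendsto_sandwich[OF always_eventually always_eventually tendsto_const, rotated 2])
      show "\<forall>i. ?f (A i) \<le> emeasure (poisson (win k)) (A i)" using A(1) lim_val_le_poisson by blast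
    qed simp
  qed
  show "A \<in> sets (local_law k)" using A by simp
qed

lemma prob_local_law: "prob_space (local_law k)"
proof
  have "{x \<in> space lf_config_space. x \<inter> win k \<in> space lf_config_space} = space lf_config_space"
    using lf_config_subset by auto
  then show "emeasure (local_law k) (space (local_law k)) = 1" by (simp add: emeasure_local_law lim_val_space)
qed

lemma tendsto_local_integral:
  assumes f[measurable]: "f \<in> borel_measurable lf_config_space" and bound: "\<And>x. f x \<le> ennreal K"
  shows "((\<lambda>n. \<integral>\<^sup>+x. f (x \<inter> win k) \<partial>avg n) \<longlongrightarrow> (\<integral>\<^sup>+x. f x \<partial>local_law k)) lim_filter"
proof -
  let ?N = "\<lambda>n. distr (avg n) lf_config_space (\<lambda>x. x \<inter> win k)"
  have "((\<lambda>n. \<integral>\<^sup>+x. f x \<partial>?N n) \<longlongrightarrow> (\<integral>\<^sup>+x. f x \<partial>local_law k)) lim_filter"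
  proof (rule tendsto_nn_integral_bounded[OF _ _ _ _ _ f bound])
    show "prob_space (?N n)" for n by (rule prob_space.prob_space_distr[OF prob_avg]) measurable
    show "((\<lambda>n. emeasure (?N n) A) \<longlongrightarrow> emeasure (local_law k) A) lim_filter" if A: "A \<in> sets lf_config_space" for A
    proof -
      have "emeasure (?N n) A = emeasure (avg n) (window_event k A)" for n
        using A by (subst emeasure_distr) (auto intro!: arg_cong[where f="emeasure (avg n)"])
      then show ?thesis using tendsto_lim_val A by (simp add: emeasure_local_law)
    qed
  qed (auto intro: prob_local_law)
  moreover have "(\<integral>\<^sup>+x. f x \<partial>?N n) = (\<integral>\<^sup>+x. f (x \<inter> win k) \<partial>avg n)" for n
    by (rule nn_integral_distr) measurable
  ultimately show ?thesis by simp
qed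

end

section \<open>Extension to growing windows\<close>

text \<open>The Ionescu-Tulcea theorem for kernels that depend on the last state only, reduced to
the laws of two consecutive states.\<close>
lemma markov_chain_exists:
  fixes K :: "nat \<Rightarrow> 'a \<Rightarrow> 'a measure"
  assumes K: "\<And>n. K n \<in> M \<rightarrow>\<^sub>M subprob_algebra M"
    and prob_K: "\<And>n z. z \<in> space M \<Longrightarrow> prob_space (K n z)"
    and z0: "z0 \<in> space M"
  shows "\<exists>(\<Omega> :: (nat \<Rightarrow> 'a) measure) X. prob_space \<Omega> \<and> (\<forall>n. X n \<in> \<Omega> \<rightarrow>\<^sub>M M) \<and>
    (\<forall>h\<in>borel_measurable M. (\<integral>\<^sup>+\<omega>. h (X 0 \<omega>) \<partial>\<Omega>) = h z0) \<and>
    (\<forall>n. \<forall>h\<in>borel_measurable (M \<Otimes>\<^sub>M M).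
      (\<integral>\<^sup>+\<omega>. h (X n \<omega>, X (Suc n) \<omega>) \<partial>\<Omega>) = (\<integral>\<^sup>+\<omega>. \<integral>\<^sup>+y. h (X n \<omega>, y) \<partial>K n (X n \<omega>) \<partial>\<Omega>))"
proof -
  define P where "P i \<omega> = (case i of 0 \<Rightarrow> return M z0 | Suc n \<Rightarrow> K n (\<omega> n))" for i and \<omega> :: "nat \<Rightarrow> 'a"
  note K[measurable]
  interpret IT: Ionescu_Tulcea P "\<lambda>_. M"
  proof (rule Ionescu_Tulcea.intro)
    fix i show "P i \<in> PiM {0..<i} (\<lambda>_. M) \<rightarrow>\<^sub>M subprob_algebra M"
    proof (cases i)
      case 0
      have "return M z0 \<in> space (subprob_algebra M)"
        using z0 by (auto simp: space_subprob_algebra intro!: prob_space_imp_subprob_space prob_space_return)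
      then show ?thesis using 0 by (simp add: P_def[abs_def])
    next
      case (Suc n)
      have "(\<lambda>\<omega>. \<omega> n) \<in> PiM {0..<i} (\<lambda>_. M) \<rightarrow>\<^sub>M M"
        using Suc by (intro measurable_component_singleton) auto
      from measurable_compose[OF this K[of n]] Suc show ?thesis by (simp add: P_def[abs_def])
    qed
  next
    fix i and x :: "nat \<Rightarrow> 'a" assume x: "x \<in> space (PiM {0..<i} (\<lambda>_. M))"
    show "prob_space (P i x)"
    proof (cases i)
      case 0 then show ?thesis using z0 by (simp add: P_def prob_space_return)
    next
      case (Suc n)
      then have "x n \<in> space M" using x by (auto simp: space_PiM PiE_iff)
      with Suc prob_K show ?thesis by (simp add: P_def)
    qed
  qed
  let ?L = "IT.PF.lim" and ?u = "(\<lambda>_. undefined) :: nat \<Rightarrow> 'a"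
  have u: "?u \<in> space (PiM {0..<0} (\<lambda>_. M))" by (simp add: space_PiM)
  have distr: "distr ?L (PiM {0..<n} (\<lambda>_. M)) (\<lambda>x. restrict x {0..<n}) = IT.C 0 n ?u" for n
  proof -
    have "IT.CI {0..<n} = IT.C 0 n ?u"
    proof (rule measure_eqI)
      show s: "sets (IT.CI {0..<n}) = sets (IT.C 0 n ?u)"
        using IT.sets_C[OF u, of n] by (simp add: IT.CI_def)
      fix A assume "A \<in> sets (IT.CI {0..<n})"
      then have A: "A \<in> sets (PiM {0..<n} (\<lambda>_. M))" by (simp add: IT.CI_def)
      have "IT.PF.emb {0..<n} {0..<n} A = A"
        using sets.sets_into_space[OF A] by (intro prod_emb_id) (simp add: space_PiM)
      then show "emeasure (IT.CI {0..<n}) A = emeasure (IT.C 0 n ?u) A"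
        using IT.emeasure_CI[OF subset_refl A] by simp
    qed
    then show ?thesis by (simp add: IT.distr_lim)
  qed
  have sets_L[measurable_cong]: "sets ?L = sets (PiM UNIV (\<lambda>_. M))" by (rule IT.PF.sets_lim)
  have space_L: "space ?L = space (PiM UNIV (\<lambda>_. M))" by (rule sets_eq_imp_space_eq[OF sets_L])
  have restr: "(\<lambda>x. restrict x {0..<n}) \<in> ?L \<rightarrow>\<^sub>M PiM {0..<n} (\<lambda>_. M)" for n
    by (rule measurable_cong_sets[OF sets_L refl, THEN equalityD2, THEN subsetD]) (intro measurable_restrict_subset, simp)
  have cyl: "(\<integral>\<^sup>+\<omega>. f (restrict \<omega> {0..<n}) \<partial>?L) = (\<integral>\<^sup>+\<omega>. f \<omega> \<partial>IT.C 0 n ?u)"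
    if f: "f \<in> borel_measurable (PiM {0..<n} (\<lambda>_. M))" for f n
    by (subst distr[symmetric], subst nn_integral_distr[OF restr]) (simp_all add: f)
  have comp: "(\<lambda>\<omega>. \<omega> i) \<in> PiM {0..<n} (\<lambda>_. M) \<rightarrow>\<^sub>M M" if "i < n" for i n :: nat
    using that by (intro measurable_component_singleton) auto
  have one_step: "(\<integral>\<^sup>+\<omega>. f \<omega> \<partial>IT.C 0 (Suc n) ?u) = (\<integral>\<^sup>+\<omega>. \<integral>\<^sup>+y. f (fun_upd \<omega> n y) \<partial>P n \<omega> \<partial>IT.C 0 n ?u)"
    if f: "f \<in> borel_measurable (PiM {0..<Suc n} (\<lambda>_. M))" for f n
  proof -
    have "(\<integral>\<^sup>+\<omega>. f \<omega> \<partial>IT.C 0 (Suc n) ?u) = (\<integral>\<^sup>+\<omega>. \<integral>\<^sup>+x. f x \<partial>IT.eP n \<omega> \<partial>IT.C 0 n ?u)"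
    proof -
      have e: "IT.eP (0 + n) \<in> IT.C 0 n ?u \<rightarrow>\<^sub>M subprob_algebra (PiM {0..<Suc n} (\<lambda>_. M))"
      proof -
        have s: "sets (IT.C 0 n ?u) = sets (PiM {0..<n} (\<lambda>_. M))" using IT.sets_C[OF u, of n] by simp
        show ?thesis unfolding add_0 measurable_cong_sets[OF s refl] by (rule IT.measurable_eP)
      qed
      show ?thesis using nn_integral_bind[OF f e] by simp
    qed
    also have "\<dots> = (\<integral>\<^sup>+\<omega>. \<integral>\<^sup>+y. f (fun_upd \<omega> n y) \<partial>P n \<omega> \<partial>IT.C 0 n ?u)"
      using IT.nn_integral_eP[OF _ f] IT.space_C[OF u, of n] by (intro nn_integral_cong) simp
    finally show ?thesis .
  qed
  define X where "X n \<omega> = \<omega> n" for n and \<omega> :: "nat \<Rightarrow> 'a"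
  have X: "X n \<in> ?L \<rightarrow>\<^sub>M M" for n
    unfolding X_def by measurable
  have 1: "(\<integral>\<^sup>+\<omega>. h (X 0 \<omega>) \<partial>?L) = h z0" if h: "h \<in> borel_measurable M" for h
  proof -
    have h0: "(\<lambda>\<omega>. h (\<omega> 0)) \<in> borel_measurable (PiM {0..<Suc 0} (\<lambda>_. M))"
      by (rule measurable_compose[OF comp h]) simp
    have "(\<integral>\<^sup>+\<omega>. h (X 0 \<omega>) \<partial>?L) = (\<integral>\<^sup>+\<omega>. h (restrict \<omega> {0..<Suc 0} 0) \<partial>?L)" by (simp add: X_def)
    also have "\<dots> = (\<integral>\<^sup>+\<omega>. \<integral>\<^sup>+y. h (fun_upd \<omega> 0 y 0) \<partial>P 0 \<omega> \<partial>IT.C 0 0 ?u)"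
      unfolding cyl[OF h0] by (rule one_step[OF h0])
    also have "\<dots> = (\<integral>\<^sup>+\<omega>. h z0 \<partial>IT.C 0 0 ?u)"
      using h z0 by (simp add: P_def nn_integral_return)
    also have "\<dots> = h z0"
      using prob_space.emeasure_space_1[OF IT.prob_space_C[OF u, of 0]]
      by (simp only: nn_integral_const mult_1_right)
    finally show ?thesis .
  qed
  have 2: "(\<integral>\<^sup>+\<omega>. h (X n \<omega>, X (Suc n) \<omega>) \<partial>?L) = (\<integral>\<^sup>+\<omega>. \<integral>\<^sup>+y. h (X n \<omega>, y) \<partial>K n (X n \<omega>) \<partial>?L)"
    if h[measurable]: "h \<in> borel_measurable (M \<Otimes>\<^sub>M M)" for h n
  proof -
    have h2: "(\<lambda>\<omega>. h (\<omega> n, \<omega> (Suc n))) \<in> borel_measurable (PiM {0..<Suc (Suc n)} (\<lambda>_. M))"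
      by (rule measurable_compose[OF measurable_Pair[OF comp comp] h]) auto
    have hK: "(\<lambda>z. \<integral>\<^sup>+y. h (z, y) \<partial>K n z) \<in> borel_measurable M"
      by (rule nn_integral_measurable_subprob_algebra2[OF _ K]) measurable
    have h1: "(\<lambda>\<omega>. \<integral>\<^sup>+y. h (\<omega> n, y) \<partial>K n (\<omega> n)) \<in> borel_measurable (PiM {0..<Suc n} (\<lambda>_. M))"
      by (rule measurable_compose[OF comp hK]) simp
    have "(\<integral>\<^sup>+\<omega>. h (X n \<omega>, X (Suc n) \<omega>) \<partial>?L) =
      (\<integral>\<^sup>+\<omega>. (\<lambda>\<omega>. h (\<omega> n, \<omega> (Suc n))) (restrict \<omega> {0..<Suc (Suc n)}) \<partial>?L)" by (simp add: X_def)
    also have "\<dots> = (\<integral>\<^sup>+\<omega>. \<integral>\<^sup>+y. h (\<omega> n, y) \<partial>K n (\<omega> n) \<partial>IT.C 0 (Suc n) ?u)"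
      unfolding cyl[OF h2] one_step[OF h2] by (simp add: P_def)
    also have "\<dots> = (\<integral>\<^sup>+\<omega>. \<integral>\<^sup>+y. h (X n \<omega>, y) \<partial>K n (X n \<omega>) \<partial>?L)"
      unfolding cyl[OF h1, symmetric] by (simp add: X_def)
    finally show ?thesis .
  qed
  have "prob_space ?L"
    using 1[of "\<lambda>_. 1"] by (intro prob_spaceI) simp
  with X 1 2 show ?thesis by (intro exI[of _ ?L] exI[of _ X]) blast
qed

text \<open>Equality is mutual inclusion, and inclusion says that a sum over the configuration
vanishes.\<close>
lemma equal_config_measurable:
  assumes Y[measurable]: "Y \<in> M \<rightarrow>\<^sub>M lf_config_space" and Z[measurable]: "Z \<in> M \<rightarrow>\<^sub>M lf_config_space"
  shows "Measurable.pred M (\<lambda>\<omega>. Y \<omega> = Z \<omega>)"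
proof -
  have sub: "Measurable.pred M (\<lambda>\<omega>. Y \<omega> \<subseteq> Z \<omega>)"
    if Y[measurable]: "Y \<in> M \<rightarrow>\<^sub>M lf_config_space" and Z[measurable]: "Z \<in> M \<rightarrow>\<^sub>M lf_config_space" for Y Z
  proof -
    have [measurable]: "Measurable.pred (M \<Otimes>\<^sub>M seg_space) (\<lambda>p. snd p \<in> Z (fst p))"
      by (rule member_config_measurable) measurable
    have "(\<lambda>\<omega>. \<integral>\<^sup>+u. (\<lambda>p. indicator {p. snd p \<notin> Z (fst p)} p) (\<omega>, u) \<partial>count_space (Y \<omega>)) \<in> borel_measurable M"
      by (rule sum_over_config_measurable) measurable
    then have m: "(\<lambda>\<omega>. \<integral>\<^sup>+u. indicator (- Z \<omega>) u \<partial>count_space (Y \<omega>) :: ennreal) \<in> borel_measurable M"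
      by (simp add: indicator_def)
    have "Y \<omega> \<subseteq> Z \<omega> \<longleftrightarrow> (\<integral>\<^sup>+u. indicator (- Z \<omega>) u \<partial>count_space (Y \<omega>)) = (0 :: ennreal)" for \<omega>
    proof -
      have "Y \<omega> \<subseteq> Z \<omega> \<longleftrightarrow> Y \<omega> \<inter> - Z \<omega> = {}" by auto
      also have "\<dots> \<longleftrightarrow> (\<integral>\<^sup>+u. indicator (- Z \<omega>) u \<partial>count_space (Y \<omega>)) = (0 :: ennreal)"
      proof (cases "finite (Y \<omega> \<inter> - Z \<omega>)")
        case True then show ?thesis unfolding sum_indicator_eq by simp
      next
        case False
        then have "Y \<omega> \<inter> - Z \<omega> \<noteq> {}" by fastforce
        with False show ?thesis unfolding sum_indicator_eq by simp
      qed
      finally show ?thesis .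
    qed
    moreover have "Measurable.pred M (\<lambda>\<omega>. (\<integral>\<^sup>+u. indicator (- Z \<omega>) u \<partial>count_space (Y \<omega>)) = (0 :: ennreal))"
      using borel_measurable_eq[OF m measurable_const[of 0]] by (simp add: pred_def)
    ultimately show ?thesis by presburger
  qed
  have "Measurable.pred M (\<lambda>\<omega>. Y \<omega> \<subseteq> Z \<omega> \<and> Z \<omega> \<subseteq> Y \<omega>)"
    using sub[OF Y Z] sub[OF Z Y] by (rule pred_intros_logic)
  moreover have "(\<lambda>\<omega>. Y \<omega> \<subseteq> Z \<omega> \<and> Z \<omega> \<subseteq> Y \<omega>) = (\<lambda>\<omega>. Y \<omega> = Z \<omega>)" by auto
  ultimately show ?thesis by (rule subst[rotated])
qed

context segment_gibbs begin

definition annulus :: "nat \<Rightarrow> seg set" where "annulus k = win (Suc k) - win k"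

lemma annulus [measurable]: "annulus k \<in> sets seg_space" and annulus_win: "annulus k \<subseteq> win (Suc k)"
  by (auto simp: annulus_def)

lemma win_Suc: "win (Suc k) = win k \<union> annulus k"
  using win_mono[of k "Suc k"] by (auto simp: annulus_def)

text \<open>The configuration in the next annulus is dominated by the Poisson measure jointly with
the configuration in the window inside. The dominating quantity is the integral of a bounded local
function, so both sides pass to the limit.\<close>
lemma annulus_law_dominated:
  assumes E[measurable]: "E \<in> sets (lf_config_space \<Otimes>\<^sub>M lf_config_space)"
  shows "emeasure (distr (local_law (Suc k)) (lf_config_space \<Otimes>\<^sub>M lf_config_space) (\<lambda>x. (x \<inter> win k, x \<inter> annulus k))) E
    \<le> emeasure (local_law k \<Otimes>\<^sub>M poisson (annulus k)) E"
proof -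
  let ?LL = "lf_config_space \<Otimes>\<^sub>M lf_config_space"
  interpret P: finite_measure "poisson (annulus k)" by (rule finite_poisson[OF annulus annulus_win])
  define f where "f z = (\<integral>\<^sup>+y. indicator E (z, y) \<partial>poisson (annulus k))" for z
  have [measurable]: "f \<in> borel_measurable lf_config_space" unfolding f_def by measurable
  define c where "c = measure (poisson (annulus k)) (space (poisson (annulus k)))"
  have f_le: "f z \<le> ennreal c" for z
  proof -
    have "f z \<le> (\<integral>\<^sup>+y. 1 \<partial>poisson (annulus k))" unfolding f_def by (intro nn_integral_mono) (auto split: split_indicator)
    also have "\<dots> = ennreal c" unfolding c_def P.emeasure_eq_measure[symmetric] by simp
    finally show ?thesis .
  qed
  let ?D = "{x \<in> space lf_config_space. (x \<inter> win k, x \<inter> annulus k) \<in> E}"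
  have pm: "(\<lambda>x. (x \<inter> win k, x \<inter> annulus k)) \<in> lf_config_space \<rightarrow>\<^sub>M ?LL" by measurable
  have D[measurable]: "?D \<in> sets lf_config_space"
  proof -
    have "(\<lambda>x. (x \<inter> win k, x \<inter> annulus k)) -` E \<inter> space lf_config_space \<in> sets lf_config_space"
      by (rule measurable_sets[OF pm E])
    also have "(\<lambda>x. (x \<inter> win k, x \<inter> annulus k)) -` E \<inter> space lf_config_space = ?D" by auto
    finally show ?thesis .
  qed
  have pm': "(\<lambda>x. (x \<inter> win k, x \<inter> annulus k)) \<in> local_law (Suc k) \<rightarrow>\<^sub>M ?LL" by measurable
  have "emeasure (distr (local_law (Suc k)) ?LL (\<lambda>x. (x \<inter> win k, x \<inter> annulus k))) E = emeasure (local_law (Suc k)) ?D"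
    by (subst emeasure_distr[OF pm' E]) (auto intro!: arg_cong[where f="emeasure _"])
  also have "\<dots> = lim_val (window_event (Suc k) ?D)" by (rule emeasure_local_law[OF D])
  also have "window_event (Suc k) ?D = ?D"
  proof -
    have "x \<inter> win (Suc k) \<inter> win k = x \<inter> win k" "x \<inter> win (Suc k) \<inter> annulus k = x \<inter> annulus k" for x
      by (auto simp: win_Suc)
    then show ?thesis using lf_config_subset by auto
  qed
  also have "lim_val ?D \<le> (\<integral>\<^sup>+x. f x \<partial>local_law k)"
  proof (rule tendsto_le[OF lim_filter(1) tendsto_local_integral tendsto_lim_val])
    have "emeasure (avg n) ?D \<le> (\<integral>\<^sup>+x. f (x \<inter> win k) \<partial>avg n)" if n: "k \<le> n" for n
    proof -
      define F where "F p = (indicator E (fst p \<inter> win k, snd p) :: ennreal)" for p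
      have F[measurable]: "F \<in> borel_measurable ?LL" unfolding F_def by measurable
      have sub: "(x - annulus k) \<inter> win k = x \<inter> win k" for x by (auto simp: annulus_def)
      have "emeasure (avg n) ?D = (\<integral>\<^sup>+x. indicator ?D x \<partial>avg n)"
        by (rule nn_integral_indicator[symmetric]) simp
      also have "\<dots> = (\<integral>\<^sup>+x. F (x - annulus k, x \<inter> annulus k) \<partial>avg n)"
        by (intro nn_integral_cong) (auto simp: F_def sub split: split_indicator)
      also have "\<dots> \<le> (\<integral>\<^sup>+x. \<integral>\<^sup>+y. F (x - annulus k, y) \<partial>poisson (annulus k) \<partial>avg n)"
        using n annulus_win[of k] win_mono[of "Suc k" "Suc n"] by (intro avg_dominated) auto
      also have "\<dots> = (\<integral>\<^sup>+x. f (x \<inter> win k) \<partial>avg n)" by (simp add: F_def f_def sub)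
      finally show ?thesis .
    qed
    then show "\<forall>\<^sub>F n in lim_filter. emeasure (avg n) ?D \<le> (\<integral>\<^sup>+x. f (x \<inter> win k) \<partial>avg n)"
      by (intro eventually_lim_filter eventually_sequentiallyI)
    show "f \<in> borel_measurable lf_config_space" by measurable
    show "f x \<le> ennreal c" for x by (rule f_le)
  qed
  also have "(\<integral>\<^sup>+x. f x \<partial>local_law k) = (\<integral>\<^sup>+p. indicator E p \<partial>(local_law k \<Otimes>\<^sub>M poisson (annulus k)))"
    unfolding f_def by (rule P.nn_integral_fst) measurable
  also have "\<dots> = emeasure (local_law k \<Otimes>\<^sub>M poisson (annulus k)) E"
    by (rule nn_integral_indicator) measurable
  finally show ?thesis .
qed

text \<open>The density of the joint law of window and annulus with respect to the product of the
law in the window and the Poisson measure gives the conditional law of the annulus. The density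
integrates to one only for almost all configurations in the window; on the exceptional null set
the kernel adds nothing.\<close>
lemma extension_kernel:
  "\<exists>K. K \<in> lf_config_space \<rightarrow>\<^sub>M subprob_algebra lf_config_space \<and>
    (\<forall>z\<in>space lf_config_space. prob_space (K z)) \<and>
    (\<forall>h\<in>borel_measurable (lf_config_space \<Otimes>\<^sub>M lf_config_space).
      (\<integral>\<^sup>+z. \<integral>\<^sup>+y. h (z, y) \<partial>K z \<partial>local_law k) = (\<integral>\<^sup>+x. h (x \<inter> win k, x \<inter> win (Suc k)) \<partial>local_law (Suc k)))"
proof -
  let ?LL = "lf_config_space \<Otimes>\<^sub>M lf_config_space" and ?P = "poisson (annulus k)"
  interpret P: finite_measure ?P by (rule finite_poisson[OF annulus annulus_win])
  interpret local_law: prob_space "local_law k" by (rule prob_local_law)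
  interpret R: pair_sigma_finite "local_law k" ?P ..
  define \<nu> where "\<nu> = distr (local_law (Suc k)) ?LL (\<lambda>x. (x \<inter> win k, x \<inter> annulus k))"
  have sets_\<nu>[measurable_cong]: "sets \<nu> = sets ?LL" by (simp add: \<nu>_def)
  have sets_R[measurable_cong]: "sets (local_law k \<Otimes>\<^sub>M ?P) = sets ?LL" by (intro sets_pair_measure_cong) auto
  have "absolutely_continuous (local_law k \<Otimes>\<^sub>M ?P) \<nu>"
    unfolding absolutely_continuous_def null_sets_def
  proof safe
    fix E assume "E \<in> sets (local_law k \<Otimes>\<^sub>M ?P)" and 0: "emeasure (local_law k \<Otimes>\<^sub>M ?P) E = 0"
    then show "E \<in> sets \<nu>" by (simp add: sets_\<nu> sets_R)
    then have "emeasure \<nu> E \<le> emeasure (local_law k \<Otimes>\<^sub>M ?P) E"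
      unfolding \<nu>_def by (intro annulus_law_dominated) simp
    with 0 show "emeasure \<nu> E = 0" by simp
  qed
  then obtain f where f': "f \<in> borel_measurable (local_law k \<Otimes>\<^sub>M ?P)" and dens_f: "density (local_law k \<Otimes>\<^sub>M ?P) f = \<nu>"
    using R.Radon_Nikodym[of \<nu>] by (auto simp: sets_\<nu> sets_R)
  have f[measurable]: "f \<in> borel_measurable ?LL"
    using f' measurable_cong_sets[OF sets_R refl] by blast
  have int_\<nu>: "(\<integral>\<^sup>+z. \<integral>\<^sup>+y. f (z, y) * h (z, y) \<partial>?P \<partial>local_law k) = (\<integral>\<^sup>+x. h (x \<inter> win k, x \<inter> annulus k) \<partial>local_law (Suc k))"
    if h[measurable]: "h \<in> borel_measurable ?LL" for h
  proof -
    have "(\<integral>\<^sup>+z. \<integral>\<^sup>+y. f (z, y) * h (z, y) \<partial>?P \<partial>local_law k) = (\<integral>\<^sup>+p. f p * h p \<partial>(local_law k \<Otimes>\<^sub>M ?P))"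
      by (rule P.nn_integral_fst) measurable
    also have "\<dots> = (\<integral>\<^sup>+p. h p \<partial>\<nu>)" unfolding dens_f[symmetric] by (rule nn_integral_density[symmetric]) measurable
    also have "\<dots> = (\<integral>\<^sup>+x. h (x \<inter> win k, x \<inter> annulus k) \<partial>local_law (Suc k))"
      unfolding \<nu>_def by (rule nn_integral_distr) measurable
    finally show ?thesis .
  qed
  define c where "c z = (\<integral>\<^sup>+y. f (z, y) \<partial>?P)" for z
  have c[measurable]: "c \<in> borel_measurable lf_config_space" unfolding c_def by measurable
  \<comment> \<open>the law in the window is the marginal of the joint law, so the density integrates to one\<close>
  have "density (local_law k) c = density (local_law k) (\<lambda>_. 1)"
  proof (rule measure_eqI)
    fix A assume "A \<in> sets (density (local_law k) c)"
    then have A[measurable]: "A \<in> sets lf_config_space" by simp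
    have "emeasure (density (local_law k) c) A = (\<integral>\<^sup>+z. c z * indicator A z \<partial>local_law k)" by (rule emeasure_density) measurable
    also have "\<dots> = (\<integral>\<^sup>+z. \<integral>\<^sup>+y. f (z, y) * (\<lambda>p. indicator A (fst p)) (z, y) \<partial>?P \<partial>local_law k)"
    proof (rule nn_integral_cong)
      fix z assume "z \<in> space (local_law k)"
      then have [measurable]: "z \<in> space lf_config_space" by simp
      show "c z * indicator A z = (\<integral>\<^sup>+y. f (z, y) * (\<lambda>p. indicator A (fst p)) (z, y) \<partial>?P)"
        unfolding c_def fst_conv by (rule nn_integral_multc[symmetric]) measurable
    qed
    also have "\<dots> = (\<integral>\<^sup>+x. indicator A (x \<inter> win k) \<partial>local_law (Suc k))"
      by (subst int_\<nu>) auto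
    also have "\<dots> = (\<integral>\<^sup>+x. indicator (window_event k A) x \<partial>local_law (Suc k))"
      by (intro nn_integral_cong) (auto split: split_indicator)
    also have "\<dots> = emeasure (local_law (Suc k)) (window_event k A)"
      by (rule nn_integral_indicator) measurable
    also have "\<dots> = lim_val {x \<in> space lf_config_space. x \<inter> win (Suc k) \<in> (window_event k A)}"
      by (rule emeasure_local_law) measurable
    also have "{x \<in> space lf_config_space. x \<inter> win (Suc k) \<in> (window_event k A)} =
      (window_event k A)"
    proof -
      have "x \<inter> win (Suc k) \<inter> win k = x \<inter> win k" for x by (auto simp: win_Suc)
      then show ?thesis using lf_config_subset by auto
    qed
    also have "lim_val (window_event k A) = emeasure (local_law k) A" by (rule emeasure_local_law[symmetric]) measurable
    finally show "emeasure (density (local_law k) c) A = emeasure (density (local_law k) (\<lambda>_. 1)) A"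
      by (simp add: density_1)
  qed simp
  then have c1: "AE z in local_law k. c z = 1"
    by (subst (asm) local_law.density_unique_iff) auto
  define K where "K z = (if c z = 1 then distr (density ?P (\<lambda>y. f (z, y))) lf_config_space (\<lambda>y. z \<union> y)
    else return lf_config_space z)" for z
  have sets_K: "sets (K z) = sets lf_config_space" for z by (simp add: K_def)
  have int_K: "(\<integral>\<^sup>+y. h y \<partial>K z) = (\<integral>\<^sup>+y. f (z, y) * h (z \<union> y) \<partial>?P)"
    if z[measurable]: "z \<in> space lf_config_space" and cz: "c z = 1" and h[measurable]: "h \<in> borel_measurable lf_config_space" for z h
  proof -
    have "(\<integral>\<^sup>+y. h y \<partial>K z) = (\<integral>\<^sup>+y. h (z \<union> y) \<partial>density ?P (\<lambda>y. f (z, y)))"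
      unfolding K_def using cz by (simp, intro nn_integral_distr) measurable
    also have "\<dots> = (\<integral>\<^sup>+y. f (z, y) * h (z \<union> y) \<partial>?P)" by (rule nn_integral_density) measurable
    finally show ?thesis .
  qed
  have prob_K: "prob_space (K z)" if z: "z \<in> space lf_config_space" for z
  proof (cases "c z = 1")
    case True
    have "emeasure (K z) (space (K z)) = (\<integral>\<^sup>+y. 1 \<partial>K z)" by simp
    also have "\<dots> = 1" using True by (subst int_K[OF z True]) (simp_all add: c_def)
    finally show ?thesis by (rule prob_spaceI)
  next
    case False then show ?thesis using z by (simp add: K_def prob_space_return)
  qed
  have K: "K \<in> lf_config_space \<rightarrow>\<^sub>M subprob_algebra lf_config_space"
  proof (rule measurable_subprob_algebra)
    show "subprob_space (K z)" if "z \<in> space lf_config_space" for z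
      using prob_K[OF that] by (rule prob_space_imp_subprob_space)
    show "sets (K z) = sets lf_config_space" for z by (rule sets_K)
    fix A assume A[measurable]: "A \<in> sets lf_config_space"
    have "emeasure (K z) A = (if c z = 1 then \<integral>\<^sup>+y. f (z, y) * indicator A (z \<union> y) \<partial>?P else indicator A z)"
      if z: "z \<in> space lf_config_space" for z
    proof (cases "c z = 1")
      case True
      have "emeasure (K z) A = (\<integral>\<^sup>+y. indicator A y \<partial>K z)" by (rule nn_integral_indicator[symmetric]) (simp add: sets_K A)
      also have "\<dots> = (\<integral>\<^sup>+y. f (z, y) * indicator A (z \<union> y) \<partial>?P)" by (rule int_K[OF z True]) simp
      finally show ?thesis using True by simp
    next
      case False then show ?thesis using A by (simp add: K_def)
    qed
    moreover have "(\<lambda>z. if c z = 1 then \<integral>\<^sup>+y. f (z, y) * indicator A (z \<union> y) \<partial>?P else indicator A z) \<in> borel_measurable lf_config_space"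
      by measurable
    ultimately show "(\<lambda>z. emeasure (K z) A) \<in> borel_measurable lf_config_space"
      by (subst measurable_cong) assumption
  qed
  have "(\<integral>\<^sup>+z. \<integral>\<^sup>+y. h (z, y) \<partial>K z \<partial>local_law k) = (\<integral>\<^sup>+x. h (x \<inter> win k, x \<inter> win (Suc k)) \<partial>local_law (Suc k))"
    if h[measurable]: "h \<in> borel_measurable ?LL" for h
  proof -
    have "(\<integral>\<^sup>+z. \<integral>\<^sup>+y. h (z, y) \<partial>K z \<partial>local_law k) =
      (\<integral>\<^sup>+z. \<integral>\<^sup>+y. f (z, y) * (\<lambda>p. h (fst p, fst p \<union> snd p)) (z, y) \<partial>?P \<partial>local_law k)"
    proof (rule nn_integral_cong_AE)
      have "AE z in local_law k. z \<in> space (local_law k)" by (rule AE_space)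
      with c1 show "AE z in local_law k. (\<integral>\<^sup>+y. h (z, y) \<partial>K z) =
        (\<integral>\<^sup>+y. f (z, y) * (\<lambda>p. h (fst p, fst p \<union> snd p)) (z, y) \<partial>?P)"
      proof eventually_elim
        case (elim z)
        then have [measurable]: "z \<in> space lf_config_space" by simp
        have "(\<lambda>y. h (z, y)) \<in> borel_measurable lf_config_space" by measurable
        from int_K[OF _ elim(1) this] show ?case using elim(2) by simp
      qed
    qed
    also have "\<dots> = (\<integral>\<^sup>+x. (\<lambda>p. h (fst p, fst p \<union> snd p)) (x \<inter> win k, x \<inter> annulus k) \<partial>local_law (Suc k))"
      by (rule int_\<nu>) measurable
    also have "\<dots> = (\<integral>\<^sup>+x. h (x \<inter> win k, x \<inter> win (Suc k)) \<partial>local_law (Suc k))"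
      by (simp add: win_Suc Int_Un_distrib)
    finally show ?thesis .
  qed
  with K prob_K show ?thesis by blast
qed

end

section \<open>The limit process\<close>

text \<open>The events that depend on the configuration in some window are stable under
intersection, because any two of them depend on a common window, and they generate the
\<sigma>-algebra, because bounded counts do.\<close>
lemma measures_eq_on_local_events:
  assumes sets: "sets M1 = sets lf_config_space" "sets M2 = sets lf_config_space"
    and fin: "finite_measure M1"
    and eq: "\<And>k A. A \<in> sets lf_config_space \<Longrightarrow>
      emeasure M1 (window_event k A) = emeasure M2 (window_event k A)"
  shows "M1 = M2"
proof -
  let ?L = "lf_config_space"
  let ?l = "\<lambda>k A. {x \<in> space ?L. x \<inter> win k \<in> A}"
  let ?E = "{?l k A | k A. A \<in> sets ?L}"
  have l_sets: "?l k A \<in> sets ?L" if "A \<in> sets ?L" for k A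
  proof -
    have "(\<lambda>x. x \<inter> win k) \<in> ?L \<rightarrow>\<^sub>M ?L" by measurable
    from measurable_sets[OF this that] have "(\<lambda>x. x \<inter> win k) -` A \<inter> space ?L \<in> sets ?L" .
    also have "(\<lambda>x. x \<inter> win k) -` A \<inter> space ?L = ?l k A" by auto
    finally show ?thesis .
  qed
  have E_sub: "?E \<subseteq> Pow (space ?L)" by auto
  have in_space: "x \<inter> win k \<in> space ?L" if "x \<in> space ?L" for x k using lf_config_subset[OF that] by simp
  have top: "space ?L \<in> ?E"
  proof -
    have "?l 0 (space ?L) = space ?L" using in_space by blast
    then show ?thesis by blast
  qed
  have up: "?l k A = ?l j (?l k A)" if "k \<le> j" for k j A
  proof -
    have "x \<inter> win j \<inter> win k = x \<inter> win k" for x using win_mono[OF that] by auto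
    then show ?thesis using in_space by auto
  qed
  have Int: "Int_stable ?E"
  proof (rule Int_stableI)
    fix a b assume "a \<in> ?E" "b \<in> ?E"
    then obtain k j A B where a: "a = ?l k A" "A \<in> sets ?L" and b: "b = ?l j B" "B \<in> sets ?L" by blast
    have "a \<inter> b = ?l (k + j) (?l k A) \<inter> ?l (k + j) (?l j B)"
      unfolding a(1) b(1) using up[of k "k + j" A] up[of j "k + j" B] by simp
    also have "\<dots> = ?l (k + j) (?l k A \<inter> ?l j B)" by blast
    finally show "a \<inter> b \<in> ?E" using l_sets[OF a(2), of k] l_sets[OF b(2), of j] by blast
  qed
  let ?M = "sigma (space ?L) ?E"
  have sp: "space ?M = space ?L" by (rule space_measure_of[OF E_sub])
  have "(\<lambda>x. x) \<in> ?M \<rightarrow>\<^sub>M ?L"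
  proof (rule measurable_lf_configI)
    fix B k assume B: "B \<in> sets seg_space" "B \<subseteq> win k"
    let ?c = "\<lambda>x. \<integral>\<^sup>+u. indicator B u \<partial>count_space x :: ennreal"
    have loc: "?c (x \<inter> win k) = ?c x" for x
    proof -
      have "x \<inter> win k \<inter> B = x \<inter> B" using B(2) by auto
      then show ?thesis unfolding sum_indicator_eq by simp
    qed
    have "?c -` S \<inter> space ?M \<in> sets ?M" if S: "S \<in> sets borel" for S
    proof -
      have "?c -` S \<inter> space ?L \<in> sets ?L" by (rule measurable_sets[OF sum_indicator_measurable[OF B] S])
      then have "?l k (?c -` S \<inter> space ?L) \<in> ?E" by blast
      moreover have "?l k (?c -` S \<inter> space ?L) = ?c -` S \<inter> space ?M"
        using in_space loc by (auto simp: sp)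
      ultimately show ?thesis by (auto simp: sets_measure_of[OF E_sub])
    qed
    then show "?c \<in> borel_measurable ?M" by (auto simp: measurable_def)
  qed (simp add: sp)
  then have "sets ?L \<subseteq> sets ?M"
    using measurable_sets[of "\<lambda>x. x" ?M ?L] sets.sets_into_space[of _ ?L] sp by (fastforce simp: Int_absorb2)
  moreover have "sets ?M \<subseteq> sets ?L"
    unfolding sets_measure_of[OF E_sub] using l_sets by (intro sets.sigma_sets_subset) auto
  ultimately have gen: "sets ?L = sigma_sets (space ?L) ?E"
    by (simp add: sets_measure_of[OF E_sub])
  show ?thesis
  proof (rule measure_eqI_generator_eq[OF Int E_sub])
    show "emeasure M1 X = emeasure M2 X" if "X \<in> ?E" for X using that eq by blast
    show "sets M1 = sigma_sets (space ?L) ?E" "sets M2 = sigma_sets (space ?L) ?E"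
      using sets gen by auto
    show "range (\<lambda>_ :: nat. space ?L) \<subseteq> ?E" using top by blast
    show "emeasure M1 (space ?L) \<noteq> \<infinity>" using finite_measure.emeasure_finite[OF fin] by simp
  qed simp
qed

context segment_gibbs begin

lemma local_law_0: "local_law 0 = return lf_config_space {}"
proof (rule measure_eqI)
  fix A assume "A \<in> sets (local_law 0)"
  then have A: "A \<in> sets lf_config_space" by simp
  have "win 0 = {}" by (auto simp: win_def)
  then have "window_event 0 A = (if {} \<in> A then space lf_config_space else {})" by auto
  moreover have "lim_val {} = 0" using tendsto_unique[OF lim_filter(1) tendsto_lim_val[of "{}"], of 0] by simp
  ultimately show "emeasure (local_law 0) A = emeasure (return lf_config_space {}) A"
    using A by (simp add: emeasure_local_law lim_val_space)
qed simp

lemma nn_integral_local_law_inter: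
  assumes f[measurable]: "f \<in> borel_measurable lf_config_space"
  shows "(\<integral>\<^sup>+x. f (x \<inter> win k) \<partial>local_law k) = (\<integral>\<^sup>+x. f x \<partial>local_law k)"
proof -
  have "distr (local_law k) lf_config_space (\<lambda>x. x \<inter> win k) = local_law k"
  proof (rule measure_eqI)
    fix A assume "A \<in> sets (distr (local_law k) lf_config_space (\<lambda>x. x \<inter> win k))"
    then have A: "A \<in> sets lf_config_space" by simp
    have "emeasure (distr (local_law k) lf_config_space (\<lambda>x. x \<inter> win k)) A =
      emeasure (local_law k) (window_event k A)"
      using A by (subst emeasure_distr) (auto intro!: arg_cong[where f="emeasure (local_law k)"])
    also have "\<dots> = lim_val {x \<in> space lf_config_space. x \<inter> win k \<in> (window_event k A)}"
      by (rule emeasure_local_law[OF local_event[OF A]])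
    also have "{x \<in> space lf_config_space. x \<inter> win k \<in> (window_event k A)} =
      (window_event k A)" using lf_config_subset by (auto simp: Int_assoc)
    finally show "emeasure (distr (local_law k) lf_config_space (\<lambda>x. x \<inter> win k)) A = emeasure (local_law k) A"
      using A by (simp add: emeasure_local_law)
  qed simp
  moreover have "(\<integral>\<^sup>+x. f x \<partial>distr (local_law k) lf_config_space (\<lambda>x. x \<inter> win k)) = (\<integral>\<^sup>+x. f (x \<inter> win k) \<partial>local_law k)"
    by (rule nn_integral_distr) measurable
  ultimately show ?thesis by simp
qed

text \<open>The kernels run a Markov chain of configurations in growing windows, each state almost
surely being the restriction of the next. The union of the states is the limit process, and its
restriction to a window is the corresponding state.\<close>
lemma limit_measure_exists:
  "\<exists>P. sets P = sets lf_config_space \<and> prob_space P \<and>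
    (\<forall>k. \<forall>f\<in>borel_measurable lf_config_space. (\<integral>\<^sup>+x. f (x \<inter> win k) \<partial>P) = (\<integral>\<^sup>+x. f x \<partial>local_law k))"
proof -
  let ?L = "lf_config_space"
  have "\<forall>k. \<exists>K. K \<in> ?L \<rightarrow>\<^sub>M subprob_algebra ?L \<and> (\<forall>z\<in>space ?L. prob_space (K z)) \<and>
    (\<forall>h\<in>borel_measurable (?L \<Otimes>\<^sub>M ?L).
      (\<integral>\<^sup>+z. \<integral>\<^sup>+y. h (z, y) \<partial>K z \<partial>local_law k) = (\<integral>\<^sup>+x. h (x \<inter> win k, x \<inter> win (Suc k)) \<partial>local_law (Suc k)))"
    using extension_kernel by blast
  from choice[OF this] obtain K where KK: "\<forall>k. K k \<in> ?L \<rightarrow>\<^sub>M subprob_algebra ?L \<and>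
    (\<forall>z\<in>space ?L. prob_space (K k z)) \<and> (\<forall>h\<in>borel_measurable (?L \<Otimes>\<^sub>M ?L).
      (\<integral>\<^sup>+z. \<integral>\<^sup>+y. h (z, y) \<partial>K k z \<partial>local_law k) = (\<integral>\<^sup>+x. h (x \<inter> win k, x \<inter> win (Suc k)) \<partial>local_law (Suc k)))" ..
  have K: "K k \<in> ?L \<rightarrow>\<^sub>M subprob_algebra ?L" for k using KK[rule_format, of k] by (rule conjunct1)
  have prob_K: "prob_space (K k z)" if "z \<in> space ?L" for k z
    using KK[rule_format, of k, THEN conjunct2, THEN conjunct1] that by (rule bspec)
  have int_K: "(\<integral>\<^sup>+z. \<integral>\<^sup>+y. h (z, y) \<partial>K k z \<partial>local_law k) = (\<integral>\<^sup>+x. h (x \<inter> win k, x \<inter> win (Suc k)) \<partial>local_law (Suc k))"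
    if "h \<in> borel_measurable (?L \<Otimes>\<^sub>M ?L)" for k h
    using KK[rule_format, of k, THEN conjunct2, THEN conjunct2] that by (rule bspec)
  obtain \<Omega> :: "(nat \<Rightarrow> seg set) measure" and X where prob_\<Omega>: "prob_space \<Omega>" and X[measurable]: "\<And>n. X n \<in> \<Omega> \<rightarrow>\<^sub>M ?L"
    and X0: "\<And>h. h \<in> borel_measurable ?L \<Longrightarrow> (\<integral>\<^sup>+\<omega>. h (X 0 \<omega>) \<partial>\<Omega>) = h {}"
    and XS: "\<And>n h. h \<in> borel_measurable (?L \<Otimes>\<^sub>M ?L) \<Longrightarrow>
      (\<integral>\<^sup>+\<omega>. h (X n \<omega>, X (Suc n) \<omega>) \<partial>\<Omega>) = (\<integral>\<^sup>+\<omega>. \<integral>\<^sup>+y. h (X n \<omega>, y) \<partial>K n (X n \<omega>) \<partial>\<Omega>)"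
    using markov_chain_exists[of K ?L "{}", OF K prob_K empty_in_lf_config] by blast
  have law: "(\<integral>\<^sup>+\<omega>. f (X k \<omega>) \<partial>\<Omega>) = (\<integral>\<^sup>+x. f x \<partial>local_law k)" if "f \<in> borel_measurable ?L" for f k
    using that
  proof (induction k arbitrary: f)
    case 0
    then show ?case by (simp add: X0 local_law_0 nn_integral_return)
  next
    case (Suc k f)
    note [measurable] = Suc.prems
    have h: "(\<lambda>p. f (snd p)) \<in> borel_measurable (?L \<Otimes>\<^sub>M ?L)" by measurable
    have g: "(\<lambda>z. \<integral>\<^sup>+y. f y \<partial>K k z) \<in> borel_measurable ?L"
      by (rule nn_integral_measurable_subprob_algebra2[OF _ K]) measurable
    have "(\<integral>\<^sup>+\<omega>. f (X (Suc k) \<omega>) \<partial>\<Omega>) = (\<integral>\<^sup>+\<omega>. \<integral>\<^sup>+y. f y \<partial>K k (X k \<omega>) \<partial>\<Omega>)"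
      using XS[OF h, of k] by simp
    also have "\<dots> = (\<integral>\<^sup>+z. \<integral>\<^sup>+y. f y \<partial>K k z \<partial>local_law k)" by (rule Suc.IH[OF g])
    also have "\<dots> = (\<integral>\<^sup>+x. f (x \<inter> win (Suc k)) \<partial>local_law (Suc k))" using int_K[OF h, of k] by simp
    also have "\<dots> = (\<integral>\<^sup>+x. f x \<partial>local_law (Suc k))" by (rule nn_integral_local_law_inter) measurable
    finally show ?case .
  qed
  \<comment> \<open>almost surely the states are consistent; the union is used only in this case\<close>
  define good where "good \<omega> \<longleftrightarrow> (\<forall>k. X k \<omega> = X (Suc k) \<omega> \<inter> win k)" for \<omega>
  have [measurable]: "Measurable.pred \<Omega> (\<lambda>\<omega>. X k \<omega> = X (Suc k) \<omega> \<inter> win k)" for k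
    by (rule equal_config_measurable) measurable
  have [measurable]: "Measurable.pred \<Omega> good" unfolding good_def[abs_def] by measurable
  have "AE \<omega> in \<Omega>. X k \<omega> = X (Suc k) \<omega> \<inter> win k" for k
  proof -
    have "Measurable.pred (?L \<Otimes>\<^sub>M ?L) (\<lambda>p. fst p = snd p \<inter> win k)"
      by (rule equal_config_measurable) measurable
    then have h[measurable]: "(\<lambda>p. indicator {p. fst p \<noteq> snd p \<inter> win k} p :: ennreal) \<in> borel_measurable (?L \<Otimes>\<^sub>M ?L)"
      by measurable
    have g: "(\<lambda>z. \<integral>\<^sup>+y. indicator {p. fst p \<noteq> snd p \<inter> win k} (z, y) \<partial>K k z :: ennreal) \<in> borel_measurable ?L"
      by (rule nn_integral_measurable_subprob_algebra2[OF _ K]) measurable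
    have "(\<integral>\<^sup>+\<omega>. indicator {p. fst p \<noteq> snd p \<inter> win k} (X k \<omega>, X (Suc k) \<omega>) \<partial>\<Omega>) =
      (\<integral>\<^sup>+z. \<integral>\<^sup>+y. indicator {p. fst p \<noteq> snd p \<inter> win k} (z, y) \<partial>K k z \<partial>local_law k)"
      unfolding XS[OF h] by (rule law[OF g])
    also have "\<dots> = (\<integral>\<^sup>+x. indicator {p. fst p \<noteq> snd p \<inter> win k} (x \<inter> win k, x \<inter> win (Suc k)) \<partial>local_law (Suc k))"
      by (rule int_K[OF h])
    also have "\<dots> = (\<integral>\<^sup>+x. 0 \<partial>local_law (Suc k))"
    proof (rule nn_integral_cong)
      fix x
      have "x \<inter> win (Suc k) \<inter> win k = x \<inter> win k" by (auto simp: win_Suc)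
      then show "indicator {p. fst p \<noteq> snd p \<inter> win k} (x \<inter> win k, x \<inter> win (Suc k)) = (0 :: ennreal)" by simp
    qed
    finally have "(\<integral>\<^sup>+\<omega>. indicator {\<omega>. X k \<omega> \<noteq> X (Suc k) \<omega> \<inter> win k} \<omega> \<partial>\<Omega>) = 0"
      by (simp add: indicator_def)
    then have "AE \<omega> in \<Omega>. indicator {\<omega>. X k \<omega> \<noteq> X (Suc k) \<omega> \<inter> win k} \<omega> = (0 :: ennreal)"
      by (subst (asm) nn_integral_0_iff_AE) measurable
    then show ?thesis by (rule eventually_mono) (auto split: split_indicator_asm)
  qed
  then have AE_good: "AE \<omega> in \<Omega>. good \<omega>" unfolding good_def by (simp add: AE_all_countable)
  define T where "T \<omega> = (if good \<omega> then \<Union>k. X k \<omega> else {})" for \<omega>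
  have T_win: "T \<omega> \<inter> win k = X k \<omega>" if good: "good \<omega>" for \<omega> k
  proof -
    have restr: "X j \<omega> = X (j + i) \<omega> \<inter> win j" for i j
    proof (induction i)
      case 0
      have "X j \<omega> = X (Suc j) \<omega> \<inter> win j" using good unfolding good_def by blast
      then show ?case by auto
    next
      case (Suc i)
      have "X (j + i) \<omega> = X (Suc (j + i)) \<omega> \<inter> win (j + i)" using good unfolding good_def by blast
      then have "X j \<omega> = X (Suc (j + i)) \<omega> \<inter> (win (j + i) \<inter> win j)" using Suc by auto
      also have "win (j + i) \<inter> win j = win j" using win_mono[of j "j + i"] by auto
      finally show ?case by simp
    qed
    show ?thesis
    proof (intro equalityI subsetI)
      fix u assume "u \<in> T \<omega> \<inter> win k"
      then obtain l where l: "u \<in> X l \<omega>" "u \<in> win k" using good by (auto simp: T_def)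
      show "u \<in> X k \<omega>"
      proof (cases "l \<le> k")
        case True
        then have "X l \<omega> \<subseteq> X k \<omega>" using restr[of l "k - l"] by (metis Int_lower1 le_add_diff_inverse)
        with l show ?thesis by blast
      next
        case False
        then have "X l \<omega> \<inter> win k = X k \<omega>" using restr[of k "l - k"] by (metis le_add_diff_inverse nat_le_linear)
        with l show ?thesis by blast
      qed
    next
      fix u assume u: "u \<in> X k \<omega>"
      then have "u \<in> win k" using restr[of k 0] by blast
      with u good show "u \<in> T \<omega> \<inter> win k" by (auto simp: T_def)
    qed
  qed
  have T[measurable]: "T \<in> \<Omega> \<rightarrow>\<^sub>M ?L"
  proof (rule measurable_lf_configI)
    fix \<omega> assume \<omega>: "\<omega> \<in> space \<Omega>"
    have Xsp: "X k \<omega> \<in> space ?L" for k using measurable_space[OF X \<omega>] .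
    show "T \<omega> \<in> space ?L"
    proof (cases "good \<omega>")
      case True
      have "T \<omega> \<subseteq> space seg_space" using Xsp by (auto simp: T_def mem_space_lf_config)
      moreover have "finite (T \<omega> \<inter> win k)" for k
      proof -
        have "T \<omega> \<inter> win k = X k \<omega> \<inter> win k" using T_win[OF True, of k] by auto
        then show ?thesis using Xsp[of k] by (simp add: mem_space_lf_config)
      qed
      ultimately show ?thesis by (simp add: mem_space_lf_config)
    qed (simp add: T_def)
  next
    fix B k assume B[measurable]: "B \<in> sets seg_space" and Bk: "B \<subseteq> win k"
    let ?c = "\<lambda>x. \<integral>\<^sup>+u. indicator B u \<partial>count_space x :: ennreal"
    have "?c (T \<omega>) = (if good \<omega> then ?c (X k \<omega>) else 0)" for \<omega>
    proof (cases "good \<omega>")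
      case True
      have "T \<omega> \<inter> B = X k \<omega> \<inter> B" using T_win[OF True, of k] Bk by auto
      then show ?thesis using True unfolding sum_indicator_eq by simp
    qed (simp add: T_def nn_integral_count_space_finite)
    moreover have [measurable]: "(\<lambda>\<omega>. ?c (X k \<omega>)) \<in> borel_measurable \<Omega>"
      by (rule measurable_compose[OF X sum_indicator_measurable[OF B Bk]])
    have "(\<lambda>\<omega>. if good \<omega> then ?c (X k \<omega>) else 0) \<in> borel_measurable \<Omega>" by measurable
    ultimately show "(\<lambda>\<omega>. ?c (T \<omega>)) \<in> borel_measurable \<Omega>" by simp
  qed
  let ?P = "distr \<Omega> ?L T"
  have "prob_space ?P" using T by (rule prob_space.prob_space_distr[OF prob_\<Omega>])
  moreover have "(\<integral>\<^sup>+x. f (x \<inter> win k) \<partial>?P) = (\<integral>\<^sup>+x. f x \<partial>local_law k)" if f[measurable]: "f \<in> borel_measurable ?L" for f k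
  proof -
    have "(\<integral>\<^sup>+x. f (x \<inter> win k) \<partial>?P) = (\<integral>\<^sup>+\<omega>. f (T \<omega> \<inter> win k) \<partial>\<Omega>)"
      by (rule nn_integral_distr) measurable
    also have "\<dots> = (\<integral>\<^sup>+\<omega>. f (X k \<omega>) \<partial>\<Omega>)"
      using AE_good by (intro nn_integral_cong_AE) (auto elim!: eventually_mono simp: T_win)
    also have "\<dots> = (\<integral>\<^sup>+x. f x \<partial>local_law k)" by (rule law[OF f])
    finally show ?thesis .
  qed
  ultimately show ?thesis by (intro exI[of _ ?P]) simp
qed

end

context segment_gibbs begin

definition limit_law :: "seg set measure" where
  "limit_law = (SOME limit_law. sets limit_law = sets lf_config_space \<and> prob_space limit_law \<and>
    (\<forall>k. \<forall>f\<in>borel_measurable lf_config_space. (\<integral>\<^sup>+x. f (x \<inter> win k) \<partial>limit_law) = (\<integral>\<^sup>+x. f x \<partial>local_law k)))"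

lemma sets_limit_law [measurable_cong, simp]: "sets limit_law = sets lf_config_space"
  and prob_limit_law: "prob_space limit_law"
  and nn_integral_limit_law_local: "f \<in> borel_measurable lf_config_space \<Longrightarrow> (\<integral>\<^sup>+x. f (x \<inter> win k) \<partial>limit_law) = (\<integral>\<^sup>+x. f x \<partial>local_law k)"
  using someI_ex[OF limit_measure_exists] unfolding limit_law_def[symmetric] by blast+

lemma space_limit_law [simp]: "space limit_law = space lf_config_space"
  by (rule sets_eq_imp_space_eq) simp

lemma emeasure_limit_law_local:
  assumes A: "A \<in> sets lf_config_space"
  shows "emeasure limit_law (window_event k A) = lim_val (window_event k A)"
proof -
  have "emeasure limit_law (window_event k A) =
    (\<integral>\<^sup>+x. indicator (window_event k A) x \<partial>limit_law)"
    using local_event[OF A] by (intro nn_integral_indicator[symmetric]) simp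
  also have "\<dots> = (\<integral>\<^sup>+x. indicator A (x \<inter> win k) \<partial>limit_law)"
    by (intro nn_integral_cong) (auto split: split_indicator)
  also have "\<dots> = (\<integral>\<^sup>+x. indicator A x \<partial>local_law k)" using A by (intro nn_integral_limit_law_local) simp
  also have "\<dots> = emeasure (local_law k) A" using A by simp
  finally show ?thesis using A by (simp add: emeasure_local_law)
qed

lemma shift_event [measurable]:
  assumes A: "A \<in> sets lf_config_space"
  shows "{x \<in> space lf_config_space. shift s x \<in> A} \<in> sets lf_config_space"
proof -
  have "(\<lambda>x. shift s x) \<in> lf_config_space \<rightarrow>\<^sub>M lf_config_space" by measurable
  from measurable_sets[OF this A] have "(\<lambda>x. shift s x) -` A \<inter> space lf_config_space \<in> sets lf_config_space" .
  also have "(\<lambda>x. shift s x) -` A \<inter> space lf_config_space = {x \<in> space lf_config_space. shift s x \<in> A}" by auto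
  finally show ?thesis .
qed

section \<open>Stationarity of the limit\<close>

text \<open>The error term of the averaged processes tends to zero. Together with the inverse
shift, this inequality yields equality.\<close>
lemma lim_val_shift_le:
  assumes A: "A \<in> sets lf_config_space"
  shows "lim_val {x \<in> space lf_config_space. shift s x \<in> A} \<le> lim_val A"
proof -
  define e where "e n = ((real (Suc n) + norm s)\<^sup>2 - (real (Suc n))\<^sup>2) / (real (Suc n))\<^sup>2" for n
  have "e \<longlonglongrightarrow> 0"
  proof -
    have "e n = 2 * norm s * inverse (real (Suc n)) + (norm s)\<^sup>2 * (inverse (real (Suc n)))\<^sup>2" for n
    proof -
      have *: "((R + c)\<^sup>2 - R\<^sup>2) / R\<^sup>2 = 2 * c * inverse R + c\<^sup>2 * (inverse R)\<^sup>2" if "R > 0" for R c :: real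
        using that by (simp add: field_simps power2_eq_square)
      show ?thesis unfolding e_def by (rule *) simp
    qed
    then have "e = (\<lambda>n. 2 * norm s * inverse (real (Suc n)) + (norm s)\<^sup>2 * (inverse (real (Suc n)))\<^sup>2)" by blast
    moreover have "(\<lambda>n. 2 * norm s * inverse (real (Suc n)) + (norm s)\<^sup>2 * (inverse (real (Suc n)))\<^sup>2)
      \<longlonglongrightarrow> 2 * norm s * 0 + (norm s)\<^sup>2 * 0\<^sup>2"
      by (intro tendsto_intros LIMSEQ_inverse_real_of_nat)
    ultimately show ?thesis by simp
  qed
  then have "(\<lambda>n. ennreal (e n)) \<longlonglongrightarrow> ennreal 0" by (rule tendsto_ennrealI)
  then have "((\<lambda>n. ennreal (e n)) \<longlongrightarrow> 0) lim_filter" using lim_filter(2) tendsto_mono by auto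
  then have "((\<lambda>n. emeasure (avg n) A + ennreal (e n)) \<longlongrightarrow> lim_val A + 0) lim_filter" by (intro tendsto_add tendsto_lim_val)
  then have "((\<lambda>n. emeasure (avg n) A + ennreal (e n)) \<longlongrightarrow> lim_val A) lim_filter" by simp
  then show ?thesis
    by (rule tendsto_le[OF lim_filter(1) _ tendsto_lim_val]) (use avg_shift_le[OF A, of _ s] in \<open>simp add: e_def\<close>)
qed

lemma lim_val_shift:
  assumes A: "A \<in> sets lf_config_space"
  shows "lim_val {x \<in> space lf_config_space. shift s x \<in> A} = lim_val A"
proof (rule antisym[OF lim_val_shift_le[OF A]])
  have "A = {x \<in> space lf_config_space. shift (- s) x \<in> {x \<in> space lf_config_space. shift s x \<in> A}}"
    using sets.sets_into_space[OF A] shift_lf_config by (auto simp: shift_shift)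
  then have "lim_val A = lim_val {x \<in> space lf_config_space. shift (- s) x \<in> {x \<in> space lf_config_space. shift s x \<in> A}}" by (rule arg_cong)
  also have "\<dots> \<le> lim_val {x \<in> space lf_config_space. shift s x \<in> A}" by (rule lim_val_shift_le[OF shift_event[OF A]])
  finally show "lim_val A \<le> lim_val {x \<in> space lf_config_space. shift s x \<in> A}" .
qed

text \<open>A shifted local event is again local, for a larger window, so on both events the limit
law agrees with the shift-invariant limit of the probabilities.\<close>
lemma distr_shift_limit_law: "distr limit_law lf_config_space (shift s) = limit_law"
proof (rule measures_eq_on_local_events)
  interpret limit_law: prob_space limit_law by (rule prob_limit_law)
  have sh: "shift s \<in> limit_law \<rightarrow>\<^sub>M lf_config_space" by measurable
  show "finite_measure (distr limit_law lf_config_space (shift s))" by (rule limit_law.finite_measure_distr[OF sh])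
  fix k A assume A: "A \<in> sets lf_config_space"
  let ?A = "window_event k A"
  let ?B = "{x \<in> space lf_config_space. shift s x \<in> ?A}"
  obtain j where j: "norm s \<le> real j" using real_arch_simple by blast
  have loc: "shift s (x \<inter> win (k + j)) \<inter> win k = shift s x \<inter> win k" for x
    using win_sh[OF j] by (auto simp: shift_eq)
  have B: "?B = window_event (k + j) ?B"
    using shift_lf_config lf_config_subset by (auto simp: loc)
  have "emeasure (distr limit_law lf_config_space (shift s)) ?A = emeasure limit_law ?B"
    using local_event[OF A] by (subst emeasure_distr[OF sh]) (auto intro!: arg_cong[where f="emeasure limit_law"])
  also have "\<dots> = emeasure limit_law (window_event (k + j) ?B)" using B by (rule arg_cong)
  also have "\<dots> = lim_val (window_event (k + j) ?B)"
    by (rule emeasure_limit_law_local[OF shift_event[OF local_event[OF A]]])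
  also have "\<dots> = lim_val ?B" using B[symmetric] by (rule arg_cong)
  also have "\<dots> = lim_val ?A" by (rule lim_val_shift[OF local_event[OF A]])
  also have "\<dots> = emeasure limit_law ?A" by (rule emeasure_limit_law_local[OF A, symmetric])
  finally show "emeasure (distr limit_law lf_config_space (shift s)) ?A = emeasure limit_law ?A" .
qed simp_all

lemma tendsto_local_integral_limit_law:
  assumes f[measurable]: "f \<in> borel_measurable lf_config_space" and bound: "\<And>x. f x \<le> ennreal K"
    and loc: "\<And>x. x \<in> space lf_config_space \<Longrightarrow> f (x \<inter> win k) = f x"
  shows "((\<lambda>n. \<integral>\<^sup>+x. f x \<partial>avg n) \<longlongrightarrow> (\<integral>\<^sup>+x. f x \<partial>limit_law)) lim_filter"
proof -
  have "(\<integral>\<^sup>+x. f x \<partial>avg n) = (\<integral>\<^sup>+x. f (x \<inter> win k) \<partial>avg n)" for n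
    by (intro nn_integral_cong) (simp add: loc)
  moreover have "(\<integral>\<^sup>+x. f x \<partial>limit_law) = (\<integral>\<^sup>+x. f x \<partial>local_law k)"
  proof -
    have "(\<integral>\<^sup>+x. f x \<partial>limit_law) = (\<integral>\<^sup>+x. f (x \<inter> win k) \<partial>limit_law)" by (intro nn_integral_cong) (simp add: loc)
    then show ?thesis by (simp add: nn_integral_limit_law_local)
  qed
  ultimately show ?thesis using tendsto_local_integral[OF f bound, of k] by simp
qed

section \<open>The conditional intensity of the limit\<close>

text \<open>Segments that meet have centres at distance at most their length, so the interaction
has finite range.\<close>
lemma hit_weight_local:
  assumes u: "u \<in> win k" and R: "r \<le> real R" and x: "x \<in> space lf_config_space"
  shows "hit_weight (x \<inter> win (k + R)) u = hit_weight x u"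
proof -
  have "v \<in> win (k + R)" if v: "v \<in> x" "hits r u v" for v
  proof -
    have "norm (fst v) \<le> norm (fst u) + dist (fst u) (fst v)"
      using norm_triangle_ineq[of "fst u" "fst v - fst u"] by (simp add: dist_norm norm_minus_commute)
    also have "\<dots> < real (k + R)" using hits_dist[OF r v(2)] u R by (simp add: win_def)
    finally show ?thesis using x v(1) by (auto simp: win_def mem_space_lf_config)
  qed
  then have "{v \<in> x \<inter> win (k + R) - {u}. hits r u v} = {v \<in> x - {u}. hits r u v}" by blast
  then show ?thesis by (simp add: hit_weight_def num_hits_def)
qed

text \<open>Bounding the number of points in a window makes the sums in the GNZ formula bounded
functions.\<close>
abbreviation few :: "nat \<Rightarrow> nat \<Rightarrow> seg set set" where
  "few k N \<equiv> {x \<in> space lf_config_space. card (x \<inter> win k) \<le> N}"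

lemma few [measurable]: "few k N \<in> sets lf_config_space"
proof -
  have [measurable]: "(\<lambda>x. card (x \<inter> win k)) \<in> lf_config_space \<rightarrow>\<^sub>M count_space UNIV"
    by (rule card_measurable) auto
  show ?thesis by measurable
qed

text \<open>For a product of a bounded set of segments and a local event with a bounded number of
points, both sides of the GNZ formula are integrals of bounded functions of the configuration in
one window. The two integrals agree for the averaged processes with large index, and both
converge.\<close>
lemma GNZ_limit_law_local:
  assumes B[measurable]: "B \<in> sets seg_space" and Bk: "B \<subseteq> win k"
    and A0: "A0 \<in> sets lf_config_space"
    and A_def: "A = window_event j A0 \<inter> few k N"
  shows "(\<integral>\<^sup>+x. \<integral>\<^sup>+u. indicator (B \<times> A) (u, x - {u}) \<partial>count_space x \<partial>limit_law) =
    (\<integral>\<^sup>+u. \<integral>\<^sup>+x. hit_weight x u * indicator (B \<times> A) (u, x) \<partial>limit_law \<partial>\<rho>)"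
proof -
  interpret limit_law: prob_space limit_law by (rule prob_limit_law)
  let ?L = "lf_config_space"
  have A[measurable]: "A \<in> sets ?L" unfolding A_def using local_event[OF A0] few by blast
  obtain R where R: "r \<le> real R" using real_arch_simple by blast
  \<comment> \<open>large enough to contain the window of the event and the range of the interaction\<close>
  define J where "J = k + R + j"
  have kJ: "win k \<subseteq> win J" "win j \<subseteq> win J" by (auto simp: J_def intro: win_mono[THEN subsetD, rotated])
  define q where "q = (indicator (B \<times> A) :: seg \<times> seg set \<Rightarrow> ennreal)"
  have q[measurable]: "q \<in> borel_measurable (seg_space \<Otimes>\<^sub>M ?L)" unfolding q_def by measurable
  define F where "F x = (\<integral>\<^sup>+u. q (u, x - {u}) \<partial>count_space x) * indicator (space ?L) x" for x
  define H where "H x = (\<integral>\<^sup>+u. hit_weight x u * q (u, x) \<partial>\<rho>) * indicator (space ?L) x" for x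
  have F[measurable]: "F \<in> borel_measurable ?L" unfolding F_def by measurable
  have H[measurable]: "H \<in> borel_measurable ?L" unfolding H_def by measurable
  have A_loc: "y \<in> A \<longleftrightarrow> x \<in> A" if "x \<in> space ?L" "y = x \<inter> win J" for x y
  proof -
    have "x \<inter> win J \<inter> win j = x \<inter> win j" "x \<inter> win J \<inter> win k = x \<inter> win k" using kJ by auto
    then show ?thesis using that lf_config_subset by (auto simp: A_def)
  qed
  have q_loc: "q (u, (x \<inter> win J) - {u}) = q (u, x - {u})" if x: "x \<in> space ?L" for x u
  proof -
    have "(x \<inter> win J) - {u} = (x - {u}) \<inter> win J" by auto
    moreover have "x - {u} \<in> space ?L" by (rule lf_config_subset[OF x]) auto
    ultimately have "(x \<inter> win J) - {u} \<in> A \<longleftrightarrow> x - {u} \<in> A" by (intro A_loc)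
    then show ?thesis unfolding q_def indicator_def mem_Times_iff by simp
  qed
  have F_loc: "F (x \<inter> win J) = F x" if x: "x \<in> space ?L" for x
  proof -
    have xJ: "x \<inter> win J \<in> space ?L" by (rule lf_config_subset[OF x]) auto
    have "(\<integral>\<^sup>+u. q (u, x - {u}) \<partial>count_space x) = (\<integral>\<^sup>+u. q (u, x - {u}) * indicator {u. u \<in> win J} u \<partial>count_space x)"
      using Bk kJ by (intro nn_integral_cong) (auto simp: q_def split: split_indicator)
    also have "\<dots> = (\<integral>\<^sup>+u. q (u, x - {u}) \<partial>count_space {u \<in> x. u \<in> win J})" by (rule sum_filter_eq[symmetric])
    also have "{u \<in> x. u \<in> win J} = x \<inter> win J" by auto
    also have "(\<integral>\<^sup>+u. q (u, x - {u}) \<partial>count_space (x \<inter> win J)) = (\<integral>\<^sup>+u. q (u, (x \<inter> win J) - {u}) \<partial>count_space (x \<inter> win J))"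
      by (simp add: q_loc[OF x])
    finally show ?thesis using x xJ by (simp add: F_def)
  qed
  \<comment> \<open>a term differs from zero only if removing one point leaves at most N points in the window\<close>
  have F_bound: "F x \<le> ennreal (real (Suc N))" for x
  proof (cases "x \<in> space ?L \<and> (\<exists>u\<in>x. q (u, x - {u}) \<noteq> 0)")
    case True
    then have x: "x \<in> space ?L" by blast
    obtain u where u: "u \<in> x" "u \<in> B" "x - {u} \<in> A" using True by (auto simp: q_def split: split_indicator_asm)
    have fin: "finite (x \<inter> win k)" using x by (simp add: mem_space_lf_config)
    have "card ((x - {u}) \<inter> win k) \<le> N" using u(3) by (simp add: A_def)
    moreover have "(x - {u}) \<inter> win k = (x \<inter> win k) - {u}" by auto
    ultimately have card: "card (x \<inter> win k) \<le> Suc N" using card_Diff1_le[of "x \<inter> win k" u] u Bk fin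
      by (auto simp: card_Diff_singleton)
    have "F x \<le> (\<integral>\<^sup>+u. indicator (win k) u \<partial>count_space x)"
      using x Bk unfolding F_def by (simp, intro nn_integral_mono) (auto simp: q_def split: split_indicator)
    also have "\<dots> = ennreal (real (card (x \<inter> win k)))" using fin by (simp add: sum_indicator_eq ennreal_of_nat_eq_real_of_nat)
    also have "\<dots> \<le> ennreal (real (Suc N))" using card by (intro ennreal_leI) simp
    finally show ?thesis .
  next
    case False
    have "F x = 0"
    proof (cases "x \<in> space ?L")
      case True
      then have "(\<integral>\<^sup>+u. q (u, x - {u}) \<partial>count_space x) = (\<integral>\<^sup>+u. 0 \<partial>count_space x)"
        using False by (intro nn_integral_cong) auto
      then show ?thesis by (simp add: F_def)
    qed (simp add: F_def)
    then show ?thesis by simp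
  qed
  have H_loc: "H (x \<inter> win J) = H x" if x: "x \<in> space ?L" for x
  proof -
    have xJ: "x \<inter> win J \<in> space ?L" by (rule lf_config_subset[OF x]) auto
    have "hit_weight (x \<inter> win J) u * q (u, x \<inter> win J) = hit_weight x u * q (u, x)" for u
    proof (cases "u \<in> B")
      case True
      have "r \<le> real (R + j)" using R by simp
      then have "hit_weight (x \<inter> win J) u = hit_weight x u"
        using hit_weight_local[of u k "R + j" x] True Bk x by (auto simp: J_def add.assoc)
      then show ?thesis using A_loc[OF x refl] by (simp add: q_def indicator_def)
    qed (simp add: q_def)
    then show ?thesis using x xJ by (simp add: H_def)
  qed
  define b where "b = enn2real (emeasure \<rho> (win k))"
  have H_bound: "H x \<le> ennreal b" for x
  proof -
    have "hit_weight x u * q (u, x) \<le> indicator (win k) u" for u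
      using hit_weight_le_1[of x u] Bk by (auto simp: q_def split: split_indicator)
    then have "(\<integral>\<^sup>+u. hit_weight x u * q (u, x) \<partial>\<rho>) \<le> (\<integral>\<^sup>+u. indicator (win k) u \<partial>\<rho>)" by (intro nn_integral_mono)
    also have "\<dots> = ennreal b" using finite_win[of k] by (simp add: b_def)
    finally show ?thesis by (auto simp: H_def split: split_indicator)
  qed
  have swap: "(\<integral>\<^sup>+u. \<integral>\<^sup>+x. hit_weight x u * q (u, x) \<partial>Q \<partial>\<rho>) = (\<integral>\<^sup>+x. H x \<partial>Q)"
    if Q: "prob_space Q" "sets Q = sets ?L" for Q
  proof -
    interpret Q: prob_space Q by fact
    interpret p: pair_sigma_finite \<rho> Q ..
    note Q(2)[measurable_cong]
    have spQ: "space Q = space ?L" using Q(2) by (rule sets_eq_imp_space_eq)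
    have "(\<integral>\<^sup>+u. \<integral>\<^sup>+x. hit_weight x u * q (u, x) \<partial>Q \<partial>\<rho>) = (\<integral>\<^sup>+x. \<integral>\<^sup>+u. hit_weight x u * q (u, x) \<partial>\<rho> \<partial>Q)"
      by (rule p.Fubini'[symmetric]) measurable
    also have "\<dots> = (\<integral>\<^sup>+x. H x \<partial>Q)" by (intro nn_integral_cong) (simp add: H_def spQ)
    finally show ?thesis .
  qed
  have eq: "(\<integral>\<^sup>+x. F x \<partial>avg n) = (\<integral>\<^sup>+x. H x \<partial>avg n)" if n: "k \<le> n" for n
  proof -
    have sub: "B \<subseteq> win (Suc n)" using Bk win_mono[of k "Suc n"] n by auto
    have "(\<integral>\<^sup>+x. F x \<partial>avg n) = (\<integral>\<^sup>+x. \<integral>\<^sup>+u. q (u, x - {u}) * indicator (win (Suc n)) u \<partial>count_space x \<partial>avg n)"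
    proof (rule nn_integral_cong)
      fix x assume "x \<in> space (avg n)"
      then have "F x = (\<integral>\<^sup>+u. q (u, x - {u}) \<partial>count_space x)" by (simp add: F_def)
      also have "\<dots> = (\<integral>\<^sup>+u. q (u, x - {u}) * indicator (win (Suc n)) u \<partial>count_space x)"
        using sub by (intro nn_integral_cong) (auto simp: q_def split: split_indicator)
      finally show "F x = (\<integral>\<^sup>+u. q (u, x - {u}) * indicator (win (Suc n)) u \<partial>count_space x)" .
    qed
    also have "\<dots> = (\<integral>\<^sup>+u. (\<integral>\<^sup>+x. hit_weight x u * q (u, x) \<partial>avg n) * indicator (win (Suc n)) u \<partial>\<rho>)"
      by (rule GNZ_avg[OF q])
    also have "\<dots> = (\<integral>\<^sup>+u. \<integral>\<^sup>+x. hit_weight x u * q (u, x) \<partial>avg n \<partial>\<rho>)"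
    proof (rule nn_integral_cong)
      fix u
      have "q (u, x) = 0" if "u \<notin> win (Suc n)" for x using sub that by (auto simp: q_def split: split_indicator)
      then show "(\<integral>\<^sup>+x. hit_weight x u * q (u, x) \<partial>avg n) * indicator (win (Suc n)) u = (\<integral>\<^sup>+x. hit_weight x u * q (u, x) \<partial>avg n)"
        by (cases "u \<in> win (Suc n)") simp_all
    qed
    also have "\<dots> = (\<integral>\<^sup>+x. H x \<partial>avg n)" by (rule swap[OF prob_avg sets_avg])
    finally show ?thesis .
  qed
  have limF: "((\<lambda>n. \<integral>\<^sup>+x. F x \<partial>avg n) \<longlongrightarrow> (\<integral>\<^sup>+x. F x \<partial>limit_law)) lim_filter"
    by (rule tendsto_local_integral_limit_law[OF F F_bound F_loc])
  have limH: "((\<lambda>n. \<integral>\<^sup>+x. H x \<partial>avg n) \<longlongrightarrow> (\<integral>\<^sup>+x. H x \<partial>limit_law)) lim_filter"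
    by (rule tendsto_local_integral_limit_law[OF H H_bound H_loc])
  have "eventually (\<lambda>n. (\<integral>\<^sup>+x. F x \<partial>avg n) = (\<integral>\<^sup>+x. H x \<partial>avg n)) lim_filter"
    using eq by (intro eventually_lim_filter eventually_sequentiallyI)
  from tendsto_cong[THEN iffD1, OF this limF] have "(\<integral>\<^sup>+x. F x \<partial>limit_law) = (\<integral>\<^sup>+x. H x \<partial>limit_law)"
    using tendsto_unique[OF lim_filter(1) _ limH] by blast
  moreover have "(\<integral>\<^sup>+x. F x \<partial>limit_law) = (\<integral>\<^sup>+x. \<integral>\<^sup>+u. q (u, x - {u}) \<partial>count_space x \<partial>limit_law)"
    by (intro nn_integral_cong) (simp add: F_def)
  ultimately show ?thesis using swap[OF prob_limit_law sets_limit_law] by (simp add: q_def)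
qed


text \<open>Both sides of the GNZ formula are integrals of the test function with respect to a
measure, here the reduced Campbell measure of the process.\<close>
lemma campbell_removed:
  "\<exists>K. sets K = sets (seg_space \<Otimes>\<^sub>M lf_config_space) \<and>
    (\<forall>q\<in>borel_measurable (seg_space \<Otimes>\<^sub>M lf_config_space).
      (\<integral>\<^sup>+p. q p \<partial>K) = (\<integral>\<^sup>+x. \<integral>\<^sup>+u. q (u, x - {u}) \<partial>count_space x \<partial>limit_law))"
  (is "\<exists>K. _ \<and> (\<forall>q\<in>_. _ = ?\<Phi> q)")
proof (rule functional_as_measure)
  fix f g :: "seg \<times> seg set \<Rightarrow> ennreal"
  assume eq: "\<And>p. p \<in> space (seg_space \<Otimes>\<^sub>M lf_config_space) \<Longrightarrow> f p = g p"
  show "?\<Phi> f = ?\<Phi> g"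
  proof (intro nn_integral_cong)
    fix x u assume x: "x \<in> space limit_law" and u: "u \<in> space (count_space x)"
    have "x - {u} \<in> space lf_config_space" by (rule lf_config_subset[of x]) (use x in auto)
    moreover have "u \<in> space seg_space" using x u by (auto simp: mem_space_lf_config)
    ultimately show "f (u, x - {u}) = g (u, x - {u})" by (intro eq) (simp add: space_pair_measure)
  qed
next
  fix f g :: "seg \<times> seg set \<Rightarrow> ennreal"
  assume [measurable]: "f \<in> borel_measurable (seg_space \<Otimes>\<^sub>M lf_config_space)"
    "g \<in> borel_measurable (seg_space \<Otimes>\<^sub>M lf_config_space)"
  have "?\<Phi> (\<lambda>p. f p + g p) = (\<integral>\<^sup>+x. (\<integral>\<^sup>+u. f (u, x - {u}) \<partial>count_space x) + (\<integral>\<^sup>+u. g (u, x - {u}) \<partial>count_space x) \<partial>limit_law)"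
    by (intro nn_integral_cong nn_integral_add) auto
  also have "\<dots> = ?\<Phi> f + ?\<Phi> g" by (rule nn_integral_add) measurable
  finally show "?\<Phi> (\<lambda>p. f p + g p) = ?\<Phi> f + ?\<Phi> g" .
next
  fix f :: "seg \<times> seg set \<Rightarrow> ennreal" and c
  assume [measurable]: "f \<in> borel_measurable (seg_space \<Otimes>\<^sub>M lf_config_space)"
  have "?\<Phi> (\<lambda>p. c * f p) = (\<integral>\<^sup>+x. c * (\<integral>\<^sup>+u. f (u, x - {u}) \<partial>count_space x) \<partial>limit_law)"
    by (intro nn_integral_cong nn_integral_cmult) auto
  also have "\<dots> = c * ?\<Phi> f" by (rule nn_integral_cmult) measurable
  finally show "?\<Phi> (\<lambda>p. c * f p) = c * ?\<Phi> f" .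
next
  fix F :: "nat \<Rightarrow> seg \<times> seg set \<Rightarrow> ennreal"
  assume F[measurable]: "\<And>i. F i \<in> borel_measurable (seg_space \<Otimes>\<^sub>M lf_config_space)" and inc: "incseq F"
  have "?\<Phi> (\<lambda>p. SUP i. F i p) = (\<integral>\<^sup>+x. (SUP i. \<integral>\<^sup>+u. F i (u, x - {u}) \<partial>count_space x) \<partial>limit_law)"
    using inc by (intro nn_integral_cong nn_integral_monotone_convergence_SUP) (auto simp: incseq_def le_fun_def)
  also have "\<dots> = (SUP i. ?\<Phi> (F i))"
    using inc by (intro nn_integral_monotone_convergence_SUP)
      (measurable, auto simp: incseq_def le_fun_def intro!: nn_integral_mono)
  finally show "?\<Phi> (\<lambda>p. SUP i. F i p) = (SUP i. ?\<Phi> (F i))" .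
qed

lemma campbell_weighted:
  "\<exists>K. sets K = sets (seg_space \<Otimes>\<^sub>M lf_config_space) \<and>
    (\<forall>q\<in>borel_measurable (seg_space \<Otimes>\<^sub>M lf_config_space).
      (\<integral>\<^sup>+p. q p \<partial>K) = (\<integral>\<^sup>+u. \<integral>\<^sup>+x. hit_weight x u * q (u, x) \<partial>limit_law \<partial>\<rho>))"
proof -
  interpret limit_law: prob_space limit_law by (rule prob_limit_law)
  let ?K = "density (\<rho> \<Otimes>\<^sub>M limit_law) (\<lambda>p. hit_weight (snd p) (fst p))"
  have sets: "sets (\<rho> \<Otimes>\<^sub>M limit_law) = sets (seg_space \<Otimes>\<^sub>M lf_config_space)"
    by (intro sets_pair_measure_cong) simp_all
  have "(\<integral>\<^sup>+p. q p \<partial>?K) = (\<integral>\<^sup>+u. \<integral>\<^sup>+x. hit_weight x u * q (u, x) \<partial>limit_law \<partial>\<rho>)"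
    if [measurable]: "q \<in> borel_measurable (seg_space \<Otimes>\<^sub>M lf_config_space)" for q
  proof -
    have "(\<integral>\<^sup>+p. q p \<partial>?K) = (\<integral>\<^sup>+p. hit_weight (snd p) (fst p) * q p \<partial>(\<rho> \<Otimes>\<^sub>M limit_law))"
      by (rule nn_integral_density) measurable
    also have "\<dots> = (\<integral>\<^sup>+u. \<integral>\<^sup>+x. hit_weight x u * q (u, x) \<partial>limit_law \<partial>\<rho>)"
      by (subst limit_law.nn_integral_fst[symmetric]) auto
    finally show ?thesis .
  qed
  with sets show ?thesis by (intro exI[of _ ?K]) auto
qed

text \<open>The two Campbell measures agree on the products treated above. Fixing the first
factor, they agree for all events on the second one, since local events determine a finite
measure; the bounds on the window and on the number of points are then removed by monotone limits,
and products of measurable sets determine the measures.\<close>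
theorem GNZ_limit_law:
  assumes q: "q \<in> borel_measurable (seg_space \<Otimes>\<^sub>M lf_config_space)"
  shows "(\<integral>\<^sup>+x. \<integral>\<^sup>+u. q (u, x - {u}) \<partial>count_space x \<partial>limit_law) = (\<integral>\<^sup>+u. \<integral>\<^sup>+x. hit_weight x u * q (u, x) \<partial>limit_law \<partial>\<rho>)"
proof -
  let ?L = "lf_config_space" and ?S = "seg_space"
  interpret limit_law: prob_space limit_law by (rule prob_limit_law)
  obtain K1 where sets1[measurable_cong]: "sets K1 = sets (?S \<Otimes>\<^sub>M ?L)"
    and K1: "\<And>q. q \<in> borel_measurable (?S \<Otimes>\<^sub>M ?L) \<Longrightarrow>
      (\<integral>\<^sup>+p. q p \<partial>K1) = (\<integral>\<^sup>+x. \<integral>\<^sup>+u. q (u, x - {u}) \<partial>count_space x \<partial>limit_law)"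
    using campbell_removed by blast
  obtain K2 where sets2[measurable_cong]: "sets K2 = sets (?S \<Otimes>\<^sub>M ?L)"
    and K2: "\<And>q. q \<in> borel_measurable (?S \<Otimes>\<^sub>M ?L) \<Longrightarrow>
      (\<integral>\<^sup>+p. q p \<partial>K2) = (\<integral>\<^sup>+u. \<integral>\<^sup>+x. hit_weight x u * q (u, x) \<partial>limit_law \<partial>\<rho>)"
    using campbell_weighted by blast
  have local: "emeasure K1 (B \<times> A) = emeasure K2 (B \<times> A)"
    if B: "B \<in> sets ?S" "B \<subseteq> win k" and A0: "A0 \<in> sets ?L"
      and A: "A = {x \<in> space ?L. x \<inter> win j \<in> A0} \<inter> few k N" for B k A0 A j N
  proof -
    have "A \<in> sets ?L" unfolding A using local_event[OF A0] few by blast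
    with B have BA: "B \<times> A \<in> sets (?S \<Otimes>\<^sub>M ?L)" by simp
    have "emeasure K1 (B \<times> A) = (\<integral>\<^sup>+p. indicator (B \<times> A) p \<partial>K1)" using BA by (simp add: sets1)
    also have "\<dots> = (\<integral>\<^sup>+p. indicator (B \<times> A) p \<partial>K2)"
      using BA by (simp only: K1 K2 borel_measurable_indicator GNZ_limit_law_local[OF B A0 A])
    also have "\<dots> = emeasure K2 (B \<times> A)" using BA by (simp add: sets2)
    finally show ?thesis .
  qed
  have finite2: "emeasure K2 (win k \<times> few k N) < \<infinity>" for k N
  proof -
    have BA: "win k \<times> few k N \<in> sets (?S \<Otimes>\<^sub>M ?L)" by simp
    have "emeasure K2 (win k \<times> few k N) = (\<integral>\<^sup>+p. indicator (win k \<times> few k N) p \<partial>K2)" using BA by (simp add: sets2)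
    also have "\<dots> = (\<integral>\<^sup>+u. \<integral>\<^sup>+x. hit_weight x u * indicator (win k \<times> few k N) (u, x) \<partial>limit_law \<partial>\<rho>)"
      using BA by (intro K2) simp
    also have "\<dots> \<le> (\<integral>\<^sup>+u. indicator (win k) u \<partial>\<rho>)"
    proof (rule nn_integral_mono)
      fix u
      have "(\<integral>\<^sup>+x. hit_weight x u * indicator (win k \<times> few k N) (u, x) \<partial>limit_law) \<le> (\<integral>\<^sup>+x. indicator (win k) u \<partial>limit_law)"
        using hit_weight_le_1[of _ u] by (intro nn_integral_mono) (auto split: split_indicator)
      then show "(\<integral>\<^sup>+x. hit_weight x u * indicator (win k \<times> few k N) (u, x) \<partial>limit_law) \<le> indicator (win k) u"
        using limit_law.emeasure_space_1 by (simp del: space_limit_law)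
    qed
    also have "\<dots> < \<infinity>" using finite_win[of k] by simp
    finally show ?thesis .
  qed
  have finite1: "emeasure K1 (win k \<times> few k N) < \<infinity>" for k N
  proof -
    have "few k N = {x \<in> space ?L. x \<inter> win 0 \<in> space ?L} \<inter> few k N" using lf_config_subset by auto
    from local[OF win_sets order_refl sets.top this] finite2 show ?thesis by simp
  qed
  have few_eq: "emeasure K1 (B \<times> (A \<inter> few k N)) = emeasure K2 (B \<times> (A \<inter> few k N))"
    if B[measurable]: "B \<in> sets ?S" and Bk: "B \<subseteq> win k" and A: "A \<in> sets ?L" for B A k N
  proof -
    \<comment> \<open>the second marginals of the two Campbell measures on the given product\<close>
    define M where "M K = distr (density K (indicator (B \<times> few k N))) ?L snd" for K :: "(seg \<times> seg set) measure"
    have em: "emeasure (M K) A = emeasure K (B \<times> (A \<inter> few k N))"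
      if K: "sets K = sets (?S \<Otimes>\<^sub>M ?L)" and A[measurable]: "A \<in> sets ?L" for K A
    proof -
      note K[measurable_cong]
      have sp: "space K = space ?S \<times> space ?L" using sets_eq_imp_space_eq[OF K] by (simp add: space_pair_measure)
      have snd: "snd \<in> density K (indicator (B \<times> few k N)) \<rightarrow>\<^sub>M ?L" by measurable
      have [measurable]: "B \<times> few k N \<in> sets K" "B \<times> (A \<inter> few k N) \<in> sets K" by (simp_all add: K)
      have "emeasure (M K) A = emeasure (density K (indicator (B \<times> few k N))) (snd -` A \<inter> space K)"
        unfolding M_def by (subst emeasure_distr[OF snd A]) simp
      also have "\<dots> = (\<integral>\<^sup>+p. indicator (B \<times> few k N) p * indicator (snd -` A \<inter> space K) p \<partial>K)"
        by (rule emeasure_density) measurable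
      also have "\<dots> = (\<integral>\<^sup>+p. indicator (B \<times> (A \<inter> few k N)) p \<partial>K)"
        by (intro nn_integral_cong) (auto simp: sp split: split_indicator)
      finally show ?thesis by simp
    qed
    have "M K1 = M K2"
    proof (rule measures_eq_on_local_events)
      show "finite_measure (M K1)"
      proof
        have "emeasure (M K1) (space (M K1)) = emeasure K1 (B \<times> (space ?L \<inter> few k N))"
          using em[OF sets1 sets.top] by (simp add: M_def)
        also have "\<dots> \<le> emeasure K1 (win k \<times> few k N)"
          using Bk by (intro emeasure_mono) (auto simp: sets1)
        finally show "emeasure (M K1) (space (M K1)) \<noteq> \<infinity>" using finite1[of k N] by (auto simp: top_unique)
      qed
      fix j A0 assume A0: "A0 \<in> sets ?L"
      show "emeasure (M K1) {x \<in> space ?L. x \<inter> win j \<in> A0} = emeasure (M K2) {x \<in> space ?L. x \<inter> win j \<in> A0}"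
        unfolding em[OF sets1 local_event[OF A0]] em[OF sets2 local_event[OF A0]]
        by (rule local[OF B Bk A0 refl])
    qed (simp_all add: M_def)
    then show ?thesis using em[OF sets1 A] em[OF sets2 A] by simp
  qed
  have approx: "emeasure K (B \<times> A) = (SUP k. SUP N. emeasure K ((B \<inter> win k) \<times> (A \<inter> few k N)))"
    if K: "sets K = sets (?S \<Otimes>\<^sub>M ?L)" and B[measurable]: "B \<in> sets ?S" and A[measurable]: "A \<in> sets ?L" for K B A
  proof -
    have "(SUP N. emeasure K ((B \<inter> win k) \<times> (A \<inter> few k N))) = emeasure K ((B \<inter> win k) \<times> A)" for k
    proof (subst SUP_emeasure_incseq)
      show "range (\<lambda>N. (B \<inter> win k) \<times> (A \<inter> few k N)) \<subseteq> sets K" by (auto simp: K)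
      show "incseq (\<lambda>N. (B \<inter> win k) \<times> (A \<inter> few k N))" by (auto simp: incseq_def)
      have "(\<Union>N. (B \<inter> win k) \<times> (A \<inter> few k N)) = (B \<inter> win k) \<times> A"
        using sets.sets_into_space[OF A] by auto
      then show "emeasure K (\<Union>N. (B \<inter> win k) \<times> (A \<inter> few k N)) = emeasure K ((B \<inter> win k) \<times> A)" by simp
    qed
    moreover have "(SUP k. emeasure K ((B \<inter> win k) \<times> A)) = emeasure K (B \<times> A)"
    proof (subst SUP_emeasure_incseq)
      show "range (\<lambda>k. (B \<inter> win k) \<times> A) \<subseteq> sets K" by (auto simp: K)
      show "incseq (\<lambda>k. (B \<inter> win k) \<times> A)" using win_mono by (fastforce simp: incseq_def)
      have "(\<Union>k. (B \<inter> win k) \<times> A) = B \<times> A"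
        using sets.sets_into_space[OF B] mem_some_win by blast
      then show "emeasure K (\<Union>k. (B \<inter> win k) \<times> A) = emeasure K (B \<times> A)" by simp
    qed
    ultimately show ?thesis by simp
  qed
  let ?E = "{a \<times> b | a b. a \<in> sets ?S \<and> b \<in> sets ?L}"
  have "K1 = K2"
  proof (rule measure_eqI_generator_eq_countable)
    show "Int_stable ?E" by (rule Int_stable_pair_measure_generator)
    show "?E \<subseteq> Pow (space ?S \<times> space ?L)" by (rule pair_measure_closed)
    show "sets K1 = sigma_sets (space ?S \<times> space ?L) ?E" "sets K2 = sigma_sets (space ?S \<times> space ?L) ?E"
      unfolding sets1 sets2 sets_pair_measure by (rule refl)+
    show "emeasure K1 X = emeasure K2 X" if XE: "X \<in> ?E" for X
    proof -
      obtain B A where X: "X = B \<times> A" and B: "B \<in> sets ?S" and A: "A \<in> sets ?L" using XE by blast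
      have "emeasure K1 ((B \<inter> win k) \<times> (A \<inter> few k N)) = emeasure K2 ((B \<inter> win k) \<times> (A \<inter> few k N))" for k N
        using B A by (intro few_eq) auto
      then show ?thesis unfolding X approx[OF sets1 B A] approx[OF sets2 B A] by simp
    qed
    let ?C = "range (\<lambda>(k, N). win k \<times> few k N)"
    show "?C \<subseteq> ?E"
    proof safe
      fix k N
      have "win k \<in> sets ?S" "few k N \<in> sets ?L" by (rule win_sets, rule few)
      then show "\<exists>a b. win k \<times> few k N = a \<times> b \<and> a \<in> sets ?S \<and> b \<in> sets ?L" by blast
    qed
    show "countable ?C" by simp
    show "\<Union>?C = space ?S \<times> space ?L"
    proof (intro equalityI subsetI)
      fix p assume "p \<in> space ?S \<times> space ?L"
      then obtain k where "fst p \<in> win k" "snd p \<in> few k (card (snd p \<inter> win k))"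
        using mem_some_win[of "fst p"] by auto
      then show "p \<in> \<Union>?C" by (cases p) auto
    qed (auto simp: win_def)
    show "emeasure K1 a \<noteq> \<infinity>" if "a \<in> ?C" for a using that finite1 by (auto simp: less_top)
  qed
  with K1[OF q] K2[OF q] show ?thesis by simp
qed

lemma segment_process_limit_law: "segment_process limit_law (\<lambda>x. x)"
proof -
  have "(\<lambda>x. x) \<in> lf_config_space \<rightarrow>\<^sub>M config_space"
    unfolding lf_config_space_def by (rule measurable_restrict_space1) simp
  then have "(\<lambda>x. x) \<in> limit_law \<rightarrow>\<^sub>M config_space" by (simp cong: measurable_cong_sets)
  moreover have "AE x in limit_law. locally_finite x"
    by (rule AE_I2) (simp add: lf_config_space_def space_restrict_space)
  ultimately show ?thesis unfolding segment_process_def using prob_limit_law by simp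
qed

lemma stationary_limit_law: "stationary limit_law (\<lambda>x. x)"
  unfolding stationary_def
proof
  fix t
  have id: "(\<lambda>x. x) \<in> lf_config_space \<rightarrow>\<^sub>M config_space"
    unfolding lf_config_space_def by (rule measurable_restrict_space1) simp
  have sh: "shift t \<in> limit_law \<rightarrow>\<^sub>M lf_config_space" by measurable
  have "distr limit_law config_space (\<lambda>x. shift t x) = distr (distr limit_law lf_config_space (shift t)) config_space (\<lambda>x. x)"
    using distr_distr[OF id sh] by (simp add: comp_def)
  then show "distr limit_law config_space (\<lambda>\<omega>. shift t \<omega>) = distr limit_law config_space (\<lambda>x. x)"
    by (simp add: distr_shift_limit_law)
qed

lemma conditional_intensity_limit_law:
  "has_conditional_intensity limit_law (\<lambda>x. x) (\<lambda>x u. ennreal (\<tau> * g (snd u) * exp (a * real (num_hits r x u))))"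
proof -
  let ?lam = "\<lambda>x u. ennreal (\<tau> * g (snd u) * exp (a * real (num_hits r x u)))"
  have lam: "?lam x u = dens u * hit_weight x u" if "u \<in> space seg_space" for x u
    using that g_nonneg[of "snd u"] \<tau>
    by (auto simp: dens_def hit_weight_def space_seg_space mem_Times_iff ennreal_mult)
  have "(\<lambda>p. dens (fst p) * hit_weight (snd p) (fst p)) \<in> borel_measurable (seg_space \<Otimes>\<^sub>M lf_config_space)"
    by measurable
  then have meas: "(\<lambda>(u, x). ?lam x u) \<in> borel_measurable (seg_space \<Otimes>\<^sub>M lf_config_space)"
    by (rule measurable_cong[THEN iffD1, rotated]) (simp add: case_prod_unfold space_pair_measure mem_Times_iff lam)
  have "(\<integral>\<^sup>+x. \<integral>\<^sup>+u. q (u, x - {u}) \<partial>count_space x \<partial>limit_law) = (\<integral>\<^sup>+u. \<integral>\<^sup>+x. ?lam x u * q (u, x) \<partial>limit_law \<partial>ref_measure)"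
    if q[measurable]: "q \<in> borel_measurable (seg_space \<Otimes>\<^sub>M lf_config_space)" for q
  proof -
    interpret limit_law: prob_space limit_law by (rule prob_limit_law)
    have "(\<integral>\<^sup>+x. \<integral>\<^sup>+u. q (u, x - {u}) \<partial>count_space x \<partial>limit_law) = (\<integral>\<^sup>+u. \<integral>\<^sup>+x. hit_weight x u * q (u, x) \<partial>limit_law \<partial>\<rho>)"
      by (rule GNZ_limit_law[OF q])
    also have "\<dots> = (\<integral>\<^sup>+u. dens u * (\<integral>\<^sup>+x. hit_weight x u * q (u, x) \<partial>limit_law) \<partial>ref_measure)"
      by (rule nn_integral_\<rho>) measurable
    also have "\<dots> = (\<integral>\<^sup>+u. \<integral>\<^sup>+x. ?lam x u * q (u, x) \<partial>limit_law \<partial>ref_measure)"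
    proof (rule nn_integral_cong)
      fix u assume "u \<in> space ref_measure"
      then have u[measurable]: "u \<in> space seg_space" by simp
      have "dens u * (\<integral>\<^sup>+x. hit_weight x u * q (u, x) \<partial>limit_law) = (\<integral>\<^sup>+x. dens u * (hit_weight x u * q (u, x)) \<partial>limit_law)"
        by (rule nn_integral_cmult[symmetric]) measurable
      then show "dens u * (\<integral>\<^sup>+x. hit_weight x u * q (u, x) \<partial>limit_law) = (\<integral>\<^sup>+x. ?lam x u * q (u, x) \<partial>limit_law)"
        unfolding lam[OF u] by (simp only: mult.assoc)
    qed
    finally show ?thesis .
  qed
  with meas show ?thesis unfolding has_conditional_intensity_def by blast
qed

end

theorem corollary1:
  fixes r a \<tau> :: real and g :: "real \<Rightarrow> real"
  assumes "r > 0" and "a \<le> 0" and "\<tau> > 0"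
    and "g \<in> borel_measurable (restrict_space borel {0..<pi})"
    and "\<And>\<phi>. \<phi> \<in> {0..<pi} \<Longrightarrow> g \<phi> \<ge> 0"
    and "(\<integral>\<^sup>+\<phi>. ennreal (g \<phi>) \<partial>restrict_space lborel {0..<pi}) = 1"
  shows "\<exists>(M :: seg set measure) (X :: seg set \<Rightarrow> seg set).
    segment_process M X \<and> stationary M X \<and>
    has_conditional_intensity M X
      (\<lambda>x u. ennreal (\<tau> * g (snd u) * exp (a * real (num_hits r x u))))"
proof -
  interpret segment_gibbs r a \<tau> g using assms by unfold_locales
  show ?thesis using segment_process_limit_law stationary_limit_law conditional_intensity_limit_law by blast
qed

end
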